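(* Let $(\Gamma,\mu,\pi)$ be a $\delta$-book-like graph with pages $\Gamma_1,\dots,\Gamma_l$ and spine $\Gamma_0$, where each page $\Gamma_i$, $i=1,\dots,l$, is Harnack and uniform in $\Gamma$. Then there exist constants $C,c_1,c_2,c_1',c_2'>0$ such that for all $v,w\in\Gamma_0$ and all integers $m\ge C(d_\Gamma(v,w)+\delta)$, $$p(m,v,w)\le \frac{c_1}{\sqrt{V_{\min}(v,\sqrt m)\,V_{\min}(w,\sqrt m)}}\exp\Big(-\frac{d_\Gamma^2(v,w)}{c_2m}\Big)\le \frac{c_1'}{\min_{1\le i\le l}V_i(v_i,\sqrt m)}\exp\Big(-\frac{d_\Gamma^2(v,w)}{c_2'm}\Big),$$ where $v_i$ is a closest point to $v$ in $\Gamma_i$ (with respect to $d_\Gamma$), and for $z\in\Gamma_0$, $r>0$, $B=B(z,r)$, $$V_{\min}(z,r)=\min_{1\le i\le l}\ \min_{y\in[B]_\delta\cap\Gamma_i\cap[\Gamma_0]_\delta}V_i(y,r).$$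
   Context: **Weighted graphs.** Graphs are simple (no loops, no multiple edges) and connected unless stated otherwise. A graph $\Gamma=(V,E)$ carries vertex weights $\pi>0$ and symmetric edge weights $\mu_{xy}=\mu_{yx}\ge 0$ with $\mu_{xy}\neq0\iff\{x,y\}\in E$ (adapted) and $\sum_{y\sim x}\mu_{xy}\le\pi(x)$ (subordinate). Standing assumptions: controlled weights (there is $C_c>1$ with $\mu_{xy}/\pi(x)\ge 1/C_c$ whenever $y\sim x$) and uniform laziness (there is $C_e\in(0,1)$ with $\sum_{y\sim x}\mu_{xy}\le(1-C_e)\pi(x)$ for all $x$). The Markov kernel is $\mathcal K(x,y)=\mu_{xy}/\pi(x)$ for $x\ne y$ and $\mathcal K(x,x)=1-\sum_{z\sim x}\mu_{xz}/\pi(x)$; $\mathcal K^n$ is its $n$-th power; the heat kernel is $p(n,x,y)=\mathcal K^n(x,y)/\pi(y)$. $d=d_\Gamma$ is graph distance, $B(x,r)=\{y:d(x,y)\le r\}$, $V(x,r)=\pi(B(x,r))$, and $[A]_s=\{y\in\Gamma:d_\Gamma(y,A)\le s\}$. Quantities with index $i$ ($d_i,B_i,V_i$) are computed in the page $\Gamma_i$, as a graph in its own right, with weights $\pi_i,\mu^i$. **Graph with pages and spine.** Such a graph is obtained by gluing or by cutting. Gluing: let $(\Gamma_i,\pi_i,\mu^i)$, $1\le i\le l$, be infinite graphs (pages) with marked vertex sets $G_i\subset\Gamma_i$, and let $(\Gamma_0,\pi_0,\mu^0)$ be a graph (spine), possibly disconnected, with symmetric, adapted, subordinate, controlled and uniformly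 lazy weights, containing (not necessarily disjoint) vertex sets $G_i'$ with bijections $G_i\leftrightarrow G_i'$. Identified vertices $x\in G_i$, $x'\in G_i'$ satisfy $c_I\pi_0(x')\le\pi_i(x)\le C_I\pi_0(x')$ with uniform constants $c_I,C_I>0$. (A vertex $x'$ with no neighbors in $\Gamma_0$ is also allowed to have $\pi_0(x')=0$; then instead $c_I\pi_j(x_j)\le\pi_i(x_i)\le C_I\pi_j(x_j)$ is required whenever $x_i\in\Gamma_i$, $x_j\in\Gamma_j$ are both identified with $x'$.) $\Gamma$ is the graph obtained by making these identifications, with $\pi=\sum_{i=0}^l\pi_i$, $\mu=\sum_{i=0}^l\mu^i$ (terms being $0$ where undefined). It is required that $\Gamma$ is connected; that $[\Gamma_0]_\alpha$ is connected in $\Gamma$ for some $\alpha>0$; and that, in $\Gamma$, the inner boundary $\partial_I\Gamma_i=\{x\in\Gamma_i:\exists y\in\Gamma\setminus\Gamma_i,\ y\sim x\}$ equals $G_i$ for $1\le i\le l$. Cutting: start from $(\Gamma,\pi,\mu)$ and a vertex set $\Gamma_0$ whose removal leaves finitely many connected components, all infinite; the page $\Gamma_i$ is the $i$-th component together with the set $G_i\subset\Gamma_0$ of vertices adjacent to it; pages and spine carry weights comparable to those of $\Gamma$ ($c_B\pi\le\pi_i\le C_B\pi$ on $\Gamma_i$, similarly for edge weights; $\pi_0=0$ allowed at vertices isolated in $\Gamma_0$); $\Gamma_0$ is $\alpha$-connected in $\Gamma$, and every vertex of $\Gamma_0$ either has all neighbors in $\Gamma_0$ or has neighbors in $\Gamma_i$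 and $\Gamma_j$ for some $i\neq j$ in $\{0,\dots,l\}$. **Book-like.** For $\delta>0$, $\Gamma$ is $\delta$-book-like if $d_\Gamma(v,\Gamma_i)\le\delta$ for all $v\in\Gamma_0$ and all $1\le i\le l$. **Uniform.** A subgraph $\Gamma'$ of $\widehat\Gamma$ is uniform in $\widehat\Gamma$ if there are $0<c_u,C_U<\infty$ such that any $x,y\in\Gamma'$ are joined by a path $(x_0=x,\dots,x_k=y)$ in $\Gamma'$ with $k\le C_Ud_{\widehat\Gamma}(x,y)$ and $d_{\widehat\Gamma}(x_j,\widehat\Gamma\setminus\Gamma')\ge c_u(1+\min\{j,k-j\})$ for $0\le j\le k$. **Harnack graph.** A graph that is doubling (there is $D$ with $V(x,2r)\le DV(x,r)$ for all $x$, $r>0$) and satisfies the Poincaré inequality: there are $C_p>0,\kappa\ge1$ such that for all $x$, $r>0$ and functions $f$ on $B(x,\kappa r)$, $\sum_{y\in B(x,r)}|f(y)-f_B|^2\pi(y)\le C_pr^2\sum_{y,z\in B(x,\kappa r)}|f(y)-f(z)|^2\mu_{yz}$, where $f_B$ is the $\pi$-average of $f$ over $B(x,r)$. *)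

theory Defs
  imports "HOL-Analysis.Analysis"
begin

(* Edges form a symmetric irreflexive relation; edge weights are only meaningful on pairs of
   vertices, vertex weights only on vertices. *)
record 'a wgraph =
  verts :: "'a set"
  edges :: "('a \<times> 'a) set"
  vw :: "'a \<Rightarrow> real"
  ew :: "'a \<Rightarrow> 'a \<Rightarrow> real"

definition nbrs :: "'a wgraph \<Rightarrow> 'a \<Rightarrow> 'a set" where
  "nbrs G x = {y. (x, y) \<in> edges G}"

definition simple_graph :: "'a wgraph \<Rightarrow> bool" where
  "simple_graph G \<longleftrightarrow>
     edges G \<subseteq> verts G \<times> verts G \<and> sym (edges G) \<and> irrefl (edges G)"

definition adapted :: "'a wgraph \<Rightarrow> bool" where
  "adapted G \<longleftrightarrow>
     (\<forall>x\<in>verts G. \<forall>y\<in>verts G.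
        ew G x y = ew G y x \<and> 0 \<le> ew G x y \<and> (ew G x y \<noteq> 0 \<longleftrightarrow> (x, y) \<in> edges G))"

(* Local finiteness follows from controlled weights together with boundedness of the partial
   sums by the vertex weight; it is explicit because the sum over an infinite set is 0 in HOL. *)
definition subordinate :: "'a wgraph \<Rightarrow> bool" where
  "subordinate G \<longleftrightarrow>
     (\<forall>x\<in>verts G. finite (nbrs G x) \<and> (\<Sum>y\<in>nbrs G x. ew G x y) \<le> vw G x)"

definition controlled :: "'a wgraph \<Rightarrow> bool" where
  "controlled G \<longleftrightarrow>
     (\<exists>Cc>1. \<forall>x\<in>verts G. \<forall>y\<in>nbrs G x. ew G x y / vw G x \<ge> 1 / Cc)"

definition uniformly_lazy :: "'a wgraph \<Rightarrow> bool" where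
  "uniformly_lazy G \<longleftrightarrow>
     (\<exists>Ce. 0 < Ce \<and> Ce < 1 \<and>
       (\<forall>x\<in>verts G. (\<Sum>y\<in>nbrs G x. ew G x y) \<le> (1 - Ce) * vw G x))"

definition standing_weights :: "'a wgraph \<Rightarrow> bool" where
  "standing_weights G \<longleftrightarrow>
     simple_graph G \<and> adapted G \<and> subordinate G \<and> controlled G \<and> uniformly_lazy G"

(* Connectedness of the subgraph of G induced on S. *)
definition connected_in :: "'a wgraph \<Rightarrow> 'a set \<Rightarrow> bool" where
  "connected_in G S \<longleftrightarrow> (\<forall>x\<in>S. \<forall>y\<in>S. (x, y) \<in> (edges G \<inter> S \<times> S)\<^sup>*)"

definition weighted_graph :: "'a wgraph \<Rightarrow> bool" where
  "weighted_graph G \<longleftrightarrow>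
     standing_weights G \<and> (\<forall>x\<in>verts G. 0 < vw G x) \<and> connected_in G (verts G)"

(* Possibly disconnected; vertex weight 0 is allowed at isolated vertices. *)
definition spine_graph :: "'a wgraph \<Rightarrow> bool" where
  "spine_graph G \<longleftrightarrow>
     standing_weights G \<and> (\<forall>x\<in>verts G. 0 < vw G x \<or> (vw G x = 0 \<and> nbrs G x = {}))"

(* Only ever applied to vertices of connected graphs (the whole graph or a page), so that the
   set of walk lengths is nonempty. *)
definition gdist :: "'a wgraph \<Rightarrow> 'a \<Rightarrow> 'a \<Rightarrow> nat" where
  "gdist G x y = (LEAST n. (x, y) \<in> edges G ^^ n)"

definition gball :: "'a wgraph \<Rightarrow> 'a \<Rightarrow> real \<Rightarrow> 'a set" where
  "gball G x r = {y \<in> verts G. real (gdist G x y) \<le> r}"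

definition vol :: "'a wgraph \<Rightarrow> 'a \<Rightarrow> real \<Rightarrow> real" where
  "vol G x r = (\<Sum>y\<in>gball G x r. vw G y)"

(* Distances are natural numbers, so the distance to a nonempty set is attained. *)
definition nbhd :: "'a wgraph \<Rightarrow> 'a set \<Rightarrow> real \<Rightarrow> 'a set" where
  "nbhd G A s = {y \<in> verts G. \<exists>a\<in>A. real (gdist G y a) \<le> s}"

definition inner_boundary :: "'a wgraph \<Rightarrow> 'a set \<Rightarrow> 'a set" where
  "inner_boundary G S = {x \<in> S. \<exists>y\<in>verts G - S. (y, x) \<in> edges G}"

definition markov :: "'a wgraph \<Rightarrow> 'a \<Rightarrow> 'a \<Rightarrow> real" where
  "markov G x y =
     (if x = y then 1 - (\<Sum>z\<in>nbrs G x. ew G x z / vw G x) else ew G x y / vw G x)"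

fun markov_pow :: "'a wgraph \<Rightarrow> nat \<Rightarrow> 'a \<Rightarrow> 'a \<Rightarrow> real" where
  "markov_pow G 0 x y = (if x = y then 1 else 0)"
| "markov_pow G (Suc n) x y = (\<Sum>\<^sub>\<infinity>z\<in>verts G. markov G x z * markov_pow G n z y)"

definition heat_kernel :: "'a wgraph \<Rightarrow> nat \<Rightarrow> 'a \<Rightarrow> 'a \<Rightarrow> real" where
  "heat_kernel G n x y = markov_pow G n x y / vw G y"

definition doubling :: "'a wgraph \<Rightarrow> bool" where
  "doubling G \<longleftrightarrow> (\<exists>D. \<forall>x\<in>verts G. \<forall>r>0. vol G x (2 * r) \<le> D * vol G x r)"

definition ball_avg :: "'a wgraph \<Rightarrow> ('a \<Rightarrow> real) \<Rightarrow> 'a \<Rightarrow> real \<Rightarrow> real" where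
  "ball_avg G f x r = (\<Sum>y\<in>gball G x r. f y * vw G y) / vol G x r"

definition poincare :: "'a wgraph \<Rightarrow> bool" where
  "poincare G \<longleftrightarrow>
     (\<exists>Cp>0. \<exists>\<kappa>\<ge>1. \<forall>x\<in>verts G. \<forall>r>0. \<forall>f :: 'a \<Rightarrow> real.
        (\<Sum>y\<in>gball G x r. \<bar>f y - ball_avg G f x r\<bar>\<^sup>2 * vw G y)
        \<le> Cp * r\<^sup>2 *
           (\<Sum>y\<in>gball G x (\<kappa> * r). \<Sum>z\<in>gball G x (\<kappa> * r). \<bar>f y - f z\<bar>\<^sup>2 * ew G y z))"

definition harnack :: "'a wgraph \<Rightarrow> bool" where
  "harnack G \<longleftrightarrow> doubling G \<and> poincare G"

(* Quantifying over all z outside H treats the distance to an empty complement as infinite. *)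
definition uniform_in :: "'a wgraph \<Rightarrow> 'a wgraph \<Rightarrow> bool" where
  "uniform_in H G \<longleftrightarrow>
     (\<exists>cu>0. \<exists>CU>0. \<forall>x\<in>verts H. \<forall>y\<in>verts H. \<exists>(k::nat) p.
        p 0 = x \<and> p k = y \<and>
        (\<forall>j\<le>k. p j \<in> verts H) \<and> (\<forall>j<k. (p j, p (Suc j)) \<in> edges H) \<and>
        real k \<le> CU * real (gdist G x y) \<and>
        (\<forall>j\<le>k. \<forall>z\<in>verts G - verts H.
           real (gdist G (p j) z) \<ge> cu * (1 + real (min j (k - j)))))"

(* P 0 is the spine and P 1, ..., P l are the pages, all represented by their copies inside the
   glued graph: identified vertices are literally equal.  The marked set of page i (and its
   partner in the spine) is therefore verts (P i) \<inter> verts (P 0), and no vertices are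
   shared between two pages except through the spine. *)
definition glued :: "'a wgraph \<Rightarrow> (nat \<Rightarrow> 'a wgraph) \<Rightarrow> nat \<Rightarrow> bool" where
  "glued G P l \<longleftrightarrow>
     spine_graph (P 0) \<and>
     (\<forall>i\<in>{1..l}. weighted_graph (P i) \<and> infinite (verts (P i))) \<and>
     (\<forall>i\<in>{1..l}. \<forall>j\<in>{1..l}. i \<noteq> j \<longrightarrow> verts (P i) \<inter> verts (P j) \<subseteq> verts (P 0)) \<and>
     (\<exists>cI>0. \<exists>CI>0.
        (\<forall>i\<in>{1..l}. \<forall>x\<in>verts (P i) \<inter> verts (P 0). vw (P 0) x \<noteq> 0 \<longrightarrow>
           cI * vw (P 0) x \<le> vw (P i) x \<and> vw (P i) x \<le> CI * vw (P 0) x) \<and>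
        (\<forall>i\<in>{1..l}. \<forall>j\<in>{1..l}. \<forall>x\<in>verts (P i) \<inter> verts (P j) \<inter> verts (P 0).
           vw (P 0) x = 0 \<longrightarrow>
           cI * vw (P j) x \<le> vw (P i) x \<and> vw (P i) x \<le> CI * vw (P j) x)) \<and>
     verts G = (\<Union>i\<le>l. verts (P i)) \<and>
     edges G = (\<Union>i\<le>l. edges (P i)) \<and>
     (\<forall>x\<in>verts G. vw G x = (\<Sum>i | i \<le> l \<and> x \<in> verts (P i). vw (P i) x)) \<and>
     (\<forall>x\<in>verts G. \<forall>y\<in>verts G.
        ew G x y = (\<Sum>i | i \<le> l \<and> x \<in> verts (P i) \<and> y \<in> verts (P i). ew (P i) x y)) \<and>
     connected_in G (verts G) \<and>
     (\<exists>\<alpha>>0. connected_in G (nbhd G (verts (P 0)) \<alpha>)) \<and>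
     (\<forall>i\<in>{1..l}. inner_boundary G (verts (P i)) = verts (P i) \<inter> verts (P 0))"

definition graph_components :: "'a wgraph \<Rightarrow> 'a set \<Rightarrow> 'a set set" where
  "graph_components G S = {{y. (x, y) \<in> (edges G \<inter> S \<times> S)\<^sup>*} | x. x \<in> S}"

(* Pages and spine are induced subgraphs of G, with their own weights. *)
definition cut :: "'a wgraph \<Rightarrow> (nat \<Rightarrow> 'a wgraph) \<Rightarrow> nat \<Rightarrow> bool" where
  "cut G P l \<longleftrightarrow>
     weighted_graph G \<and>
     verts (P 0) \<subseteq> verts G \<and>
     (\<exists>K. bij_betw K {1..l} (graph_components G (verts G - verts (P 0))) \<and>
        (\<forall>i\<in>{1..l}. infinite (K i) \<and>
           verts (P i) = K i \<union> {x \<in> verts (P 0). \<exists>y\<in>K i. (x, y) \<in> edges G})) \<and>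
     spine_graph (P 0) \<and>
     (\<forall>i\<in>{1..l}. weighted_graph (P i)) \<and>
     (\<forall>i\<le>l. edges (P i) = edges G \<inter> verts (P i) \<times> verts (P i)) \<and>
     (\<exists>cB>0. \<exists>CB>0. \<forall>i\<le>l.
        (\<forall>x\<in>verts (P i).
           (cB * vw G x \<le> vw (P i) x \<and> vw (P i) x \<le> CB * vw G x) \<or>
           (i = 0 \<and> vw (P 0) x = 0 \<and> nbrs (P 0) x = {})) \<and>
        (\<forall>(x, y)\<in>edges (P i).
           cB * ew G x y \<le> ew (P i) x y \<and> ew (P i) x y \<le> CB * ew G x y)) \<and>
     (\<exists>\<alpha>>0. connected_in G (nbhd G (verts (P 0)) \<alpha>)) \<and>
     (\<forall>x\<in>verts (P 0).
        nbrs G x \<subseteq> verts (P 0) \<or>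
        (\<exists>i\<le>l. \<exists>j\<le>l. i \<noteq> j \<and>
           nbrs G x \<inter> verts (P i) \<noteq> {} \<and> nbrs G x \<inter> verts (P j) \<noteq> {}))"

definition pages_and_spine :: "'a wgraph \<Rightarrow> (nat \<Rightarrow> 'a wgraph) \<Rightarrow> nat \<Rightarrow> bool" where
  "pages_and_spine G P l \<longleftrightarrow> 1 \<le> l \<and> (glued G P l \<or> cut G P l)"

definition book_like :: "real \<Rightarrow> 'a wgraph \<Rightarrow> (nat \<Rightarrow> 'a wgraph) \<Rightarrow> nat \<Rightarrow> bool" where
  "book_like \<delta> G P l \<longleftrightarrow>
     (\<forall>v\<in>verts (P 0). \<forall>i\<in>{1..l}. \<exists>u\<in>verts (P i). real (gdist G v u) \<le> \<delta>)"

(* For a book-like graph with l \<ge> 1 and z in the spine, both minima are over finite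
   nonempty sets. *)
definition Vmin ::
  "'a wgraph \<Rightarrow> (nat \<Rightarrow> 'a wgraph) \<Rightarrow> nat \<Rightarrow> real \<Rightarrow> 'a \<Rightarrow> real \<Rightarrow> real" where
  "Vmin G P l \<delta> z r =
     (MIN i\<in>{1..l}.
        MIN y\<in>nbhd G (gball G z r) \<delta> \<inter> verts (P i) \<inter> nbhd G (verts (P 0)) \<delta>.
          vol (P i) y r)"

end

(*
  On each page, averaging the Poincare inequality over balls of radius s gives a Nash inequality at
  every scale s, with the volumes of the page. Vertices of the spine are within distance delta of a
  page, so these inequalities add up to one on the whole graph: for v in the spine, any F below all
  page volumes at radius r near v, and s <= r,
    |f|_2^2 <= C s^2 E(f, f) + (C / F) (r / s)^(2 q) |f rho|_1^2,
  where rho(x) = exp (2 q d(v, x) / r) compensates for the change of volume away from v. (Doubling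
  and uniformity allow this, the latter because it makes page distances comparable to those of the
  whole graph.)
  Iterating over L^p, p = 2, 4, 8, ..., as in the method of Carlen, Kusuoka and Stroock, with
  weights exp (c d(v, .) / r), bounds the kernel from weighted L^2 to L^infinity. Davies' method then
  yields the Gaussian factor: symmetry and Chapman-Kolmogorov give
    p(m, v, w) <= C (F_v F_w)^(-1/2) exp (C m / r^2 - d(v, w) / r),
  and r is chosen of order m / d(v, w), or of order sqrt m if d(v, w) <= sqrt m. The kernel is killed
  outside a large ball, so that all sums are finite; this does not change p(m, v, w).
*)
theory Submission
  imports Defs
begin

section \<open>Nash inequalities and smoothing of reversible kernels\<close>

text \<open>Nash's usual argument starts from the conservation of the L^1 norm. Here F bounds page
  volumes only near v, which forces the weight rho, and the weighted L^1 norm is out of control: the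
  available bound for one step is a factor 1 + O(1 / r), hence exp (O(r)) over the r^2 steps that
  are needed. In L^2, symmetry cancels the first-order term of an exponential twist and leaves 1 +
  O(1 / r^2), harmless over r^2 steps. So the iteration starts at p = 2, and the L^1 norm that the
  Nash inequality asks for is that of a p-th power, that is, an L^p norm bounded one level earlier.
  On p-th powers a twist of slope c / r becomes one of slope p c / r, at a cost of order (p c / r)^2
  per step. Level p can therefore last only about r^2 / p^2 steps, which is also why all levels fit
  into time r^2. The iteration must stop at p of order r, where a single step already changes the
  weight by a constant factor. By then the L^p norm controls the value at one vertex, because a
  factor r^(2 q) stays bounded under a root of order r.\<close>

lemma weighted_Cauchy_Schwarz_sum:
  fixes c u :: "'a \<Rightarrow> real"
  assumes "\<And>i. i \<in> I \<Longrightarrow> 0 \<le> c i"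
  shows "(\<Sum>i\<in>I. c i * u i)\<^sup>2 \<le> (\<Sum>i\<in>I. c i) * (\<Sum>i\<in>I. c i * (u i)\<^sup>2)"
proof -
  have "(\<Sum>i\<in>I. sqrt (c i) * (sqrt (c i) * u i))\<^sup>2
      \<le> (\<Sum>i\<in>I. (sqrt (c i))\<^sup>2) * (\<Sum>i\<in>I. (sqrt (c i) * u i)\<^sup>2)"
    by (rule Cauchy_Schwarz_ineq_sum)
  also have "(\<Sum>i\<in>I. sqrt (c i) * (sqrt (c i) * u i)) = (\<Sum>i\<in>I. c i * u i)"
    by (rule sum.cong) (use assms in \<open>auto simp: mult.assoc[symmetric] real_sqrt_mult_self\<close>)
  also have "(\<Sum>i\<in>I. (sqrt (c i))\<^sup>2) = (\<Sum>i\<in>I. c i)"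
    by (rule sum.cong) (use assms in auto)
  also have "(\<Sum>i\<in>I. (sqrt (c i) * u i)\<^sup>2) = (\<Sum>i\<in>I. c i * (u i)\<^sup>2)"
    by (rule sum.cong) (use assms in \<open>auto simp: power_mult_distrib\<close>)
  finally show ?thesis .
qed

lemma exp_le_quadratic:
  fixes t :: real
  assumes "\<bar>t\<bar> \<le> 1"
  shows "exp t \<le> 1 + t + t\<^sup>2"
proof (cases "0 \<le> t")
  case True
  then show ?thesis using assms exp_bound[of t] by simp
next
  case False
  define x where "x = - t"
  have x: "0 < x" "x \<le> 1" using False assms by (auto simp: x_def)
  \<comment> \<open>The product is 1 + x^3.\<close>
  have "1 \<le> (1 + x) * (1 - x + x\<^sup>2)"
    using x by (simp add: algebra_simps power2_eq_square)
  also have "\<dots> \<le> exp x * (1 - x + x\<^sup>2)"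
  proof (rule mult_right_mono)
    show "0 \<le> 1 - x + x\<^sup>2" using x by (simp add: add_nonneg_nonneg)
  qed (use exp_ge_add_one_self[of x] in simp)
  finally have "exp (- x) \<le> 1 - x + x\<^sup>2"
    by (simp add: exp_minus field_simps)
  then show ?thesis by (simp add: x_def)
qed

text \<open>Discrete form of the differential inequality X' \<le> - const X^(1 + 1 / q), with an
  additional growth term. Taking S = \<mu> (n + L) in \<open>nash\<close> makes its last term half
  of the claimed bound; the energy then yields a relative decrease of (q + \<alpha>) / (n + L). The
  share \<alpha> pays for the growth, because n + L \<le> R / P, and the share q produces the power
  -q. The lag L keeps S \<ge> 1.\<close>

lemma nash_sequence:
  fixes X E :: "nat \<Rightarrow> real" and q M :: nat and \<kappa> C \<alpha> Q P R \<mu> L A :: real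
  assumes pos: "0 < \<kappa>" "\<kappa> \<le> C" "0 < \<alpha>" "0 \<le> Q" "1 \<le> P" "0 < R"
    and mu: "\<mu> = \<kappa> / (2 * C * (q + \<alpha>))" "\<mu> \<le> 1"
    and L: "1 / \<mu> \<le> L" and A: "L ^ q \<le> A" "2 / \<mu> ^ q \<le> A"
    and X0: "X 0 \<le> Q * R ^ q" and Xnn: "\<And>n. 0 \<le> X n"
    and step: "\<And>n. n < M \<Longrightarrow> X (Suc n) \<le> (1 + \<alpha> * P / R) * X n - \<kappa> * E n"
    and nash: "\<And>n S. n < M \<Longrightarrow> 1 \<le> S \<Longrightarrow> S \<le> R \<Longrightarrow> X n \<le> C * S * E n + Q * (R / S) ^ q"
    and M: "M + L \<le> R / P"
  shows "X M \<le> A * Q * (R / (M + L)) ^ q"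
proof -
  have C: "0 < C" using pos by linarith
  have mupos: "0 < \<mu>" unfolding mu(1) using pos C by (intro divide_pos_pos mult_pos_pos) auto
  have L1: "0 < L" using L mupos by (meson divide_pos_pos less_le_trans zero_less_one)
  have "n \<le> M \<Longrightarrow> X n \<le> A * Q * (R / (n + L)) ^ q" for n
  proof (induction n)
    case 0
    have "Q * R ^ q = Q * (L ^ q * (R / L) ^ q)"
      using L1 by (simp add: power_divide)
    also have "\<dots> \<le> Q * (A * (R / L) ^ q)"
      using pos L1 A by (intro mult_left_mono mult_right_mono) auto
    finally show ?case using X0 by (simp add: mult_ac)
  next
    case (Suc n)
    then have n: "n < M" by simp
    define y where "y = n + L"
    have y: "0 < y" using L1 by (simp add: y_def)
    define S where "S = \<mu> * y"
    have "1 \<le> \<mu> * L" using L mupos by (simp add: field_simps)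
    also have "\<dots> \<le> S" unfolding S_def y_def using mupos by (intro mult_left_mono) auto
    finally have S1: "1 \<le> S" .
    have yRP: "y \<le> R / P" using n M by (simp add: y_def)
    have "R / P \<le> R" using pos by (simp add: field_simps)
    then have yR: "y \<le> R" using yRP by simp
    have "S \<le> 1 * y" unfolding S_def using mu y by (intro mult_right_mono) auto
    then have SR: "S \<le> R" using yR by simp
    define U where "U = (R / y) ^ q"
    have U: "0 \<le> U" using pos y by (simp add: U_def)
    have RS: "(R / S) ^ q = U / \<mu> ^ q"
      by (simp add: U_def S_def power_divide power_mult_distrib)
    have IH: "X n \<le> A * Q * U" using Suc n by (simp add: U_def y_def)
    have CS: "0 < C * S" using C S1 by auto
    have half: "Q * (R / S) ^ q \<le> A * Q * U / 2"
    proof -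
      have "Q * (U / \<mu> ^ q) = (2 / \<mu> ^ q) * (Q * U / 2)" by simp
      also have "\<dots> \<le> A * (Q * U / 2)" using A U pos by (intro mult_right_mono) auto
      finally show ?thesis by (simp add: RS)
    qed
    have "X n \<le> C * S * E n + A * Q * U / 2"
      using nash[OF n S1 SR] half by linarith
    then have "(X n - A * Q * U / 2) / (C * S) \<le> E n"
      using CS by (simp add: divide_le_eq algebra_simps)
    then have "\<kappa> * ((X n - A * Q * U / 2) / (C * S)) \<le> \<kappa> * E n"
      using pos by (intro mult_left_mono) auto
    then have "X (Suc n) \<le> (1 + \<alpha> * P / R) * X n - \<kappa> * ((X n - A * Q * U / 2) / (C * S))"
      using step[OF n] by linarith
    also have "\<dots> = (1 + \<alpha> * P / R - \<kappa> / (C * S)) * X n + \<kappa> / (C * S) * (A * Q * U / 2)"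
      by (simp add: algebra_simps diff_divide_distrib)
    \<comment> \<open>The coefficient of \<open>X n\<close> is nonnegative because \<kappa> \<le> C
      S, so the induction hypothesis may be inserted.\<close>
    also have "\<dots> \<le> (1 + \<alpha> * P / R - \<kappa> / (C * S)) * (A * Q * U) + \<kappa> / (C * S) * (A * Q * U / 2)"
    proof -
      have "\<kappa> \<le> C * S" using pos S1 C by (smt (verit) mult_le_cancel_left1)
      then have "\<kappa> / (C * S) \<le> 1" using CS by simp
      moreover have "0 \<le> \<alpha> * P / R" using pos by simp
      ultimately show ?thesis using IH by (intro add_right_mono mult_left_mono) auto
    qed
    also have "\<dots> = A * Q * U * (1 + \<alpha> * P / R - \<kappa> / (2 * C * S))"
      using CS by (simp add: field_simps)
    also have "\<dots> \<le> A * Q * U * (1 - q / y)"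
    proof (rule mult_left_mono)
      have "\<kappa> / (2 * C * S) = (q + \<alpha>) / y"
      proof -
        have "0 < q + \<alpha>" using pos by simp
        then show ?thesis using pos C y unfolding S_def mu(1) by (simp add: field_simps)
      qed
      moreover have "\<alpha> * P / R \<le> \<alpha> / y"
        using yRP pos y by (simp add: field_simps)
      ultimately show "1 + \<alpha> * P / R - \<kappa> / (2 * C * S) \<le> 1 - q / y"
        by (simp add: add_divide_distrib)
      have "0 \<le> A" using A L1 by (meson order_trans zero_le_power less_imp_le)
      then show "0 \<le> A * Q * U" using pos U by simp
    qed
    also have "\<dots> \<le> A * Q * U * (y / (y + 1)) ^ q"
    proof (rule mult_left_mono)
      have "1 - q / y \<le> 1 + q * (- 1 / (y + 1))"
        using y by (simp add: frac_le)
      also have "\<dots> \<le> (1 + (- 1 / (y + 1))) ^ q"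
        by (rule Bernoulli_inequality) (use y in \<open>simp add: field_simps\<close>)
      also have "1 + (- 1 / (y + 1)) = y / (y + 1)" using y by (simp add: field_simps)
      finally show "1 - q / y \<le> (y / (y + 1)) ^ q" .
      have "0 \<le> A" using A L1 by (meson order_trans zero_le_power less_imp_le)
      then show "0 \<le> A * Q * U" using pos U by simp
    qed
    also have "\<dots> = A * Q * (R / (y + 1)) ^ q"
      using y by (simp add: U_def power_mult_distrib[symmetric] mult.assoc)
    finally show ?case by (simp add: y_def add_ac)
  qed
  then show ?thesis by simp
qed

section \<open>Killed reversible kernels and their energy\<close>

text \<open>\<open>a x y\<close> stands for \<open>w x\<close> times a transition probability, with
  the holding mass on the diagonal. Row sums may stay below \<open>w x\<close>: the difference is
  mass killed on leaving \<open>V\<close>. The laziness is \<theta>.\<close>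

locale subkernel =
  fixes V :: "'a set" and w :: "'a \<Rightarrow> real" and a :: "'a \<Rightarrow> 'a \<Rightarrow> real" and \<theta> :: real
  assumes fin: "finite V"
    and wpos: "x \<in> V \<Longrightarrow> 0 < w x"
    and asym: "x \<in> V \<Longrightarrow> y \<in> V \<Longrightarrow> a x y = a y x"
    and ann: "x \<in> V \<Longrightarrow> y \<in> V \<Longrightarrow> 0 \<le> a x y"
    and asub: "x \<in> V \<Longrightarrow> (\<Sum>y\<in>V. a x y) \<le> w x"
    and alazy: "x \<in> V \<Longrightarrow> \<theta> * w x \<le> a x x"
    and theta: "0 < \<theta>" "\<theta> < 1"
begin

definition op :: "('a \<Rightarrow> real) \<Rightarrow> 'a \<Rightarrow> real" where
  "op f x = (\<Sum>y\<in>V. a x y * f y) / w x"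

definition ip :: "('a \<Rightarrow> real) \<Rightarrow> ('a \<Rightarrow> real) \<Rightarrow> real" where
  "ip f g = (\<Sum>x\<in>V. w x * f x * g x)"

definition en :: "('a \<Rightarrow> real) \<Rightarrow> real" where
  "en f = ip f f - ip f (op f)"

lemma ip_op: "ip f (op g) = (\<Sum>x\<in>V. \<Sum>y\<in>V. a x y * f x * g y)"
  unfolding ip_def op_def
proof (rule sum.cong[OF refl])
  fix x assume "x \<in> V"
  then have "w x * f x * ((\<Sum>y\<in>V. a x y * g y) / w x) = f x * (\<Sum>y\<in>V. a x y * g y)"
    using wpos[of x] by simp
  then show "w x * f x * ((\<Sum>y\<in>V. a x y * g y) / w x) = (\<Sum>y\<in>V. a x y * f x * g y)"
    by (simp add: sum_distrib_left mult_ac)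
qed

lemma ip_sym: "ip f g = ip g f"
  by (simp add: ip_def mult_ac)

lemma op_sym: "ip f (op g) = ip (op f) g"
proof -
  have "ip f (op g) = (\<Sum>y\<in>V. \<Sum>x\<in>V. a x y * f x * g y)"
    unfolding ip_op by (rule sum.swap)
  also have "\<dots> = (\<Sum>y\<in>V. \<Sum>x\<in>V. a y x * g y * f x)"
    by (intro sum.cong refl) (use asym in auto)
  also have "\<dots> = ip g (op f)" by (simp add: ip_op)
  finally show ?thesis by (simp add: ip_sym)
qed

lemma op_pow_sym: "ip f ((op ^^ n) g) = ip ((op ^^ n) f) g"
proof (induction n arbitrary: f)
  case (Suc n)
  have "ip f ((op ^^ Suc n) g) = ip (op f) ((op ^^ n) g)" by (simp add: op_sym)
  also have "\<dots> = ip ((op ^^ Suc n) f) g" using Suc by (simp add: funpow_swap1)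
  finally show ?case .
qed simp

lemma ip_nonneg: "0 \<le> ip f f"
  unfolding ip_def by (rule sum_nonneg) (use wpos in \<open>force simp: mult.assoc\<close>)

lemma ip_Cauchy_Schwarz: "(ip f g)\<^sup>2 \<le> ip f f * ip g g"
proof -
  have "ip f g = (\<Sum>x\<in>V. (sqrt (w x) * f x) * (sqrt (w x) * g x))"
    unfolding ip_def by (rule sum.cong) (use wpos in \<open>force simp: algebra_simps\<close>)+
  moreover have "ip h h = (\<Sum>x\<in>V. (sqrt (w x) * h x)\<^sup>2)" for h
    unfolding ip_def
    by (rule sum.cong) (use wpos in \<open>force simp: power_mult_distrib power2_eq_square\<close>)+
  ultimately show ?thesis by (simp add: Cauchy_Schwarz_ineq_sum)
qed

lemma op_nonneg:
  assumes "\<And>y. y \<in> V \<Longrightarrow> 0 \<le> f y" "x \<in> V"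
  shows "0 \<le> op f x"
  unfolding op_def using assms wpos[of x] ann
  by (auto intro!: divide_nonneg_pos sum_nonneg)

lemma op_pow_nonneg:
  assumes "\<And>y. y \<in> V \<Longrightarrow> 0 \<le> f y" "x \<in> V"
  shows "0 \<le> (op ^^ n) f x"
  using assms(2) by (induction n arbitrary: x) (auto simp: assms intro: op_nonneg)

text \<open>Killed mass acts like an edge to a cemetery where f vanishes. The diagonal drops out of
  all differences, so by laziness the mass that takes part is at most (1 - \<theta>) w x;
  Cauchy-Schwarz over this mass gives the factor.\<close>

lemma increment_pointwise:
  assumes x: "x \<in> V"
  shows "w x * (f x - op f x)\<^sup>2
    \<le> (1 - \<theta>) * ((\<Sum>y\<in>V. a x y * (f x - f y)\<^sup>2) + (w x - (\<Sum>y\<in>V. a x y)) * (f x)\<^sup>2)"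
proof -
  define A where "A = (\<Sum>y\<in>V. a x y)"
  define k where "k = w x - A"
  define B where "B = (\<Sum>y\<in>V-{x}. a x y)"
  define U where "U = (\<Sum>y\<in>V. a x y * (f x - f y))"
  define Pq where "Pq = (\<Sum>y\<in>V. a x y * (f x - f y)\<^sup>2)"
  have wx: "0 < w x" using wpos x by simp
  have k: "0 \<le> k" using asub[OF x] by (simp add: k_def A_def)
  have B0: "0 \<le> B" unfolding B_def using ann x by (auto intro: sum_nonneg)
  have P0: "0 \<le> Pq" unfolding Pq_def using ann x by (auto intro: sum_nonneg)
  have AB: "A = a x x + B" unfolding A_def B_def using x fin by (simp add: sum.remove)
  have Bk: "B + k \<le> (1 - \<theta>) * w x" using AB alazy[OF x] by (simp add: k_def algebra_simps)
  have Ueq: "U = (\<Sum>y\<in>V-{x}. a x y * (f x - f y))"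
    unfolding U_def using x fin by (simp add: sum.remove)
  have Peq: "Pq = (\<Sum>y\<in>V-{x}. a x y * (f x - f y)\<^sup>2)"
    unfolding Pq_def using x fin by (simp add: sum.remove)
  have UBP: "U\<^sup>2 \<le> B * Pq"
    unfolding Ueq Peq B_def by (rule weighted_Cauchy_Schwarz_sum) (use ann x in auto)
  \<comment> \<open>The cross term between the jump part \<open>U\<close> and the killed part,
    bounded through 4 u v \<le> (u + v)^2.\<close>
  have "(2 * (U * f x))\<^sup>2 = 4 * (U\<^sup>2 * (f x)\<^sup>2)" by (simp add: power_mult_distrib)
  also have "\<dots> \<le> 4 * ((B * Pq) * (f x)\<^sup>2)"
    by (intro mult_left_mono mult_right_mono UBP) auto
  also have "\<dots> \<le> (B * (f x)\<^sup>2 + Pq)\<^sup>2"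
    using zero_le_power2[of "B * (f x)\<^sup>2 - Pq"] by (simp add: power2_eq_square algebra_simps)
  finally have "2 * (U * f x) \<le> B * (f x)\<^sup>2 + Pq"
    by (rule power2_le_imp_le) (use B0 P0 in simp)
  then have "k * (2 * (U * f x)) \<le> k * (B * (f x)\<^sup>2 + Pq)" using k by (rule mult_left_mono)
  then have two: "(U + k * f x)\<^sup>2 \<le> (B + k) * (Pq + k * (f x)\<^sup>2)"
    using UBP by (simp add: power2_eq_square algebra_simps)
  have "w x * (f x - op f x) = w x * f x - (\<Sum>y\<in>V. a x y * f y)"
    using wx by (simp add: op_def field_simps)
  also have "\<dots> = U + k * f x"
    by (simp add: U_def k_def A_def algebra_simps sum_subtractf sum_distrib_left sum_distrib_right)
  finally have "w x * (w x * (f x - op f x)\<^sup>2) = (U + k * f x)\<^sup>2"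
    by (metis (no_types, lifting) mult.assoc mult.left_commute power2_eq_square)
  also have "\<dots> \<le> (1 - \<theta>) * w x * (Pq + k * (f x)\<^sup>2)"
    using two mult_right_mono[OF Bk, of "Pq + k * (f x)\<^sup>2"] P0 k by simp
  finally have "w x * (w x * (f x - op f x)\<^sup>2) \<le> w x * ((1 - \<theta>) * (Pq + k * (f x)\<^sup>2))"
    by (simp add: mult_ac)
  then show ?thesis using wx by (simp add: Pq_def k_def A_def)
qed

text \<open>Summing over x meets each edge from both ends and each killed mass once, so the
  pointwise bounds add up to at most twice the energy.\<close>

lemma increment_le_en: "ip (\<lambda>x. f x - op f x) (\<lambda>x. f x - op f x) \<le> 2 * (1 - \<theta>) * en f"
proof -
  let ?A = "\<lambda>x. \<Sum>y\<in>V. a x y"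
  have "ip (\<lambda>x. f x - op f x) (\<lambda>x. f x - op f x) = (\<Sum>x\<in>V. w x * (f x - op f x)\<^sup>2)"
    by (simp add: ip_def power2_eq_square mult_ac)
  also have "\<dots> \<le> (\<Sum>x\<in>V. (1 - \<theta>) * ((\<Sum>y\<in>V. a x y * (f x - f y)\<^sup>2) + (w x - ?A x) * (f x)\<^sup>2))"
    by (rule sum_mono) (rule increment_pointwise)
  also have "\<dots> = (1 - \<theta>) * ((\<Sum>x\<in>V. \<Sum>y\<in>V. a x y * (f x - f y)\<^sup>2) + (\<Sum>x\<in>V. (w x - ?A x) * (f x)\<^sup>2))"
    by (subst sum_distrib_left[symmetric], subst sum.distrib) simp
  also have "(\<Sum>x\<in>V. \<Sum>y\<in>V. a x y * (f x - f y)\<^sup>2)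
      = 2 * (\<Sum>x\<in>V. ?A x * (f x)\<^sup>2) - 2 * ip f (op f)"
  proof -
    have "(\<Sum>x\<in>V. \<Sum>y\<in>V. a x y * (f x - f y)\<^sup>2)
        = (\<Sum>x\<in>V. \<Sum>y\<in>V. a x y * (f x)\<^sup>2) + (\<Sum>x\<in>V. \<Sum>y\<in>V. a x y * (f y)\<^sup>2)
          - 2 * (\<Sum>x\<in>V. \<Sum>y\<in>V. a x y * f x * f y)"
      by (simp add: sum.distrib[symmetric] sum_subtractf[symmetric] sum_distrib_left
          power2_eq_square algebra_simps)
    moreover have "(\<Sum>x\<in>V. \<Sum>y\<in>V. a x y * (f y)\<^sup>2) = (\<Sum>x\<in>V. \<Sum>y\<in>V. a x y * (f x)\<^sup>2)"
      by (subst sum.swap) (intro sum.cong refl, use asym in auto)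
    ultimately show ?thesis by (simp add: ip_op sum_distrib_right)
  qed
  also have "(1 - \<theta>) * (2 * (\<Sum>x\<in>V. ?A x * (f x)\<^sup>2) - 2 * ip f (op f) + (\<Sum>x\<in>V. (w x - ?A x) * (f x)\<^sup>2))
     \<le> (1 - \<theta>) * (2 * en f)"
  proof (rule mult_left_mono)
    have "2 * (\<Sum>x\<in>V. ?A x * (f x)\<^sup>2) + (\<Sum>x\<in>V. (w x - ?A x) * (f x)\<^sup>2)
        = (\<Sum>x\<in>V. (w x + ?A x) * (f x)\<^sup>2)"
      by (simp add: sum_distrib_left sum.distrib[symmetric] algebra_simps)
    also have "\<dots> \<le> (\<Sum>x\<in>V. 2 * (w x * f x * f x))"
    proof (rule sum_mono)
      fix x assume "x \<in> V"
      then have "(w x + ?A x) * (f x)\<^sup>2 \<le> (2 * w x) * (f x)\<^sup>2"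
        using asub by (intro mult_right_mono) auto
      then show "(w x + ?A x) * (f x)\<^sup>2 \<le> 2 * (w x * f x * f x)"
        by (simp add: power2_eq_square mult_ac)
    qed
    also have "\<dots> = 2 * ip f f" by (simp add: ip_def sum_distrib_left)
    finally show "2 * (\<Sum>x\<in>V. ?A x * (f x)\<^sup>2) - 2 * ip f (op f)
        + (\<Sum>x\<in>V. (w x - ?A x) * (f x)\<^sup>2) \<le> 2 * en f"
      by (simp add: en_def)
  qed (use theta in simp)
  also have "(1 - \<theta>) * (2 * en f) = 2 * (1 - \<theta>) * en f" by algebra
  finally show ?thesis .
qed

lemma en_nonneg: "0 \<le> en f"
proof -
  have "0 \<le> 2 * (1 - \<theta>) * en f" using increment_le_en ip_nonneg order_trans by blast
  then show ?thesis using theta by (simp add: zero_le_mult_iff)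
qed

text \<open>Laziness keeps the spectrum away from -1: \<open>increment_le_en\<close> says (1 -
  \<lambda>)^2 \<le> 2 (1 - \<theta>) (1 - \<lambda>) for an eigenvalue \<lambda>. Hence each
  application of \<open>op\<close> dissipates a fixed multiple of the energy.\<close>

lemma op_contracts: "ip (op f) (op f) \<le> ip f f - 2 * \<theta> * en f"
proof -
  have "ip (\<lambda>x. f x - op f x) (\<lambda>x. f x - op f x) = ip f f - 2 * ip f (op f) + ip (op f) (op f)"
    by (simp add: ip_def sum.distrib[symmetric] sum_subtractf[symmetric] sum_distrib_left algebra_simps)
  then show ?thesis using increment_le_en[of f] by (simp add: en_def algebra_simps)
qed

section \<open>Davies' exponential perturbation\<close>

text \<open>The conjugate exp (- \<psi>) op exp \<psi> of the kernel.\<close>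

definition tw :: "('a \<Rightarrow> real) \<Rightarrow> ('a \<Rightarrow> real) \<Rightarrow> 'a \<Rightarrow> real" where
  "tw \<psi> f x = (\<Sum>y\<in>V. a x y * (exp (\<psi> y - \<psi> x) * f y)) / w x"

definition \<alpha> :: real where "\<alpha> = 6 + 8 / \<theta>"

text \<open>The first-order terms in \<open>\<epsilon>\<close> cancel: for \<open>R = tw \<psi> f - op f\<close>, \<open>ip f R\<close> only sees
  \<open>cosh (\<psi> y - \<psi> x) - 1\<close>, and \<open>ip (op f - f) R\<close> is absorbed by the energy.\<close>

lemma tw_bound:
  assumes f: "\<And>x. x \<in> V \<Longrightarrow> 0 \<le> f x"
    and psi: "\<And>x y. x \<in> V \<Longrightarrow> y \<in> V \<Longrightarrow> a x y \<noteq> 0 \<Longrightarrow> \<bar>\<psi> y - \<psi> x\<bar> \<le> \<epsilon>"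
    and eps: "0 \<le> \<epsilon>" "\<epsilon> \<le> 1"
  shows "ip (tw \<psi> f) (tw \<psi> f) \<le> (1 + \<alpha> * \<epsilon>\<^sup>2) * ip f f - \<theta> * en f"
proof -
  define R where "R x = tw \<psi> f x - op f x" for x
  have Req: "R x = (\<Sum>y\<in>V. a x y * ((exp (\<psi> y - \<psi> x) - 1) * f y)) / w x" for x
    by (simp add: R_def tw_def op_def diff_divide_distrib[symmetric] sum_subtractf[symmetric] algebra_simps)
  have opop: "ip (op f) (op f) \<le> ip f f"
    using op_contracts[of f] en_nonneg[of f] theta by (smt (verit) mult_nonneg_nonneg)
  have Rabs: "\<bar>R x\<bar> \<le> 2 * \<epsilon> * op f x" if x: "x \<in> V" for x
  proof -
    have "\<bar>\<Sum>y\<in>V. a x y * ((exp (\<psi> y - \<psi> x) - 1) * f y)\<bar> \<le> (\<Sum>y\<in>V. 2 * \<epsilon> * (a x y * f y))"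
    proof (rule order_trans[OF sum_abs sum_mono])
      fix y assume y: "y \<in> V"
      show "\<bar>a x y * ((exp (\<psi> y - \<psi> x) - 1) * f y)\<bar> \<le> 2 * \<epsilon> * (a x y * f y)"
      proof (cases "a x y = 0")
        case False
        define t where "t = \<psi> y - \<psi> x"
        have t: "\<bar>t\<bar> \<le> \<epsilon>" using psi[OF x y False] by (simp add: t_def)
        then have t1: "\<bar>t\<bar> \<le> 1" using eps by simp
        have "t\<^sup>2 \<le> \<bar>t\<bar>" using t1 by (metis abs_ge_zero mult_left_le power2_abs power2_eq_square)
        then have "\<bar>exp t - 1\<bar> \<le> 2 * \<epsilon>"
          using exp_le_quadratic[OF t1] exp_ge_add_one_self[of t] t by linarith
        then have "(a x y * f y) * \<bar>exp t - 1\<bar> \<le> (a x y * f y) * (2 * \<epsilon>)"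
          using ann x y f by (intro mult_left_mono) auto
        then show ?thesis using ann[OF x y] f[OF y] by (simp add: abs_mult t_def mult_ac)
      qed simp
    qed
    then show ?thesis
      using wpos[OF x] by (simp add: Req op_def abs_divide sum_distrib_left[symmetric] divide_right_mono)
  qed
  have RR: "ip R R \<le> 4 * \<epsilon>\<^sup>2 * ip f f"
  proof -
    have "ip R R = (\<Sum>x\<in>V. w x * (R x)\<^sup>2)" by (simp add: ip_def power2_eq_square mult_ac)
    also have "\<dots> \<le> (\<Sum>x\<in>V. w x * (2 * \<epsilon> * op f x)\<^sup>2)"
      using Rabs wpos by (intro sum_mono mult_left_mono) (auto simp: abs_le_square_iff[symmetric] less_imp_le dest: order_trans[OF _ abs_ge_self])
    also have "\<dots> = 4 * \<epsilon>\<^sup>2 * ip (op f) (op f)"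
      by (simp add: ip_def sum_distrib_left power2_eq_square mult_ac)
    also have "\<dots> \<le> 4 * \<epsilon>\<^sup>2 * ip f f" by (intro mult_left_mono opop) auto
    finally show ?thesis .
  qed
  have fR: "2 * ip f R \<le> 2 * \<epsilon>\<^sup>2 * ip f f"
  proof -
    have e: "ip f R = (\<Sum>x\<in>V. \<Sum>y\<in>V. a x y * (exp (\<psi> y - \<psi> x) - 1) * f x * f y)"
      unfolding ip_def Req
    proof (rule sum.cong[OF refl])
      fix x assume "x \<in> V"
      then have "w x * f x * ((\<Sum>y\<in>V. a x y * ((exp (\<psi> y - \<psi> x) - 1) * f y)) / w x)
          = f x * (\<Sum>y\<in>V. a x y * ((exp (\<psi> y - \<psi> x) - 1) * f y))"
        using wpos[of x] by simp
      then show "w x * f x * ((\<Sum>y\<in>V. a x y * ((exp (\<psi> y - \<psi> x) - 1) * f y)) / w x)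
          = (\<Sum>y\<in>V. a x y * (exp (\<psi> y - \<psi> x) - 1) * f x * f y)"
        by (simp add: sum_distrib_left mult_ac)
    qed
    also have "\<dots> = (\<Sum>y\<in>V. \<Sum>x\<in>V. a x y * (exp (\<psi> y - \<psi> x) - 1) * f x * f y)"
      by (rule sum.swap)
    also have "\<dots> = (\<Sum>x\<in>V. \<Sum>y\<in>V. a x y * (exp (\<psi> x - \<psi> y) - 1) * f x * f y)"
      by (intro sum.cong refl) (use asym in auto)
    finally have e2: "ip f R = (\<Sum>x\<in>V. \<Sum>y\<in>V. a x y * (exp (\<psi> x - \<psi> y) - 1) * f x * f y)" .
    have "2 * ip f R = ip f R + ip f R" by simp
    also have "\<dots> = (\<Sum>x\<in>V. \<Sum>y\<in>V. a x y * (exp (\<psi> y - \<psi> x) - 1) * f x * f y)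
        + (\<Sum>x\<in>V. \<Sum>y\<in>V. a x y * (exp (\<psi> x - \<psi> y) - 1) * f x * f y)"
      using e e2 by (rule arg_cong2[where f="(+)"])
    also have "\<dots> = (\<Sum>x\<in>V. \<Sum>y\<in>V. a x y * f x * f y * (exp (\<psi> y - \<psi> x) + exp (\<psi> x - \<psi> y) - 2))"
      by (subst sum.distrib[symmetric], rule sum.cong[OF refl], subst sum.distrib[symmetric],
          rule sum.cong[OF refl]) (simp add: algebra_simps)
    also have "\<dots> \<le> (\<Sum>x\<in>V. \<Sum>y\<in>V. a x y * f x * f y * (2 * \<epsilon>\<^sup>2))"
    proof (intro sum_mono)
      fix x y assume x: "x \<in> V" and y: "y \<in> V"
      show "a x y * f x * f y * (exp (\<psi> y - \<psi> x) + exp (\<psi> x - \<psi> y) - 2) \<le> a x y * f x * f y * (2 * \<epsilon>\<^sup>2)"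
      proof (cases "a x y = 0")
        case False
        define t where "t = \<psi> y - \<psi> x"
        have t: "\<bar>t\<bar> \<le> \<epsilon>" using psi[OF x y False] by (simp add: t_def)
        then have t2: "t\<^sup>2 \<le> \<epsilon>\<^sup>2" using eps by (metis abs_le_square_iff abs_of_nonneg)
        have "exp t + exp (- t) - 2 \<le> 2 * \<epsilon>\<^sup>2"
          using exp_le_quadratic[of t] exp_le_quadratic[of "-t"] t t2 eps by auto
        then show ?thesis using ann[OF x y] f[OF x] f[OF y]
          by (intro mult_left_mono) (auto simp: t_def)
      qed simp
    qed
    also have "\<dots> = 2 * \<epsilon>\<^sup>2 * ip f (op f)"
      by (simp add: ip_op sum_distrib_left mult_ac)
    also have "\<dots> \<le> 2 * \<epsilon>\<^sup>2 * ip f f"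
      using en_nonneg[of f] by (intro mult_left_mono) (auto simp: en_def)
    finally show ?thesis .
  qed
  define g where "g x = f x - op f x" for x
  have gg: "ip g g \<le> 2 * en f"
    using increment_le_en[of f] mult_right_mono[of "2 * (1 - \<theta>)" 2 "en f"] theta en_nonneg[of f]
    unfolding g_def by simp
  have cross: "- 2 * ip g R \<le> \<theta> * en f + 8 / \<theta> * \<epsilon>\<^sup>2 * ip f f"
  proof -
    \<comment> \<open>The weights in this AM-GM are chosen to spend exactly half of the dissipation
      2 \<theta> \<open>en f\<close> from \<open>op_contracts\<close>, given that ip g g \<le> 2
      \<open>en f\<close>.\<close>
    have "- 2 * (g x * R x) \<le> \<theta> / 2 * (g x)\<^sup>2 + 2 / \<theta> * (R x)\<^sup>2" for x
    proof -
      have "0 \<le> (\<theta> * g x + 2 * R x)\<^sup>2 / (2 * \<theta>)" using theta by simp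
      also have "\<dots> = \<theta> / 2 * (g x)\<^sup>2 + 2 / \<theta> * (R x)\<^sup>2 + 2 * (g x * R x)"
        using theta by (simp add: field_simps power2_eq_square)
      finally show ?thesis by simp
    qed
    then have "(\<Sum>x\<in>V. w x * (- 2 * (g x * R x))) \<le> (\<Sum>x\<in>V. w x * (\<theta> / 2 * (g x)\<^sup>2 + 2 / \<theta> * (R x)\<^sup>2))"
      using wpos by (intro sum_mono mult_left_mono) (auto simp: less_imp_le)
    then have "- 2 * ip g R \<le> \<theta> / 2 * ip g g + 2 / \<theta> * ip R R"
      by (simp add: ip_def sum_distrib_left sum.distrib[symmetric] power2_eq_square algebra_simps sum_negf)
    also have "\<dots> \<le> \<theta> / 2 * (2 * en f) + 2 / \<theta> * (4 * \<epsilon>\<^sup>2 * ip f f)"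
      using gg RR theta by (intro add_mono mult_left_mono) auto
    finally show ?thesis by (simp add: mult_ac)
  qed
  have "ip (tw \<psi> f) (tw \<psi> f) = ip (op f) (op f) - 2 * ip g R + 2 * ip f R + ip R R"
  proof -
    have "tw \<psi> f = (\<lambda>x. op f x + R x)" by (auto simp: R_def)
    then show ?thesis
      by (simp add: ip_def g_def sum.distrib[symmetric] sum_subtractf[symmetric] sum_distrib_left algebra_simps)
  qed
  also have "\<dots> \<le> (ip f f - 2 * \<theta> * en f) + (\<theta> * en f + 8 / \<theta> * \<epsilon>\<^sup>2 * ip f f)
      + 2 * \<epsilon>\<^sup>2 * ip f f + 4 * \<epsilon>\<^sup>2 * ip f f"
    using op_contracts[of f] cross fR RR by linarith
  \<comment> \<open>In \<alpha>, 8 / \<theta> comes from the cross term, and 6 = 2 + 4 from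
    \<open>fR\<close> and \<open>RR\<close>.\<close>
  also have "\<dots> = (1 + \<alpha> * \<epsilon>\<^sup>2) * ip f f - \<theta> * en f"
    by (simp add: \<alpha>_def algebra_simps)
  finally show ?thesis .
qed

text \<open>Repeated Cauchy-Schwarz takes the place of convexity, which is why all exponents are
  powers of two. Row sums at most \<open>w x\<close> keep the constant 1.\<close>

lemma op_Jensen:
  assumes g: "\<And>x. x \<in> V \<Longrightarrow> 0 \<le> g x" and x: "x \<in> V"
  shows "(op g x) ^ (2 ^ j) \<le> op (\<lambda>y. g y ^ (2 ^ j)) x"
proof (induction j)
  case (Suc j)
  have wx: "0 < w x" using wpos x by simp
  let ?f = "\<lambda>y. g y ^ (2 ^ j)"
  have "(op g x) ^ (2 ^ Suc j) = ((op g x) ^ (2 ^ j))\<^sup>2" by (simp add: power_mult[symmetric] mult.commute)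
  also have "\<dots> \<le> (op ?f x)\<^sup>2"
    using Suc op_nonneg[OF g x] by (intro power_mono) auto
  also have "\<dots> = (\<Sum>y\<in>V. a x y * ?f y)\<^sup>2 / (w x)\<^sup>2" by (simp add: op_def power_divide)
  also have "\<dots> \<le> ((\<Sum>y\<in>V. a x y) * (\<Sum>y\<in>V. a x y * (?f y)\<^sup>2)) / (w x)\<^sup>2"
    using ann x by (intro divide_right_mono weighted_Cauchy_Schwarz_sum) auto
  also have "\<dots> \<le> (w x * (\<Sum>y\<in>V. a x y * (?f y)\<^sup>2)) / (w x)\<^sup>2"
    using ann x asub[OF x] by (intro divide_right_mono mult_right_mono sum_nonneg) auto
  also have "\<dots> = op (\<lambda>y. g y ^ (2 ^ Suc j)) x"
    using wx by (simp add: op_def power2_eq_square power_mult[symmetric] mult.commute power_add[symmetric] mult_2)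
  finally show ?case .
qed simp

end

section \<open>Smoothing from weighted L^2 to a pointwise bound\<close>

text \<open>The parameters \<open>\<mu>\<close>, \<open>L\<close> and \<open>A\<close> of \<open>nash_sequence\<close>. The extra summand of the lag makes the twist
  at most 1 on every level that is used.\<close>

definition smooth_rate :: "real \<Rightarrow> nat \<Rightarrow> real \<Rightarrow> real" where
  "smooth_rate \<theta> q C = \<theta> / (2 * C * (q + (6 + 8 / \<theta>) * (1 + 2 * real q)\<^sup>2))"

definition smooth_lag :: "real \<Rightarrow> nat \<Rightarrow> real \<Rightarrow> real" where
  "smooth_lag \<theta> q C = 1 / smooth_rate \<theta> q C + (1 + 2 * real q)\<^sup>2"

definition smooth_amp :: "real \<Rightarrow> nat \<Rightarrow> real \<Rightarrow> real" where
  "smooth_amp \<theta> q C = max (smooth_lag \<theta> q C ^ q) (2 / smooth_rate \<theta> q C ^ q)"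

text \<open>In \<open>ultracontractive\<close>, 4^(2 q) normalizes the first level, the amplitude
  times 2^q G is the loss per level, and the first factor remains from evaluating at a vertex on the
  last level.\<close>

definition ultra_const :: "real \<Rightarrow> nat \<Rightarrow> real \<Rightarrow> real \<Rightarrow> real" where
  "ultra_const \<theta> q C G
    = (2 * smooth_lag \<theta> q C + 2) ^ q * (4 ^ (2 * q) * (smooth_amp \<theta> q C * 2 ^ q * G))"

text \<open>\<phi> plays the distance from \<open>v\<close>, and \<open>F\<close> a lower bound for
  volumes at radius \<open>r\<close> near \<open>v\<close>. The single-vertex estimate
  \<open>crude\<close> serves at both ends: at the start of a level it bounds a function by its
  weighted L^1 norm, and after the last level it turns a norm into a value at
  \<open>v\<close>.\<close>

locale nash_kernel = subkernel +
  fixes v :: 'a and \<phi> :: "'a \<Rightarrow> real" and r F C G :: real and q :: nat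
  assumes v: "v \<in> V" and phi_v: "\<phi> v = 0" and phi_nonneg: "x \<in> V \<Longrightarrow> 0 \<le> \<phi> x"
    and phi_lip: "x \<in> V \<Longrightarrow> y \<in> V \<Longrightarrow> a x y \<noteq> 0 \<Longrightarrow> \<bar>\<phi> y - \<phi> x\<bar> \<le> 1"
    and r: "1 \<le> r" and F: "0 < F" and C: "1 \<le> C" and G: "0 < G"
    and nash: "(\<And>x. x \<in> V \<Longrightarrow> 0 \<le> f x) \<Longrightarrow> 1 \<le> S \<Longrightarrow> S \<le> r\<^sup>2 \<Longrightarrow>
       ip f f \<le> C * S * en f + G / F * (r\<^sup>2 / S) ^ q * (\<Sum>x\<in>V. w x * f x * exp (2 * q * \<phi> x / r))\<^sup>2"
    and crude: "x \<in> V \<Longrightarrow> F \<le> G * (r\<^sup>2) ^ q * (w x * exp (2 * q * \<phi> x / r))"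
begin

abbreviation "\<mu> \<equiv> smooth_rate \<theta> q C"
abbreviation "b \<equiv> 1 + 2 * real q"
abbreviation "L \<equiv> smooth_lag \<theta> q C"
abbreviation "A \<equiv> smooth_amp \<theta> q C"

definition wnorm :: "('a \<Rightarrow> real) \<Rightarrow> real \<Rightarrow> nat \<Rightarrow> nat \<Rightarrow> real" where
  "wnorm h c p n = (\<Sum>x\<in>V. w x * ((op ^^ n) h x * exp (- (c * \<phi> x / r))) ^ p)"

lemma wnorm_nonneg:
  assumes "\<And>x. x \<in> V \<Longrightarrow> 0 \<le> h x"
  shows "0 \<le> wnorm h c p n"
  unfolding wnorm_def using wpos op_pow_nonneg[OF assms]
  by (auto intro!: sum_nonneg mult_nonneg_nonneg zero_le_power simp: less_imp_le)

lemma op_exp_eq_tw: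
  "op h x * exp (- \<psi> x) = tw \<psi> (\<lambda>y. h y * exp (- \<psi> y)) x"
proof -
  have "h y * exp (- \<psi> x) = exp (\<psi> y - \<psi> x) * (h y * exp (- \<psi> y))" for y
    by (simp add: exp_diff exp_minus field_simps)
  then have "a x y * h y * exp (- \<psi> x) = a x y * (exp (\<psi> y - \<psi> x) * (h y * exp (- \<psi> y)))" for y
    by (simp only: mult.assoc)
  then show ?thesis by (simp only: op_def tw_def sum_distrib_right times_divide_eq_left)
qed

lemma rate: "0 < \<mu>" "\<mu> \<le> 1"
proof -
  have "0 < (6 + 8 / \<theta>) * b\<^sup>2" using theta by (intro mult_pos_pos add_pos_pos) auto
  then have "0 < q + (6 + 8 / \<theta>) * b\<^sup>2" by (rule add_nonneg_pos[rotated]) simp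
  then have pos: "0 < 2 * C * (q + (6 + 8 / \<theta>) * b\<^sup>2)" using C by (intro mult_pos_pos) auto
  then show "0 < \<mu>" using theta by (simp add: smooth_rate_def)
  have "1 \<le> b\<^sup>2" by (simp add: one_le_power)
  then have "1 * 1 \<le> (6 + 8 / \<theta>) * b\<^sup>2" using theta by (intro mult_mono) auto
  then have "1 \<le> q + (6 + 8 / \<theta>) * b\<^sup>2" by simp
  then have "1 * 1 \<le> (2 * C) * (q + (6 + 8 / \<theta>) * b\<^sup>2)" using C by (intro mult_mono) auto
  then show "\<mu> \<le> 1" using theta pos by (simp add: smooth_rate_def)
qed

lemma L: "1 / \<mu> \<le> L" "b\<^sup>2 \<le> L" "1 \<le> L"
proof -
  have "1 \<le> b\<^sup>2" by (simp add: one_le_power)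
  then show "1 / \<mu> \<le> L" "b\<^sup>2 \<le> L" "1 \<le> L"
    using rate by (auto simp: smooth_lag_def add_increasing)
qed

lemma A: "L ^ q \<le> A" "2 / \<mu> ^ q \<le> A" "1 \<le> A"
proof -
  show "L ^ q \<le> A" "2 / \<mu> ^ q \<le> A" by (auto simp: smooth_amp_def)
  then show "1 \<le> A" using L(3) one_le_power order_trans by blast
qed

text \<open>One step from \<open>L\<close> to the power \<open>p\<close> to \<open>L\<close> to the power \<open>2 p\<close>. Jensen turns powers of \<open>op h\<close>
  into a twisted kernel acting on powers of \<open>h\<close>, so that the Nash inequality applies to them. Its
  weight \<open>exp (2 q \<phi> / r)\<close> is absorbed by raising the exponent \<open>c\<close> by \<open>2 q / p\<close>; over all
  \<open>p = 2, 4, 8, \<dots>\<close> these increments stay below \<open>2 q\<close>, and the times \<open>r\<^sup>2 / p\<^sup>2\<close> sum to at most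
  \<open>r\<^sup>2 / 3\<close>.\<close>

lemma level_step:
  assumes h: "\<And>x. x \<in> V \<Longrightarrow> 0 \<le> h x"
    and p: "p = 2 ^ j" and c: "0 \<le> c" "c + 2 * q / p \<le> b"
    and pr: "(real p)\<^sup>2 * (2 * L + 2) \<le> r\<^sup>2"
    and bound: "\<And>n. \<tau> \<le> real n \<Longrightarrow> n \<le> N \<Longrightarrow> wnorm h c p n \<le> B"
    and n: "\<tau> + r\<^sup>2 / (real p)\<^sup>2 \<le> real n" "n \<le> N" and tau: "0 \<le> \<tau>"
  shows "wnorm h (c + 2 * q / p) (2 * p) n \<le> A * 2 ^ q * G / F * (real p ^ 2) ^ q * B\<^sup>2"
proof -
  define c' where "c' = c + 2 * q / p"
  have p1: "1 \<le> real p" using p by simp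
  have c': "0 \<le> c'" using c by (simp add: c'_def)
  define R where "R = r\<^sup>2"
  define P where "P = (real p)\<^sup>2"
  have P1: "1 \<le> P" using p1 by (simp add: P_def)
  have R: "0 < R" using r by (simp add: R_def)
  have RP: "2 * L + 2 \<le> R / P" using pr p1 pos_le_divide_eq[of P "2 * L + 2" R] by (simp add: R_def P_def mult.commute)
  \<comment> \<open>The longest run that \<open>nash_sequence\<close> admits. Rounding down costs at
    most a factor 2 in T + L, because R / P \<ge> 2; this is the 2^q of the conclusion.\<close>
  define T where "T = nat \<lfloor>R / P - L\<rfloor>"
  have "0 \<le> R / P - L" using RP L by linarith
  then have T: "real T \<le> R / P - L" "R / P - L - 1 \<le> real T"
    unfolding T_def by linarith+
  have Tn: "\<tau> + T \<le> real n" using n T L unfolding R_def P_def by linarith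
  define n0 where "n0 = n - T"
  have n0: "n0 + T = n" "\<tau> \<le> real n0" using Tn tau unfolding n0_def by linarith+
  define f where "f k x = ((op ^^ (n0 + k)) h x * exp (- (c' * \<phi> x / r))) ^ p" for k x
  define X where "X k = wnorm h c' (2 * p) (n0 + k)" for k
  define Q where "Q = G / F * B\<^sup>2"
  have hn: "0 \<le> (op ^^ k) h x" if "x \<in> V" for k x using op_pow_nonneg[OF h that] .
  have f0: "0 \<le> f k x" if "x \<in> V" for k x using hn[OF that] by (simp add: f_def)
  have X: "X k = ip (f k) (f k)" for k
    by (simp add: X_def wnorm_def ip_def f_def mult.assoc power_add[symmetric] mult_2)
  have frho: "(\<Sum>x\<in>V. w x * f k x * exp (2 * q * \<phi> x / r)) = wnorm h c p (n0 + k)" for k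
    unfolding wnorm_def
  proof (rule sum.cong[OF refl])
    fix x
    have e: "real p * (- (c' * \<phi> x / r)) + 2 * q * \<phi> x / r = real p * (- (c * \<phi> x / r))"
      using p1 r by (simp add: c'_def field_simps)
    have "exp (- (c' * \<phi> x / r)) ^ p * exp (2 * q * \<phi> x / r) = exp (- (c * \<phi> x / r)) ^ p"
      unfolding exp_of_nat_mult[symmetric] exp_add[symmetric] e ..
    then show "w x * f k x * exp (2 * q * \<phi> x / r)
        = w x * ((op ^^ (n0 + k)) h x * exp (- (c * \<phi> x / r))) ^ p"
      by (simp add: f_def power_mult_distrib mult.assoc)
  qed
  have bd: "0 \<le> (\<Sum>x\<in>V. w x * f k x * exp (2 * q * \<phi> x / r))"
    "(\<Sum>x\<in>V. w x * f k x * exp (2 * q * \<phi> x / r)) \<le> B" if "k \<le> T" for k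
    unfolding frho using wnorm_nonneg[OF h] bound[of "n0 + k"] that n0 n by auto
  have B: "0 \<le> B" using bd[of 0] by linarith
  \<comment> \<open>L^2 is interpolated between L^1 and a sup bound: a single summand of the
    weighted L^1 norm is at most \<open>B\<close>, and \<open>crude\<close> bounds its weight from
    below.\<close>
  have X0: "X 0 \<le> Q * R ^ q"
  proof -
    define K where "K = G * (r\<^sup>2) ^ q * B / F"
    have fK: "f 0 x \<le> K" if x: "x \<in> V" for x
    proof -
      have "w x * f 0 x * exp (2 * q * \<phi> x / r) \<le> B"
        using bd(2)[of 0] fin x f0 wpos
        by (intro order_trans[OF member_le_sum[OF x, of "\<lambda>x. w x * f 0 x * exp (2 * q * \<phi> x / r)"]])
          (auto simp: less_imp_le)
      then have "G * (r\<^sup>2) ^ q * (w x * f 0 x * exp (2 * q * \<phi> x / r)) \<le> G * (r\<^sup>2) ^ q * B"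
        using G by (intro mult_left_mono) auto
      moreover have "F * f 0 x \<le> G * (r\<^sup>2) ^ q * (w x * exp (2 * q * \<phi> x / r)) * f 0 x"
        using crude[OF x] f0[OF x] by (intro mult_right_mono)
      ultimately have "F * f 0 x \<le> G * (r\<^sup>2) ^ q * B" by (simp add: mult_ac)
      then show ?thesis using F by (simp add: K_def pos_le_divide_eq mult.commute)
    qed
    have K: "0 \<le> K" using G F B by (simp add: K_def)
    have "X 0 \<le> (\<Sum>x\<in>V. w x * f 0 x * exp (2 * q * \<phi> x / r) * K)"
      unfolding X ip_def
    proof (rule sum_mono)
      fix x assume x: "x \<in> V"
      have "w x * f 0 x * f 0 x \<le> w x * f 0 x * 1 * K"
        using fK[OF x] f0[OF x] wpos[OF x] by (simp add: mult_left_mono)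
      also have "\<dots> \<le> w x * f 0 x * exp (2 * q * \<phi> x / r) * K"
        using phi_nonneg[OF x] r K f0[OF x] wpos[OF x] by (intro mult_right_mono mult_left_mono) auto
      finally show "w x * f 0 x * f 0 x \<le> w x * f 0 x * exp (2 * q * \<phi> x / r) * K" .
    qed
    also have "\<dots> \<le> B * K"
      unfolding sum_distrib_right[symmetric] using bd[of 0] K by (intro mult_right_mono) auto
    also have "\<dots> = Q * R ^ q" by (simp add: K_def Q_def R_def power2_eq_square mult_ac)
    finally show ?thesis .
  qed
  have Xstep: "X (Suc k) \<le> (1 + \<alpha> * b\<^sup>2 * P / R) * X k - \<theta> * en (f k)" for k
  proof -
    define \<psi> where "\<psi> x = p * (c' * \<phi> x / r)" for x
    define \<epsilon> where "\<epsilon> = p * b / r"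
    have "(p * b)\<^sup>2 \<le> P * (2 * L + 2)"
      unfolding power_mult_distrib P_def using L by (intro mult_left_mono) auto
    also have "\<dots> \<le> r\<^sup>2" using pr by (simp add: P_def)
    finally have "p * b \<le> r" by (rule power2_le_imp_le) (use r in simp)
    then have eps: "0 \<le> \<epsilon>" "\<epsilon> \<le> 1" using r by (auto simp: \<epsilon>_def)
    have "ip (f (Suc k)) (f (Suc k)) \<le> ip (tw \<psi> (f k)) (tw \<psi> (f k))"
    proof -
      have le: "f (Suc k) x \<le> tw \<psi> (f k) x" if x: "x \<in> V" for x
      proof -
        define g where "g y = (op ^^ (n0 + k)) h y * exp (- (c' * \<phi> y / r)) * exp (c' * \<phi> y / r - c' * \<phi> x / r)" for y
        have "(op ^^ (n0 + Suc k)) h x * exp (- (c' * \<phi> x / r)) = op g x"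
        proof -
          have "exp (c' * \<phi> y / r - c' * \<phi> x / r) * ((op ^^ (n0 + k)) h y * exp (- (c' * \<phi> y / r))) = g y" for y
            by (simp only: g_def mult.commute)
          then show ?thesis
            using op_exp_eq_tw[of "(op ^^ (n0 + k)) h" x "\<lambda>x. c' * \<phi> x / r"]
            by (simp add: tw_def op_def[of g])
        qed
        then have "f (Suc k) x = op g x ^ (2 ^ j)" by (simp add: f_def p)
        also have "\<dots> \<le> op (\<lambda>y. g y ^ (2 ^ j)) x"
          by (rule op_Jensen[OF _ x]) (use hn in \<open>simp add: g_def\<close>)
        also have "\<dots> = tw \<psi> (f k) x"
        proof -
          have "g y ^ (2 ^ j) = exp (\<psi> y - \<psi> x) * f k y" for y
          proof -
            have "exp (c' * \<phi> y / r - c' * \<phi> x / r) ^ p = exp (\<psi> y - \<psi> x)"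
              by (simp only: exp_of_nat_mult[symmetric] \<psi>_def right_diff_distrib)
            then show ?thesis
              by (simp only: g_def f_def p[symmetric] power_mult_distrib mult.commute)
          qed
          then show ?thesis by (simp only: tw_def op_def)
        qed
        finally show ?thesis .
      qed
      show ?thesis unfolding ip_def
      proof (rule sum_mono)
        fix x assume x: "x \<in> V"
        then show "w x * f (Suc k) x * f (Suc k) x \<le> w x * tw \<psi> (f k) x * tw \<psi> (f k) x"
          using le[OF x] f0[OF x, of "Suc k"] wpos[OF x] unfolding mult.assoc
          by (intro mult_left_mono mult_mono) auto
      qed
    qed
    also have "\<dots> \<le> (1 + \<alpha> * \<epsilon>\<^sup>2) * ip (f k) (f k) - \<theta> * en (f k)"
    proof (rule tw_bound[OF f0 _ eps])
      fix x y assume xy: "x \<in> V" "y \<in> V" "a x y \<noteq> 0"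
      have "\<psi> y - \<psi> x = p * c' / r * (\<phi> y - \<phi> x)" using r by (simp add: \<psi>_def field_simps)
      then have "\<bar>\<psi> y - \<psi> x\<bar> = p * c' / r * \<bar>\<phi> y - \<phi> x\<bar>" using c' r by (simp add: abs_mult)
      also have "\<dots> \<le> p * b / r * 1"
        using phi_lip[OF xy] c' c r by (intro mult_mono divide_right_mono mult_left_mono) (auto simp: c'_def)
      finally show "\<bar>\<psi> y - \<psi> x\<bar> \<le> \<epsilon>" by (simp add: \<epsilon>_def)
    qed
    also have "\<alpha> * \<epsilon>\<^sup>2 = \<alpha> * b\<^sup>2 * P / R"
      by (simp add: \<epsilon>_def P_def R_def power_mult_distrib power_divide)
    finally show ?thesis by (simp add: X)
  qed
  have al: "0 < \<alpha>" using theta by (simp add: \<alpha>_def add_pos_pos)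
  have "X T \<le> A * Q * (R / (T + L)) ^ q"
  proof (rule nash_sequence[where E = "\<lambda>k. en (f k)" and \<kappa> = \<theta> and C = C and \<alpha> = "\<alpha> * b\<^sup>2" and P = P])
    show "0 < \<theta>" "\<theta> \<le> C" "1 \<le> P" "0 < R" using theta C P1 R by auto
    show "0 < \<alpha> * b\<^sup>2" using al by (intro mult_pos_pos) auto
    show "0 \<le> Q" using G F by (simp add: Q_def)
    show "\<mu> = \<theta> / (2 * C * (real q + \<alpha> * b\<^sup>2))"
      by (simp add: smooth_rate_def \<alpha>_def)
    show "T + L \<le> R / P" using T by simp
    show "X k \<le> C * S * en (f k) + Q * (R / S) ^ q" if k: "k < T" and S: "1 \<le> S" "S \<le> R" for k S
    proof -
      let ?s = "\<Sum>x\<in>V. w x * f k x * exp (2 * q * \<phi> x / r)"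
      have "X k \<le> C * S * en (f k) + G / F * (r\<^sup>2 / S) ^ q * ?s\<^sup>2"
        unfolding X using nash[of "f k" S] f0 S by (simp add: R_def)
      also have "\<dots> \<le> C * S * en (f k) + G / F * (r\<^sup>2 / S) ^ q * B\<^sup>2"
        using bd[of k] k G F S by (intro add_left_mono mult_left_mono power_mono) auto
      finally show ?thesis by (simp add: Q_def R_def mult_ac)
    qed
  qed (use rate L A X0 Xstep X ip_nonneg in auto)
  also have "\<dots> \<le> A * Q * (2 * P) ^ q"
  proof (rule mult_left_mono[OF power_mono])
    have "R / P \<le> 2 * (T + L)" using T(2) RP L(3) by (simp add: distrib_left)
    moreover have "0 < T + L" using L by linarith
    ultimately show "R / (T + L) \<le> 2 * P" using P1 by (simp add: field_simps)
    show "0 \<le> R / (T + L)" using R L by simp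
    show "0 \<le> A * Q" using A G F by (simp add: Q_def)
  qed
  finally show ?thesis
    using n0 by (simp add: X_def c'_def Q_def P_def power_mult_distrib mult_ac)
qed

text \<open>The bounds on successive levels obey B' = (H / F) 4^(q (j + 1)) B^2. After normalization
  the solution is z to the power 2^j, so a root of order 2^J on the last level leaves a constant
  that does not depend on the number of levels.\<close>

lemma ultracontractive:
  assumes h: "\<And>x. x \<in> V \<Longrightarrow> 0 \<le> h x"
    and N: "r\<^sup>2 \<le> real N" and M: "\<And>n. n \<le> N \<Longrightarrow> wnorm h 1 2 n \<le> M"
  shows "((op ^^ N) h v)\<^sup>2 \<le> ultra_const \<theta> q C G / F * M"
proof -
  define H where "H = A * 2 ^ q * G"
  have H: "0 < H" "G \<le> H"
  proof -
    have "1 * 1 \<le> A * 2 ^ q" using A by (intro mult_mono) auto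
    then have "1 * G \<le> H" unfolding H_def using G by (intro mult_right_mono) auto
    then show "0 < H" "G \<le> H" using G by auto
  qed
  define z where "z = 4 ^ (2 * q) * (H / F * M)"
  have M0: "0 \<le> M" using M[of 0] wnorm_nonneg[of h 1 2 0, OF h] by simp
  have z0: "0 \<le> z" using H F M0 by (simp add: z_def)
  \<comment> \<open>The factor 4^(q (j + 2)) turns the recursion into exact squaring, since q (j +
    3) + q (j + 1) = 2 q (j + 2). The time threshold and the exponent, the latter starting from 1,
    are partial sums of r^2 / p^2 and 2 q / p over p = 2, 4, ..., 2^j.\<close>
  define lev where "lev j \<longleftrightarrow> (\<forall>n\<le>N. r\<^sup>2 / 3 * (1 - 1 / 4 ^ j) \<le> real n \<longrightarrow>
      4 ^ (q * (j + 2)) * (H / F * wnorm h (1 + 2 * q * (1 - 1 / 2 ^ j)) (2 ^ (j + 1)) n) \<le> z ^ (2 ^ j))" for j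
  have lev0: "lev 0"
  proof -
    have e: "q * (0 + 2) = 2 * q" by simp
    have "4 ^ (q * (0 + 2)) * (H / F * wnorm h 1 2 n) \<le> z" if "n \<le> N" for n
      unfolding z_def e using M[OF that] H F by (intro mult_left_mono) auto
    then show ?thesis by (simp add: lev_def)
  qed
  have levS: "lev (Suc j)" if lj: "lev j" and jr: "4 ^ (Suc j) * (2 * L + 2) \<le> r\<^sup>2" for j
    unfolding lev_def
  proof (intro allI impI)
    fix n assume n: "n \<le> N" "r\<^sup>2 / 3 * (1 - 1 / 4 ^ Suc j) \<le> real n"
    define c where "c = 1 + 2 * q * (1 - 1 / 2 ^ j)"
    define B where "B = z ^ (2 ^ j) / (4 ^ (q * (j + 2)) * (H / F))"
    define p where "p = (2::nat) ^ (j + 1)"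
    have pp: "(real p)\<^sup>2 = 4 ^ Suc j"
    proof -
      have "(real p)\<^sup>2 = (2\<^sup>2) ^ Suc j"
        by (simp only: p_def of_nat_power of_nat_numeral power_mult[symmetric] mult.commute Suc_eq_plus1)
      then show ?thesis by simp
    qed
    have HF: "0 < H / F" using H F by simp
    have den: "0 < 4 ^ (q * (j + 2)) * (H / F)" using HF by (intro mult_pos_pos) auto
    have cs: "1 + 2 * q * (1 - 1 / 2 ^ Suc j) = c + 2 * q / p"
      by (simp add: c_def p_def field_simps)
    have "wnorm h (c + 2 * q / p) (2 * p) n \<le> A * 2 ^ q * G / F * (real p ^ 2) ^ q * B\<^sup>2"
    proof (rule level_step[OF h p_def])
      show "0 \<le> c" by (auto simp: c_def intro!: add_nonneg_nonneg mult_nonneg_nonneg)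
      show "c + 2 * q / p \<le> b"
        unfolding cs[symmetric] by (auto intro: mult_left_le)
      show "(real p)\<^sup>2 * (2 * L + 2) \<le> r\<^sup>2" using jr by (simp add: pp)
      show "wnorm h c p n' \<le> B" if "r\<^sup>2 / 3 * (1 - 1 / 4 ^ j) \<le> real n'" "n' \<le> N" for n'
      proof -
        have "4 ^ (q * (j + 2)) * (H / F) * wnorm h c p n' \<le> z ^ (2 ^ j)"
          using lj that unfolding lev_def c_def[symmetric] p_def[symmetric] mult.assoc by blast
        then show ?thesis
          unfolding B_def using den pos_le_divide_eq by (metis mult.commute)
      qed
      show "r\<^sup>2 / 3 * (1 - 1 / 4 ^ j) + r\<^sup>2 / (real p)\<^sup>2 \<le> real n"
        using n(2) unfolding pp by (simp add: field_simps)
    qed (use n in auto)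
    then have "4 ^ (q * (Suc j + 2)) * (H / F * wnorm h (c + 2 * q / p) (2 * p) n)
        \<le> 4 ^ (q * (Suc j + 2)) * (H / F * (H / F * (4 ^ Suc j) ^ q * B\<^sup>2))"
      using HF by (intro mult_left_mono) (auto simp: pp H_def)
    also have "\<dots> = (4 ^ (q * (j + 2)) * (H / F) * B)\<^sup>2"
    proof -
      have e: "(4::real) ^ (q * (Suc j + 2)) * (4 ^ Suc j) ^ q = (4 ^ (q * (j + 2)))\<^sup>2"
        by (simp add: power_mult[symmetric] power_add[symmetric] algebra_simps)
      show ?thesis unfolding power_mult_distrib e[symmetric] by (simp add: power2_eq_square mult_ac)
    qed
    also have "4 ^ (q * (j + 2)) * (H / F) * B = z ^ (2 ^ j)" using den H F by (simp add: B_def)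
    also have "(z ^ (2 ^ j))\<^sup>2 = z ^ (2 ^ Suc j)" by (simp add: power_mult[symmetric] mult.commute)
    finally show "4 ^ (q * (Suc j + 2)) * (H / F * wnorm h (1 + 2 * q * (1 - 1 / 2 ^ Suc j)) (2 ^ (Suc j + 1)) n)
        \<le> z ^ (2 ^ Suc j)"
      unfolding cs by (simp add: p_def)
  qed
  obtain k :: nat where "r\<^sup>2 < 4 ^ k" using real_arch_pow[of 4 "r\<^sup>2"] by auto
  also have "\<dots> \<le> 4 ^ Suc k * (2 * L + 2)"
  proof -
    have "(4::real) ^ k * 1 \<le> 4 ^ Suc k * (2 * L + 2)" using L by (intro mult_mono) auto
    then show ?thesis by simp
  qed
  finally have ex: "r\<^sup>2 < 4 ^ Suc k * (2 * L + 2)" .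
  \<comment> \<open>The last level that \<open>levS\<close> reaches; by minimality r is bounded by a
    fixed multiple of 2^J.\<close>
  define J where "J = (LEAST k. r\<^sup>2 < 4 ^ Suc k * (2 * L + 2))"
  have J: "r\<^sup>2 < 4 ^ Suc J * (2 * L + 2)" unfolding J_def by (rule LeastI) (rule ex)
  have "j \<le> J \<Longrightarrow> lev j" for j
  proof (induction j)
    case (Suc j)
    then have "\<not> r\<^sup>2 < 4 ^ Suc j * (2 * L + 2)" unfolding J_def by (meson not_less_Least Suc_le_lessD)
    then show ?case using Suc by (intro levS) auto
  qed (rule lev0)
  then have "lev J" by simp
  moreover have "r\<^sup>2 / 3 * (1 - 1 / 4 ^ J) \<le> real N"
  proof -
    have "r\<^sup>2 / 3 * (1 - 1 / 4 ^ J) \<le> r\<^sup>2 * 1" by (intro mult_mono) auto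
    then show ?thesis using N by simp
  qed
  ultimately have lv: "4 ^ (q * (J + 2)) * (H / F * wnorm h (1 + 2 * q * (1 - 1 / 2 ^ J)) (2 ^ (J + 1)) N) \<le> z ^ (2 ^ J)"
    unfolding lev_def by blast
  define Y where "Y = ((op ^^ N) h v)\<^sup>2"
  have Y: "0 \<le> Y" by (simp add: Y_def)
  have "w v * Y ^ (2 ^ J) \<le> wnorm h (1 + 2 * q * (1 - 1 / 2 ^ J)) (2 ^ (J + 1)) N"
  proof -
    let ?t = "\<lambda>x. w x * ((op ^^ N) h x * exp (- ((1 + 2 * q * (1 - 1 / 2 ^ J)) * \<phi> x / r))) ^ (2 ^ (J + 1))"
    have "?t v \<le> sum ?t V"
      using v fin wpos op_pow_nonneg[OF h] by (intro member_le_sum) (auto simp: less_imp_le)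
    then show ?thesis by (simp add: wnorm_def Y_def phi_v power_mult[symmetric])
  qed
  then have "4 ^ (q * (J + 2)) * (H / F * (w v * Y ^ (2 ^ J))) \<le> z ^ (2 ^ J)"
    using lv H F by (smt (verit) mult_left_mono divide_pos_pos zero_le_power)
  \<comment> \<open>\<open>crude\<close> at \<open>v\<close>, where \<phi> vanishes, trades the
    unknown \<open>w v\<close> for a factor r^(2 q). By the choice of J that is at most 4^(q (J +
    1)) (2 L + 2)^q, and the normalization of level J cancels the power of 4.\<close>
  moreover have "1 \<le> (r\<^sup>2) ^ q * (H / F * w v)"
  proof -
    have "F \<le> G * (r\<^sup>2) ^ q * w v" using crude[OF v] by (simp add: phi_v)
    also have "\<dots> \<le> H * (r\<^sup>2) ^ q * w v" using H wpos[OF v] by (intro mult_right_mono) auto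
    finally show ?thesis using F by (simp add: field_simps)
  qed
  then have "(4 ^ (q * (J + 2)) * Y ^ (2 ^ J)) * 1 \<le> (4 ^ (q * (J + 2)) * Y ^ (2 ^ J)) * ((r\<^sup>2) ^ q * (H / F * w v))"
    using Y by (intro mult_left_mono) auto
  ultimately have "4 ^ (q * (J + 2)) * Y ^ (2 ^ J) \<le> (r\<^sup>2) ^ q * z ^ (2 ^ J)"
    by (smt (verit, del_insts) mult.assoc mult.commute mult_left_mono zero_le_power zero_le_power2)
  also have "\<dots> \<le> (4 ^ Suc J * (2 * L + 2)) ^ q * z ^ (2 ^ J)"
    using J z0 by (intro mult_right_mono power_mono) auto
  also have "\<dots> \<le> 4 ^ (q * (J + 2)) * ((2 * L + 2) ^ q * z ^ (2 ^ J))"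
  proof -
    have "((4::real) ^ Suc J) ^ q \<le> 4 ^ (q * (J + 2))"
      unfolding power_mult[symmetric] by (intro power_increasing) (auto simp: algebra_simps)
    then show ?thesis unfolding power_mult_distrib mult.assoc using L z0 by (intro mult_right_mono) auto
  qed
  \<comment> \<open>A constant \<ge> 1 is at most its own power of order 2^J, so that the root can
    be taken afterwards.\<close>
  also have "\<dots> \<le> 4 ^ (q * (J + 2)) * (((2 * L + 2) ^ q) ^ (2 ^ J) * z ^ (2 ^ J))"
    using L z0 by (intro mult_left_mono mult_right_mono self_le_power one_le_power) auto
  finally have "Y ^ (2 ^ J) \<le> ((2 * L + 2) ^ q * z) ^ (2 ^ J)"
    by (simp add: power_mult_distrib)
  then have "Y \<le> (2 * L + 2) ^ q * z"
    by (rule power_mono_iff[THEN iffD1, rotated 3]) (use Y L z0 in auto)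
  then show ?thesis by (simp add: Y_def z_def H_def ultra_const_def mult_ac)
qed

text \<open>The ultracontractive bound applied to \<open>h = g exp (2 \<phi> / r)\<close>, for which \<open>w v * (op ^^ N) h v\<close>
  is by symmetry the left-hand side itself.\<close>

lemma weighted_L2_bound:
  assumes N: "r\<^sup>2 \<le> real N"
  defines "g \<equiv> (op ^^ N) (\<lambda>x. if x = v then 1 else 0)"
  shows "(\<Sum>x\<in>V. w x * (g x * exp (\<phi> x / r))\<^sup>2)
    \<le> ultra_const \<theta> q C G / F * exp (\<alpha> * N / r\<^sup>2) * (w v)\<^sup>2"
proof -
  define h where "h x = g x * exp (2 * \<phi> x / r)" for x
  define Z where "Z = (\<Sum>x\<in>V. w x * (g x * exp (\<phi> x / r))\<^sup>2)"
  have g0: "0 \<le> g x" if "x \<in> V" for x unfolding g_def by (rule op_pow_nonneg[OF _ that]) auto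
  have h0: "0 \<le> h x" if "x \<in> V" for x using g0[OF that] by (simp add: h_def)
  have al: "0 < \<alpha>" using theta by (simp add: \<alpha>_def add_pos_pos)
  have Z0: "0 \<le> Z" unfolding Z_def using wpos by (intro sum_nonneg) (auto simp: less_imp_le)
  have W0: "wnorm h 1 2 0 = Z"
    unfolding wnorm_def Z_def
    by (intro sum.cong refl) (simp add: h_def mult.assoc exp_add[symmetric])
  have step: "wnorm h 1 2 (Suc n) \<le> (1 + \<alpha> * (1 / r)\<^sup>2) * wnorm h 1 2 n" for n
  proof -
    define f where "f x = (op ^^ n) h x * exp (- (\<phi> x / r))" for x
    have f0: "0 \<le> f x" if "x \<in> V" for x using op_pow_nonneg[OF h0 that] by (simp add: f_def)
    have "wnorm h 1 2 (Suc n) = ip (tw (\<lambda>x. \<phi> x / r) f) (tw (\<lambda>x. \<phi> x / r) f)"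
      using op_exp_eq_tw[of "(op ^^ n) h" _ "\<lambda>x. \<phi> x / r"]
      by (simp add: wnorm_def ip_def f_def[abs_def] power2_eq_square mult.assoc)
    also have "\<dots> \<le> (1 + \<alpha> * (1 / r)\<^sup>2) * ip f f - \<theta> * en f"
    proof (rule tw_bound[OF f0])
      fix x y assume "x \<in> V" "y \<in> V" "a x y \<noteq> 0"
      then show "\<bar>\<phi> y / r - \<phi> x / r\<bar> \<le> 1 / r"
        using phi_lip[of x y] r by (simp add: diff_divide_distrib[symmetric] abs_divide divide_right_mono)
    qed (use r in auto)
    also have "\<dots> \<le> (1 + \<alpha> * (1 / r)\<^sup>2) * ip f f" using en_nonneg[of f] theta by simp
    also have "ip f f = wnorm h 1 2 n" by (simp add: wnorm_def ip_def f_def power2_eq_square mult.assoc)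
    finally show ?thesis .
  qed
  have pw: "wnorm h 1 2 n \<le> (1 + \<alpha> * (1 / r)\<^sup>2) ^ n * Z" for n
  proof (induction n)
    case (Suc n)
    have "wnorm h 1 2 (Suc n) \<le> (1 + \<alpha> * (1 / r)\<^sup>2) * ((1 + \<alpha> * (1 / r)\<^sup>2) ^ n * Z)"
      using step[of n] Suc al by (smt (verit) mult_left_mono zero_le_mult_iff zero_le_power2)
    then show ?case by (simp add: mult.assoc)
  qed (simp add: W0)
  have Mb: "wnorm h 1 2 n \<le> exp (\<alpha> * N / r\<^sup>2) * Z" if "n \<le> N" for n
  proof -
    have "(1 + \<alpha> * (1 / r)\<^sup>2) ^ n \<le> exp (\<alpha> * (1 / r)\<^sup>2) ^ n"
      using al by (intro power_mono) auto
    also have "\<dots> = exp (n * (\<alpha> * (1 / r)\<^sup>2))" by (simp add: exp_of_nat_mult)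
    also have "\<dots> \<le> exp (\<alpha> * N / r\<^sup>2)"
      using that al r by (simp add: power_divide field_simps)
    finally show ?thesis using pw[of n] mult_right_mono[OF _ Z0] order_trans by blast
  qed
  have "w v * (op ^^ N) h v = ip (\<lambda>x. if x = v then 1 else 0) ((op ^^ N) h)"
  proof -
    have "ip (\<lambda>x. if x = v then 1 else 0) ((op ^^ N) h) = (\<Sum>x\<in>V. if x = v then w x * (op ^^ N) h x else 0)"
      unfolding ip_def by (rule sum.cong) auto
    then show ?thesis using v fin by simp
  qed
  also have "\<dots> = ip g h" unfolding op_pow_sym g_def ..
  also have "\<dots> = Z"
    unfolding ip_def Z_def
    by (intro sum.cong refl) (simp add: h_def power2_eq_square exp_add[symmetric] mult_ac)
  finally have "(w v * (op ^^ N) h v)\<^sup>2 = Z\<^sup>2" by simp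
  then have "Z\<^sup>2 = (w v)\<^sup>2 * ((op ^^ N) h v)\<^sup>2" by (simp add: power_mult_distrib)
  also have "\<dots> \<le> (w v)\<^sup>2 * (ultra_const \<theta> q C G / F * (exp (\<alpha> * N / r\<^sup>2) * Z))"
    by (intro mult_left_mono ultracontractive[OF h0 N Mb]) auto
  \<comment> \<open>Z appears squared on the left and linearly on the right, so the estimate closes
    on itself.\<close>
  finally have "Z * Z \<le> (ultra_const \<theta> q C G / F * exp (\<alpha> * N / r\<^sup>2) * (w v)\<^sup>2) * Z"
    by (simp add: power2_eq_square mult_ac)
  moreover have "0 \<le> ultra_const \<theta> q C G / F * exp (\<alpha> * N / r\<^sup>2) * (w v)\<^sup>2"
    using L A G F by (simp add: ultra_const_def)
  ultimately have "Z \<le> ultra_const \<theta> q C G / F * exp (\<alpha> * N / r\<^sup>2) * (w v)\<^sup>2"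
    using Z0 by (cases "Z = 0") (auto intro: mult_right_le_imp_le[of _ Z])
  then show ?thesis by (simp add: Z_def)
qed

end

section \<open>Local Nash inequalities from doubling and Poincare\<close>

lemma gdist_le: "(x, y) \<in> edges G ^^ n \<Longrightarrow> gdist G x y \<le> n"
  unfolding gdist_def by (rule Least_le)

lemma gdist_self [simp]: "gdist G x x = 0"
  using gdist_le[where x = x and y = x and n = 0] by simp

lemma relpow_sym:
  assumes "sym R" "(x, y) \<in> R ^^ n"
  shows "(y, x) \<in> R ^^ n"
  using assms(2)
proof (induction n arbitrary: y)
  case (Suc n)
  then obtain z where "(x, z) \<in> R ^^ n" "(z, y) \<in> R" by auto
  then show ?case using Suc.IH assms(1) by (meson relpow_Suc_I2 symD)
qed simp

locale wgr =
  fixes G :: "'a wgraph"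
  assumes wg: "weighted_graph G"
begin

lemma weighted_graphD:
  "edges G \<subseteq> verts G \<times> verts G" "sym (edges G)" "irrefl (edges G)"
  "adapted G" "subordinate G" "controlled G" "uniformly_lazy G"
  "x \<in> verts G \<Longrightarrow> 0 < vw G x" "connected_in G (verts G)"
  using wg by (auto simp: weighted_graph_def standing_weights_def simple_graph_def)

lemma edgeD: "(x, y) \<in> edges G \<Longrightarrow> x \<in> verts G \<and> y \<in> verts G"
  using weighted_graphD(1) by auto

lemma edge_sym: "(x, y) \<in> edges G \<Longrightarrow> (y, x) \<in> edges G"
  using weighted_graphD(2) by (meson symD)

lemma nbrs_subset: "nbrs G x \<subseteq> verts G"
  using edgeD by (auto simp: nbrs_def)

lemma finite_nbrs: "x \<in> verts G \<Longrightarrow> finite (nbrs G x)"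
  using weighted_graphD(5) by (auto simp: subordinate_def)

lemma ew_sym: "x \<in> verts G \<Longrightarrow> y \<in> verts G \<Longrightarrow> ew G x y = ew G y x"
  using weighted_graphD(4) by (auto simp: adapted_def)

lemma ew_nonneg: "x \<in> verts G \<Longrightarrow> y \<in> verts G \<Longrightarrow> 0 \<le> ew G x y"
  using weighted_graphD(4) by (auto simp: adapted_def)

lemma ew_eq_0: "x \<in> verts G \<Longrightarrow> y \<in> verts G \<Longrightarrow> (x, y) \<notin> edges G \<Longrightarrow> ew G x y = 0"
  using weighted_graphD(4) by (auto simp: adapted_def)

lemma ew_self: "x \<in> verts G \<Longrightarrow> ew G x x = 0"
  using weighted_graphD(3) ew_eq_0 by (auto simp: irrefl_def)

lemma relpow_verts: "(x, y) \<in> edges G ^^ n \<Longrightarrow> x \<in> verts G \<Longrightarrow> y \<in> verts G"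
  by (induction n arbitrary: y) (auto dest: edgeD)

lemma gdist_relpow:
  assumes "x \<in> verts G" "y \<in> verts G"
  shows "(x, y) \<in> edges G ^^ gdist G x y"
proof -
  have "edges G \<inter> verts G \<times> verts G = edges G" using weighted_graphD(1) by auto
  then have "(x, y) \<in> (edges G)\<^sup>*" using weighted_graphD(9) assms by (auto simp: connected_in_def)
  then obtain n where "(x, y) \<in> edges G ^^ n" using rtrancl_imp_relpow by blast
  then show ?thesis unfolding gdist_def by (rule LeastI)
qed

lemma gdist_sym: "x \<in> verts G \<Longrightarrow> y \<in> verts G \<Longrightarrow> gdist G x y = gdist G y x"
  by (meson gdist_le gdist_relpow relpow_sym weighted_graphD(2) order_antisym)

lemma gdist_triangle:
  assumes "x \<in> verts G" "y \<in> verts G" "z \<in> verts G"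
  shows "gdist G x z \<le> gdist G x y + gdist G y z"
  using gdist_relpow[OF assms(1,2)] gdist_relpow[OF assms(2,3)]
  by (intro gdist_le) (auto simp: relpow_add)

lemma gdist_edge: "(x, y) \<in> edges G \<Longrightarrow> gdist G x y \<le> 1"
  by (intro gdist_le) simp

lemma gdist_eq_0: "x \<in> verts G \<Longrightarrow> y \<in> verts G \<Longrightarrow> gdist G x y = 0 \<Longrightarrow> x = y"
  using gdist_relpow[of x y] by simp

lemma finite_relpow: "x \<in> verts G \<Longrightarrow> finite {y. (x, y) \<in> edges G ^^ n}"
proof (induction n)
  case (Suc n)
  have "{y. (x, y) \<in> edges G ^^ Suc n} \<subseteq> (\<Union>z\<in>{z. (x, z) \<in> edges G ^^ n}. nbrs G z)"
    by (auto simp: nbrs_def)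
  moreover have "finite \<dots>"
    using Suc relpow_verts finite_nbrs by (intro finite_UN_I) auto
  ultimately show ?case by (rule finite_subset)
qed simp

lemma finite_gball [simp]:
  assumes "x \<in> verts G"
  shows "finite (gball G x r)"
proof -
  have "gball G x r \<subseteq> (\<Union>n\<in>{..nat \<lfloor>r\<rfloor>}. {y. (x, y) \<in> edges G ^^ n})"
  proof
    fix y assume "y \<in> gball G x r"
    then have "y \<in> verts G" "real (gdist G x y) \<le> r" by (auto simp: gball_def)
    then have "gdist G x y \<in> {..nat \<lfloor>r\<rfloor>}" by (simp add: le_nat_floor)
    then show "y \<in> (\<Union>n\<in>{..nat \<lfloor>r\<rfloor>}. {y. (x, y) \<in> edges G ^^ n})"
      using gdist_relpow[OF assms \<open>y \<in> verts G\<close>] by blast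
  qed
  then show ?thesis using finite_relpow[OF assms] finite_subset by blast
qed

lemmas finite_gball_Collect [simp] = finite_gball[unfolded gball_def]

lemma gball_subset: "gball G x r \<subseteq> verts G"
  by (auto simp: gball_def)

lemma vol_mono:
  assumes "x \<in> verts G" "r \<le> s"
  shows "vol G x r \<le> vol G x s"
  unfolding vol_def
  by (rule sum_mono2) (use assms weighted_graphD(8) in \<open>auto simp: gball_def less_imp_le\<close>)

lemma vol_shift:
  assumes "x \<in> verts G" "y \<in> verts G"
  shows "vol G x r \<le> vol G y (r + gdist G x y)"
  unfolding vol_def
proof (rule sum_mono2)
  show "gball G x r \<subseteq> gball G y (r + gdist G x y)"
  proof
    fix z assume "z \<in> gball G x r"
    then have z: "z \<in> verts G" "gdist G x z \<le> r" by (auto simp: gball_def)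
    then show "z \<in> gball G y (r + gdist G x y)"
      using gdist_triangle[OF assms(2,1) z(1)] gdist_sym[OF assms] by (simp add: gball_def)
  qed
qed (use assms weighted_graphD(8) in \<open>auto simp: gball_def less_imp_le\<close>)

lemma vol_pos:
  assumes "x \<in> verts G" "0 \<le> r"
  shows "0 < vol G x r"
  unfolding vol_def
  by (rule sum_pos2[of _ x]) (use assms weighted_graphD(8) in \<open>auto simp: gball_def less_imp_le\<close>)

lemma vol_small:
  assumes "x \<in> verts G" "0 \<le> r" "r < 1"
  shows "vol G x r = vw G x"
proof -
  have "y = x" if "y \<in> verts G" "real (gdist G x y) \<le> r" for y
  proof -
    have "gdist G x y = 0" using that assms by linarith
    then show ?thesis using gdist_eq_0 assms that by metis
  qed
  then have "gball G x r = {x}" using assms by (auto simp: gball_def)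
  then show ?thesis by (simp add: vol_def)
qed

end

section \<open>Doubling and Poincare with explicit constants\<close>

definition poincare_with :: "'a wgraph \<Rightarrow> real \<Rightarrow> real \<Rightarrow> bool" where
  "poincare_with G Cp \<kappa> \<longleftrightarrow> (\<forall>x\<in>verts G. \<forall>r>0. \<forall>f :: 'a \<Rightarrow> real.
        (\<Sum>y\<in>gball G x r. \<bar>f y - ball_avg G f x r\<bar>\<^sup>2 * vw G y)
        \<le> Cp * r\<^sup>2 * (\<Sum>y\<in>gball G x (\<kappa> * r). \<Sum>z\<in>gball G x (\<kappa> * r). \<bar>f y - f z\<bar>\<^sup>2 * ew G y z))"

text \<open>Rounding the doubling constant up to a power of 4 gives volume growth of exponent 2 q
  with q natural, so that radii r and sqrt S compare by (r^2 / S)^q, the form used in the Nash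
  inequality.\<close>

definition dbl_exp :: "'a wgraph \<Rightarrow> nat \<Rightarrow> bool" where
  "dbl_exp G q \<longleftrightarrow> (\<forall>x\<in>verts G. \<forall>r>0. vol G x (2 * r) \<le> 4 ^ q * vol G x r)"

lemma (in wgr) dbl_exp_mono: "dbl_exp G q \<Longrightarrow> q \<le> q' \<Longrightarrow> dbl_exp G q'"
  unfolding dbl_exp_def
  by (smt (verit) mult_right_mono power_increasing vol_pos)

lemma (in wgr) doubling_dbl_exp:
  assumes "doubling G"
  obtains q where "dbl_exp G q"
proof -
  obtain D :: real where D: "\<And>x (r::real). x \<in> verts G \<Longrightarrow> 0 < r \<Longrightarrow> vol G x (2 * r) \<le> D * vol G x r"
    using assms by (auto simp: doubling_def)
  obtain q :: nat where "D < 4 ^ q" using real_arch_pow[of 4 D] by auto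
  then have "vol G x (2 * r) \<le> 4 ^ q * vol G x r" if "x \<in> verts G" "0 < r" for x and r :: real
    using D[OF that] vol_pos[of x r] that by (smt (verit) mult_right_mono)
  then have "dbl_exp G q" by (auto simp: dbl_exp_def)
  then show ?thesis by (rule that)
qed

lemma (in wgr) vol_growth:
  assumes q: "dbl_exp G q" and x: "x \<in> verts G" and s: "0 < s" "s \<le> t"
  shows "vol G x t \<le> (2 * t / s) ^ (2 * q) * vol G x s"
proof -
  have pow: "vol G x (2 ^ k * s) \<le> (2 ^ k) ^ (2 * q) * vol G x s" for k
  proof (induction k)
    case (Suc k)
    have "vol G x (2 ^ Suc k * s) = vol G x (2 * (2 ^ k * s))" by (simp add: mult.assoc)
    also have "\<dots> \<le> 4 ^ q * vol G x (2 ^ k * s)" using q x s by (simp add: dbl_exp_def)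
    also have "\<dots> \<le> 4 ^ q * ((2 ^ k) ^ (2 * q) * vol G x s)" using Suc by simp
    also have "\<dots> = (2 ^ Suc k) ^ (2 * q) * vol G x s"
      by (simp add: power_mult_distrib power_mult)
    finally show ?case .
  qed simp
  obtain k0 :: nat where "t / s < 2 ^ k0" using real_arch_pow[of 2 "t / s"] by auto
  then have ex: "t \<le> 2 ^ k0 * s" using s by (simp add: field_simps)
  define k where "k = (LEAST k. t \<le> 2 ^ k * s)"
  have k: "t \<le> 2 ^ k * s" unfolding k_def by (rule LeastI) (rule ex)
  have "2 ^ k \<le> 2 * t / s"
  proof (cases k)
    case 0
    then show ?thesis using s by (simp add: field_simps)
  next
    case (Suc j)
    then have "\<not> t \<le> 2 ^ j * s" unfolding k_def by (metis lessI not_less_Least)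
    then show ?thesis using s Suc by (simp add: field_simps)
  qed
  then have "(2 ^ k) ^ (2 * q) * vol G x s \<le> (2 * t / s) ^ (2 * q) * vol G x s"
    using vol_pos[of x s] x s by (intro mult_right_mono power_mono) auto
  then show ?thesis using vol_mono[OF x k] pow[of k] by linarith
qed

text \<open>Averaging the Poincare inequality over all centres \<open>x\<close> with density
  \<open>\<pi>(x) / V(x, s)\<close> replaces a covering argument: by doubling every point receives total mass
  comparable to 1.\<close>

lemma (in wgr) local_nash:
  fixes s \<kappa> lam Cp :: real and f \<tau> :: "'a \<Rightarrow> real"
  assumes q: "dbl_exp G q" and kap: "1 \<le> \<kappa>" and Cp: "0 < Cp"
    and PI: "poincare_with G Cp \<kappa>"
    and A: "finite A" "A \<subseteq> verts G"
    and f: "\<And>y. 0 \<le> f y" "\<And>y. y \<notin> A \<Longrightarrow> f y = 0"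
    and s: "0 < s" and Lam: "0 \<le> lam"
    and tau: "\<And>y. 1 \<le> \<tau> y"
      "\<And>x y. x \<in> verts G \<Longrightarrow> y \<in> A \<Longrightarrow> gdist G x y \<le> s \<Longrightarrow> 1 \<le> lam * \<tau> y * vol G x s"
  shows "\<exists>Y. finite Y \<and> Y \<subseteq> verts G \<and>
    (\<Sum>y\<in>A. vw G y * (f y)\<^sup>2) \<le> 2 * 4 ^ q * (4 * \<kappa>) ^ (2 * q) *
      (Cp * s\<^sup>2 * (\<Sum>y\<in>Y. \<Sum>z\<in>Y. ew G y z * (f y - f z)\<^sup>2) + lam * (\<Sum>y\<in>A. vw G y * f y * \<tau> y)\<^sup>2)"
proof -
  define X where "X = (\<Union>y\<in>A. gball G y s)"
  define Y where "Y = (\<Union>x\<in>X. gball G x (\<kappa> * s))"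
  define m where "m x = vw G x / vol G x s" for x
  \<comment> \<open>For x within t \<le> \<kappa> s of y, the ball of radius t about y lies in that
    of radius 2 t about x, and \<open>vol_growth\<close> from s to 2 t costs (4 t / s)^(2
    q).\<close>
  define M where "M = (4 * \<kappa>) ^ (2 * q)"
  have X: "finite X" "X \<subseteq> verts G" unfolding X_def using A by (auto simp: gball_def)
  have Y: "finite Y" "Y \<subseteq> verts G" unfolding Y_def using X by (auto simp: gball_def)
  have vp: "0 < vol G x s" if "x \<in> verts G" for x using vol_pos that s by simp
  have m0: "0 \<le> m x" if "x \<in> verts G" for x using vp[OF that] weighted_graphD(8)[OF that] by (simp add: m_def)
  have fv: "0 \<le> vw G y * f y" if "y \<in> A" for y using A that by (intro mult_nonneg_nonneg f(1) less_imp_le[OF weighted_graphD(8)]) auto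
  have mass_lower: "1 \<le> 4 ^ q * (\<Sum>x\<in>gball G y s. m x)" if y: "y \<in> verts G" for y
  proof -
    have "vw G x / (4 ^ q * vol G y s) \<le> m x" if x: "x \<in> gball G y s" for x
    proof -
      have xv: "x \<in> verts G" using x by (simp add: gball_def)
      have "vol G x s \<le> vol G y (s + gdist G x y)" by (rule vol_shift[OF xv y])
      also have "\<dots> \<le> vol G y (2 * s)"
        using x gdist_sym[OF xv y] by (intro vol_mono y) (simp add: gball_def)
      also have "\<dots> \<le> 4 ^ q * vol G y s" using q y s by (simp add: dbl_exp_def)
      finally show ?thesis unfolding m_def using vp[OF xv] weighted_graphD(8)[OF xv]
        by (intro divide_left_mono) (auto simp: vp[OF y])
    qed
    then have "(\<Sum>x\<in>gball G y s. vw G x / (4 ^ q * vol G y s)) \<le> (\<Sum>x\<in>gball G y s. m x)"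
      by (rule sum_mono)
    then have "vol G y s / (4 ^ q * vol G y s) \<le> (\<Sum>x\<in>gball G y s. m x)"
      by (simp add: sum_divide_distrib[symmetric] vol_def)
    then show ?thesis using vp[OF y] by (simp add: field_simps)
  qed
  have mass_upper: "(\<Sum>x\<in>gball G y t. m x) \<le> M" if y: "y \<in> verts G" and t: "s \<le> t" "t \<le> \<kappa> * s" for y t
  proof -
    have t0: "0 < t" using s t by simp
    have "m x \<le> vw G x * M / vol G y t" if x: "x \<in> gball G y t" for x
    proof -
      have xv: "x \<in> verts G" using x by (simp add: gball_def)
      have "vol G y t \<le> vol G x (t + gdist G y x)" by (rule vol_shift[OF y xv])
      also have "\<dots> \<le> vol G x (2 * t)" using x by (intro vol_mono xv) (simp add: gball_def)
      also have "\<dots> \<le> (2 * (2 * t) / s) ^ (2 * q) * vol G x s"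
        using t s by (intro vol_growth q xv) auto
      also have "\<dots> \<le> M * vol G x s"
        unfolding M_def using s t vp[OF xv] by (intro mult_right_mono power_mono) (auto simp: field_simps)
      finally have le: "vol G y t \<le> M * vol G x s" .
      have "vw G x * vol G y t \<le> vw G x * (M * vol G x s)"
        using le weighted_graphD(8)[OF xv] by (intro mult_left_mono) auto
      then show ?thesis unfolding m_def using vp[OF xv] vol_pos[OF y, of t] t0
        by (simp add: divide_simps mult_ac)
    qed
    then have "(\<Sum>x\<in>gball G y t. m x) \<le> (\<Sum>x\<in>gball G y t. vw G x * M / vol G y t)"
      by (rule sum_mono)
    also have "\<dots> = vol G y t * M / vol G y t"
      by (simp add: sum_divide_distrib[symmetric] sum_distrib_right[symmetric] vol_def)
    also have "\<dots> = M" using vol_pos[OF y, of t] t0 by simp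
    finally show ?thesis .
  qed
  have AX: "gball G y s \<subseteq> X" if "y \<in> A" for y using that by (auto simp: X_def)
  have swap: "(\<Sum>x\<in>X. m x * (\<Sum>y\<in>gball G x s. g y)) = (\<Sum>y\<in>A. g y * (\<Sum>x\<in>gball G y s. m x))"
    if g: "\<And>y. y \<notin> A \<Longrightarrow> g y = 0" for g :: "'a \<Rightarrow> real"
  proof -
    have "(\<Sum>y\<in>gball G x s. g y) = (\<Sum>y\<in>A. if gdist G x y \<le> s then g y else 0)" if "x \<in> X" for x
      using that A X g by (intro sum.mono_neutral_cong) (auto simp: gball_def)
    then have "(\<Sum>x\<in>X. m x * (\<Sum>y\<in>gball G x s. g y))
        = (\<Sum>x\<in>X. \<Sum>y\<in>A. if gdist G x y \<le> s then m x * g y else 0)"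
      by (simp add: sum_distrib_left if_distrib cong: if_cong)
    also have "\<dots> = (\<Sum>y\<in>A. \<Sum>x\<in>X. if gdist G x y \<le> s then m x * g y else 0)"
      by (rule sum.swap)
    also have "\<dots> = (\<Sum>y\<in>A. \<Sum>x\<in>gball G y s. m x * g y)"
    proof (rule sum.cong[OF refl])
      fix y assume y: "y \<in> A"
      show "(\<Sum>x\<in>X. if gdist G x y \<le> s then m x * g y else 0) = (\<Sum>x\<in>gball G y s. m x * g y)"
      proof (rule sum.mono_neutral_cong_right)
        show "gball G y s \<subseteq> X" by (rule AX[OF y])
        show "\<forall>x\<in>X - gball G y s. (if gdist G x y \<le> s then m x * g y else 0) = 0"
        proof
          fix x assume x: "x \<in> X - gball G y s"
          then have "gdist G x y = gdist G y x" "x \<in> verts G" using X A y by (auto intro: gdist_sym)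
          then show "(if gdist G x y \<le> s then m x * g y else 0) = 0" using x by (auto simp: gball_def)
        qed
        show "(if gdist G x y \<le> s then m x * g y else 0) = m x * g y" if "x \<in> gball G y s" for x
          using that A y gdist_sym[of x y] by (auto simp: gball_def)
      qed (use X in auto)
    qed
    finally show ?thesis by (simp add: sum_distrib_left mult.commute)
  qed
  define e where "e y z = ew G y z * (f y - f z)\<^sup>2" for y z
  have e0: "0 \<le> e y z" if "y \<in> verts G" "z \<in> verts G" for y z using ew_nonneg[OF that] by (simp add: e_def)
  define en where "en x = (\<Sum>y\<in>gball G x (\<kappa> * s). \<Sum>z\<in>gball G x (\<kappa> * s). e y z)" for x
  define N where "N = (\<Sum>y\<in>A. vw G y * f y * \<tau> y)"
  have tau0: "0 \<le> \<tau> y" for y using tau(1)[of y] by simp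
  have N0: "0 \<le> N" unfolding N_def by (intro sum_nonneg mult_nonneg_nonneg[OF fv tau0])
  define a where "a x = (\<Sum>y\<in>gball G x s. vw G y * f y * \<tau> y)" for x
  have fvall: "0 \<le> vw G y * f y" if "y \<in> verts G" for y using that by (intro mult_nonneg_nonneg f(1) less_imp_le[OF weighted_graphD(8)]) auto
  have a0: "0 \<le> a x" if "x \<in> verts G" for x
    unfolding a_def by (intro sum_nonneg mult_nonneg_nonneg fvall tau0) (auto simp: gball_def)
  have aN: "a x \<le> N" if x: "x \<in> verts G" for x
  proof -
    have "a x = (\<Sum>y\<in>gball G x s \<inter> A. vw G y * f y * \<tau> y)"
      unfolding a_def using f by (intro sum.mono_neutral_right) (auto simp: x)
    also have "\<dots> \<le> N"
      unfolding N_def using A fv tau0 by (intro sum_mono2) auto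
    finally show ?thesis .
  qed
  have local: "(\<Sum>y\<in>gball G x s. vw G y * (f y)\<^sup>2)
      \<le> 2 * Cp * s\<^sup>2 * en x + 2 * lam * (N * a x)"
    if x: "x \<in> verts G" for x
  proof -
    define S where "S = (\<Sum>y\<in>gball G x s. f y * vw G y)"
    define V where "V = vol G x s"
    have V: "0 < V" using vp[OF x] by (simp add: V_def)
    have avg: "ball_avg G f x s = S / V" by (simp add: ball_avg_def S_def V_def)
    have S0: "0 \<le> S" unfolding S_def using fvall by (intro sum_nonneg) (auto simp: gball_def mult.commute)
    have "(\<Sum>y\<in>gball G x s. vw G y * (f y)\<^sup>2)
        \<le> (\<Sum>y\<in>gball G x s. 2 * (\<bar>f y - S / V\<bar>\<^sup>2 * vw G y) + 2 * ((S / V)\<^sup>2 * vw G y))"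
    proof (rule sum_mono)
      fix y assume "y \<in> gball G x s"
      then have "0 < vw G y" using weighted_graphD(8) by (auto simp: gball_def)
      have "(f y)\<^sup>2 \<le> 2 * \<bar>f y - S / V\<bar>\<^sup>2 + 2 * (S / V)\<^sup>2"
        using zero_le_power2[of "f y - 2 * (S / V)"] by (simp add: power2_eq_square algebra_simps)
      then have "vw G y * (f y)\<^sup>2 \<le> vw G y * (2 * \<bar>f y - S / V\<bar>\<^sup>2 + 2 * (S / V)\<^sup>2)"
        using \<open>0 < vw G y\<close> by (intro mult_left_mono) auto
      then show "vw G y * (f y)\<^sup>2 \<le> 2 * (\<bar>f y - S / V\<bar>\<^sup>2 * vw G y) + 2 * ((S / V)\<^sup>2 * vw G y)"
        by (simp add: algebra_simps)
    qed
    also have "\<dots> = 2 * (\<Sum>y\<in>gball G x s. \<bar>f y - S / V\<bar>\<^sup>2 * vw G y) + 2 * ((S / V)\<^sup>2 * V)"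
      by (simp add: sum.distrib sum_distrib_left[symmetric] V_def vol_def)
    also have "\<dots> \<le> 2 * (Cp * s\<^sup>2 * en x) + 2 * (lam * (N * a x))"
    proof (intro add_mono mult_left_mono)
      show "(\<Sum>y\<in>gball G x s. \<bar>f y - S / V\<bar>\<^sup>2 * vw G y) \<le> Cp * s\<^sup>2 * en x"
        using PI[unfolded poincare_with_def, rule_format, OF x s, of f]
          by (simp add: avg en_def e_def mult.commute)
      \<comment> \<open>By hypothesis \<open>lam * \<tau> y\<close> dominates the reciprocal volume
        about x for each y of the ball in \<open>A\<close>; this lets the volume vary with
        x.\<close>
      have "S \<le> (\<Sum>y\<in>gball G x s. lam * V * (vw G y * f y * \<tau> y))"
        unfolding S_def
      proof (rule sum_mono)
        fix y assume y: "y \<in> gball G x s"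
        show "f y * vw G y \<le> lam * V * (vw G y * f y * \<tau> y)"
        proof (cases "y \<in> A")
          case True
          have "(vw G y * f y) * 1 \<le> (vw G y * f y) * (lam * \<tau> y * V)"
            unfolding V_def using y fv[OF True] by (intro mult_left_mono tau(2) x True) (auto simp: gball_def)
          then show ?thesis by (simp add: mult_ac)
        qed (simp add: f)
      qed
      then have 1: "S \<le> lam * V * a x" by (simp add: a_def sum_distrib_left)
      have "S \<le> a x"
        unfolding S_def a_def
      proof (rule sum_mono)
        fix y assume y: "y \<in> gball G x s"
        then have "(vw G y * f y) * 1 \<le> (vw G y * f y) * \<tau> y"
          using fvall[of y] tau by (intro mult_left_mono) (auto simp: gball_def)
        then show "f y * vw G y \<le> vw G y * f y * \<tau> y" by (simp add: mult.commute)
      qed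
      then have 2: "S \<le> N" using aN[OF x] by simp
      \<comment> \<open>Only one factor S is replaced by the global \<open>N\<close>. The other
        keeps the local \<open>a x\<close>, which the average over x sums to a multiple of
        \<open>N\<close>.\<close>
      have "S * S \<le> (lam * V * a x) * N"
        using 1 2 S0 by (intro mult_mono) auto
      then have "S * S / V \<le> lam * (N * a x)" using V by (simp add: divide_le_eq mult_ac)
      then show "(S / V)\<^sup>2 * V \<le> lam * (N * a x)" using V by (simp add: power2_eq_square)
    qed auto
    finally show ?thesis by (simp add: mult_ac)
  qed
  have "(\<Sum>y\<in>A. vw G y * (f y)\<^sup>2) \<le> (\<Sum>y\<in>A. vw G y * (f y)\<^sup>2 * (4 ^ q * (\<Sum>x\<in>gball G y s. m x)))"
  proof (rule sum_mono)
    fix y assume y: "y \<in> A"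
    then have "0 \<le> vw G y * (f y)\<^sup>2" using A by (intro mult_nonneg_nonneg less_imp_le[OF weighted_graphD(8)]) auto
    then show "vw G y * (f y)\<^sup>2 \<le> vw G y * (f y)\<^sup>2 * (4 ^ q * (\<Sum>x\<in>gball G y s. m x))"
      using mult_left_mono[OF mass_lower] y A by fastforce
  qed
  also have "\<dots> = 4 ^ q * (\<Sum>x\<in>X. m x * (\<Sum>y\<in>gball G x s. vw G y * (f y)\<^sup>2))"
    by (subst swap) (auto simp: f sum_distrib_left mult_ac)
  also have "(\<Sum>x\<in>X. m x * (\<Sum>y\<in>gball G x s. vw G y * (f y)\<^sup>2))
      \<le> (\<Sum>x\<in>X. m x * (2 * Cp * s\<^sup>2 * en x + 2 * lam * (N * a x)))"
    using X m0 by (intro sum_mono mult_left_mono local) auto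
  also have "\<dots> = 2 * Cp * s\<^sup>2 * (\<Sum>x\<in>X. m x * en x)
      + 2 * lam * N * (\<Sum>x\<in>X. m x * a x)"
    by (simp add: sum.distrib sum_distrib_left algebra_simps)
  also have "(\<Sum>x\<in>X. m x * a x) \<le> N * M"
  proof -
    have "(\<Sum>x\<in>X. m x * a x) = (\<Sum>y\<in>A. vw G y * f y * \<tau> y * (\<Sum>x\<in>gball G y s. m x))"
      unfolding a_def by (subst swap) (auto simp: f)
    also have "\<dots> \<le> (\<Sum>y\<in>A. vw G y * f y * \<tau> y * M)"
      using A s kap tau0 fv by (intro sum_mono mult_left_mono mass_upper) auto
    finally show ?thesis by (simp add: N_def sum_distrib_right)
  qed
  also have "(\<Sum>x\<in>X. m x * en x)
      \<le> M * (\<Sum>y\<in>Y. \<Sum>z\<in>Y. e y z)"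
  proof -
    \<comment> \<open>Enlarging the range of z to all of \<open>Y\<close> leaves x tied to y alone,
      so that \<open>mass_upper\<close> at scale \<kappa> s applies.\<close>
    have "(\<Sum>x\<in>X. m x * en x)
        \<le> (\<Sum>x\<in>X. m x * (\<Sum>y\<in>Y. if gdist G x y \<le> \<kappa> * s then (\<Sum>z\<in>Y. e y z) else 0))"
    proof (intro sum_mono mult_left_mono)
      fix x assume x: "x \<in> X"
      then have sub: "gball G x (\<kappa> * s) \<subseteq> Y" by (auto simp: Y_def)
      have "en x \<le> (\<Sum>y\<in>gball G x (\<kappa> * s). \<Sum>z\<in>Y. e y z)"
        unfolding en_def using sub Y by (intro sum_mono sum_mono2 e0) (auto simp: gball_def)
      also have "\<dots> = (\<Sum>y\<in>Y. if gdist G x y \<le> \<kappa> * s then (\<Sum>z\<in>Y. e y z) else 0)"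
        using sub Y by (intro sum.mono_neutral_cong_left) (auto simp: gball_def)
      finally show "en x
        \<le> (\<Sum>y\<in>Y. if gdist G x y \<le> \<kappa> * s then (\<Sum>z\<in>Y. e y z) else 0)" .
    qed (use X m0 in auto)
    also have "\<dots> = (\<Sum>x\<in>X. \<Sum>y\<in>Y. if gdist G x y \<le> \<kappa> * s then m x * (\<Sum>z\<in>Y. e y z) else 0)"
      by (simp add: sum_distrib_left if_distrib cong: if_cong)
    also have "\<dots> = (\<Sum>y\<in>Y. \<Sum>x\<in>X. if gdist G x y \<le> \<kappa> * s then m x * (\<Sum>z\<in>Y. e y z) else 0)"
      by (rule sum.swap)
    also have "\<dots> \<le> (\<Sum>y\<in>Y. M * (\<Sum>z\<in>Y. e y z))"
    proof (rule sum_mono)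
      fix y assume y: "y \<in> Y"
      then have yv: "y \<in> verts G" using Y by auto
      have E0: "0 \<le> (\<Sum>z\<in>Y. e y z)" using Y yv by (intro sum_nonneg e0) auto
      have "(\<Sum>x\<in>X. if gdist G x y \<le> \<kappa> * s then m x * (\<Sum>z\<in>Y. e y z) else 0)
          = (\<Sum>x\<in>X \<inter> gball G y (\<kappa> * s). m x * (\<Sum>z\<in>Y. e y z))"
        using X yv gdist_sym[of y] by (intro sum.mono_neutral_cong_right) (auto simp: gball_def)
      also have "\<dots> \<le> (\<Sum>x\<in>gball G y (\<kappa> * s). m x * (\<Sum>z\<in>Y. e y z))"
        using yv m0 E0 by (intro sum_mono2) (auto simp: gball_def)
      also have "\<dots> \<le> M * (\<Sum>z\<in>Y. e y z)"
        unfolding sum_distrib_right[symmetric]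
        using yv kap s E0 by (intro mult_right_mono mass_upper) auto
      finally show "(\<Sum>x\<in>X. if gdist G x y \<le> \<kappa> * s then m x * (\<Sum>z\<in>Y. e y z) else 0) \<le> M * (\<Sum>z\<in>Y. e y z)" .
    qed
    finally show ?thesis by (simp add: sum_distrib_left)
  qed
  finally have "(\<Sum>y\<in>A. vw G y * (f y)\<^sup>2)
      \<le> 4 ^ q * (2 * Cp * s\<^sup>2 * (M * (\<Sum>y\<in>Y. \<Sum>z\<in>Y. e y z)) + 2 * lam * N * (N * M))"
    using Cp Lam N0 by (simp add: mult_left_mono)
  then show ?thesis
    using Y by (intro exI[of _ Y]) (simp add: M_def N_def e_def power2_eq_square algebra_simps)
qed

section \<open>Books: the Nash inequality on the whole graph\<close>

lemma relpow_subset: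
  fixes R S :: "('a \<times> 'a) set"
  shows "R \<subseteq> S \<Longrightarrow> (x, y) \<in> R ^^ n \<Longrightarrow> (x, y) \<in> S ^^ n"
  by (induction n arbitrary: y) auto

text \<open>The common ground of gluing and cutting, with every constant named; only \<kappa> and
  \<open>Cp\<close> still depend on the page. Uniformity enters as the comparison \<open>U\<close>
  of page distance with ambient distance.\<close>

locale book = wgr G for G :: "'a wgraph" +
  fixes P :: "nat \<Rightarrow> 'a wgraph" and l :: nat and \<delta> K U Ce Cc :: real and q :: nat
    and \<kappa> Cp :: "nat \<Rightarrow> real"
  assumes l: "1 \<le> l" and delta: "0 < \<delta>"
    and page_wg: "i \<in> {1..l} \<Longrightarrow> weighted_graph (P i)"
    and page_verts: "i \<in> {1..l} \<Longrightarrow> verts (P i) \<subseteq> verts G"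
    and page_edges: "i \<in> {1..l} \<Longrightarrow> edges (P i) \<subseteq> edges G"
    and K: "1 \<le> K"
    and vw_page: "i \<in> {1..l} \<Longrightarrow> x \<in> verts (P i) \<Longrightarrow> vw (P i) x \<le> K * vw G x"
      "i \<in> {1..l} \<Longrightarrow> x \<in> verts (P i) \<Longrightarrow> vw G x \<le> K * vw (P i) x"
    and ew_page: "i \<in> {1..l} \<Longrightarrow> x \<in> verts (P i) \<Longrightarrow> y \<in> verts (P i) \<Longrightarrow> ew (P i) x y \<le> K * ew G x y"
    and cover: "x \<in> verts G \<Longrightarrow> \<exists>i\<in>{1..l}. \<exists>u\<in>verts (P i). real (gdist G x u) \<le> \<delta>"
    and spine: "verts (P 0) \<subseteq> verts G"
    and book: "v \<in> verts (P 0) \<Longrightarrow> i \<in> {1..l} \<Longrightarrow> \<exists>u\<in>verts (P i). real (gdist G v u) \<le> \<delta>"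
    and U: "1 \<le> U"
      "i \<in> {1..l} \<Longrightarrow> x \<in> verts (P i) \<Longrightarrow> y \<in> verts (P i) \<Longrightarrow> real (gdist (P i) x y) \<le> U * gdist G x y"
    and q: "i \<in> {1..l} \<Longrightarrow> dbl_exp (P i) q"
    and kap: "i \<in> {1..l} \<Longrightarrow> 1 \<le> \<kappa> i" and Cp: "i \<in> {1..l} \<Longrightarrow> 0 < Cp i"
    and PI: "i \<in> {1..l} \<Longrightarrow> poincare_with (P i) (Cp i) (\<kappa> i)"
    and Ce: "0 < Ce" "Ce < 1" "x \<in> verts G \<Longrightarrow> (\<Sum>y\<in>nbrs G x. ew G x y) \<le> (1 - Ce) * vw G x"
    and Cc: "1 < Cc" "(x, y) \<in> edges G \<Longrightarrow> vw G x \<le> Cc * ew G x y"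
begin

lemma page_wgr: "i \<in> {1..l} \<Longrightarrow> wgr (P i)"
  using page_wg by unfold_locales

lemma page_vertsD: "i \<in> {1..l} \<Longrightarrow> x \<in> verts (P i) \<Longrightarrow> x \<in> verts G"
  using page_verts by blast

lemma gdist_page:
  assumes "i \<in> {1..l}" "x \<in> verts (P i)" "y \<in> verts (P i)"
  shows "gdist G x y \<le> gdist (P i) x y"
proof (rule gdist_le)
  have "(x, y) \<in> edges (P i) ^^ gdist (P i) x y"
    by (rule wgr.gdist_relpow[OF page_wgr]) (use assms in auto)
  then show "(x, y) \<in> edges G ^^ gdist (P i) x y"
    using relpow_subset[OF page_edges[OF assms(1)]] by blast
qed

lemma sum_ew_le:
  assumes "finite S" "S \<subseteq> verts G" "x \<in> verts G"
  shows "(\<Sum>y\<in>S. ew G x y) \<le> (\<Sum>y\<in>nbrs G x. ew G x y)"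
proof -
  have "(\<Sum>y\<in>S. ew G x y) = (\<Sum>y\<in>S \<inter> nbrs G x. ew G x y)"
    using assms ew_eq_0 by (intro sum.mono_neutral_right) (auto simp: nbrs_def)
  also have "\<dots> \<le> (\<Sum>y\<in>nbrs G x. ew G x y)"
    using assms nbrs_subset[of x] by (intro sum_mono2 finite_nbrs ew_nonneg) auto
  finally show ?thesis .
qed

lemma sum_ew_le_vw:
  assumes "finite S" "S \<subseteq> verts G" "x \<in> verts G"
  shows "(\<Sum>y\<in>S. ew G x y) \<le> vw G x"
  using sum_ew_le[OF assms] weighted_graphD(5) assms(3) unfolding subordinate_def by (meson order_trans)

lemma ew_le_vw: "x \<in> verts G \<Longrightarrow> y \<in> verts G \<Longrightarrow> ew G x y \<le> vw G x"
  using sum_ew_le_vw[of "{y}" x] by simp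

lemma vw_path:
  "(x, y) \<in> edges G ^^ n \<Longrightarrow> vw G y \<le> Cc ^ n * vw G x"
proof (induction n arbitrary: y)
  case (Suc n)
  then obtain z where z: "(x, z) \<in> edges G ^^ n" "(z, y) \<in> edges G" by auto
  have "vw G y \<le> Cc * ew G y z" using Cc(2) edge_sym z by blast
  also have "\<dots> = Cc * ew G z y" using ew_sym edgeD z by metis
  also have "\<dots> \<le> Cc * vw G z" using Cc(1) edgeD[OF z(2)] ew_le_vw by (intro mult_left_mono) auto
  also have "\<dots> \<le> Cc * (Cc ^ n * vw G x)" using Suc.IH[OF z(1)] Cc(1) by (intro mult_left_mono) auto
  finally show ?case by simp
qed simp

definition a :: "'a \<Rightarrow> 'a \<Rightarrow> real" where
  "a x y = (if x = y then vw G x - (\<Sum>z\<in>nbrs G x. ew G x z) else ew G x y)"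

lemma a_markov:
  assumes "x \<in> verts G"
  shows "markov G x y = a x y / vw G x"
  using weighted_graphD(8)[OF assms]
  by (cases "x = y") (simp_all add: markov_def a_def diff_divide_distrib sum_divide_distrib)

lemma subkernel:
  assumes "finite V" "V \<subseteq> verts G"
  shows "subkernel V (vw G) a Ce"
proof
  fix x assume x: "x \<in> V"
  then have xv: "x \<in> verts G" using assms by auto
  show "0 < vw G x" by (rule weighted_graphD(8)[OF xv])
  show axx: "Ce * vw G x \<le> a x x" using Ce(3)[OF xv] by (simp add: a_def algebra_simps)
  have "(\<Sum>y\<in>V. a x y) = a x x + (\<Sum>y\<in>V-{x}. ew G x y)"
  proof -
    have "(\<Sum>y\<in>V-{x}. a x y) = (\<Sum>y\<in>V-{x}. ew G x y)"
      by (rule sum.cong) (auto simp: a_def)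
    then show ?thesis using sum.remove[OF assms(1) x, of "a x"] by simp
  qed
  also have "\<dots> \<le> vw G x"
    using sum_ew_le[of "V - {x}" x] assms xv by (auto simp: a_def)
  finally show "(\<Sum>y\<in>V. a x y) \<le> vw G x" .
  show "a x y = a y x" if "y \<in> V" for y using ew_sym[of x y] xv that assms by (auto simp: a_def)
  show "0 \<le> a x y" if "y \<in> V" for y
  proof (cases "x = y")
    case True
    have "0 \<le> Ce * vw G x" using Ce weighted_graphD(8)[OF xv] by simp
    then show ?thesis using axx True by simp
  next
    case False
    then show ?thesis using ew_nonneg[of x y] xv that assms by (auto simp: a_def)
  qed
qed (use assms Ce in auto)

text \<open>Across an edge leaving \<open>V\<close> the extension of f by zero drops to 0, and
  \<open>en\<close> accounts for exactly this as killed mass. The factor 2 comes from ordered pairs;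
  edges that are missed by \<open>Y\<close> make it an inequality.\<close>

lemma energy_le_en:
  assumes V: "finite V" "V \<subseteq> verts G" and Y: "finite Y" "Y \<subseteq> verts G"
    and f: "\<And>x. x \<notin> V \<Longrightarrow> f x = 0"
  shows "(\<Sum>x\<in>Y. \<Sum>y\<in>Y. ew G x y * (f x - f y)\<^sup>2) \<le> 2 * subkernel.en V (vw G) a f"
proof -
  interpret s: subkernel V "vw G" a Ce by (rule subkernel[OF V])
  define Z where "Z = Y \<union> V"
  have Z: "finite Z" "Z \<subseteq> verts G" "V \<subseteq> Z" using V Y by (auto simp: Z_def)
  have "(\<Sum>x\<in>Y. \<Sum>y\<in>Y. ew G x y * (f x - f y)\<^sup>2) \<le> (\<Sum>x\<in>Z. \<Sum>y\<in>Z. ew G x y * (f x - f y)\<^sup>2)"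
  proof -
    have "(\<Sum>x\<in>Y. \<Sum>y\<in>Y. ew G x y * (f x - f y)\<^sup>2) \<le> (\<Sum>x\<in>Y. \<Sum>y\<in>Z. ew G x y * (f x - f y)\<^sup>2)"
      using Z Y by (intro sum_mono sum_mono2 mult_nonneg_nonneg ew_nonneg) (auto simp: Z_def)
    also have "\<dots> \<le> (\<Sum>x\<in>Z. \<Sum>y\<in>Z. ew G x y * (f x - f y)\<^sup>2)"
      using Z Y by (intro sum_mono2 sum_nonneg mult_nonneg_nonneg ew_nonneg) (auto simp: Z_def)
    finally show ?thesis .
  qed
  also have "\<dots> = 2 * (\<Sum>x\<in>Z. \<Sum>y\<in>Z. ew G x y * (f x)\<^sup>2) - 2 * (\<Sum>x\<in>Z. \<Sum>y\<in>Z. ew G x y * f x * f y)"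
  proof -
    have "(\<Sum>x\<in>Z. \<Sum>y\<in>Z. ew G x y * (f x - f y)\<^sup>2)
        = (\<Sum>x\<in>Z. \<Sum>y\<in>Z. ew G x y * (f x)\<^sup>2) + (\<Sum>x\<in>Z. \<Sum>y\<in>Z. ew G x y * (f y)\<^sup>2)
          - 2 * (\<Sum>x\<in>Z. \<Sum>y\<in>Z. ew G x y * f x * f y)"
      by (simp add: sum.distrib[symmetric] sum_subtractf[symmetric] sum_distrib_left
          power2_eq_square algebra_simps)
    moreover have "(\<Sum>x\<in>Z. \<Sum>y\<in>Z. ew G x y * (f y)\<^sup>2) = (\<Sum>x\<in>Z. \<Sum>y\<in>Z. ew G x y * (f x)\<^sup>2)"
      by (subst sum.swap, intro sum.cong refl arg_cong[where f = "\<lambda>t. t * _"] ew_sym) (use Z in auto)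
    ultimately show ?thesis by simp
  qed
  also have "(\<Sum>x\<in>Z. \<Sum>y\<in>Z. ew G x y * (f x)\<^sup>2) \<le> (\<Sum>x\<in>V. (\<Sum>y\<in>nbrs G x. ew G x y) * (f x)\<^sup>2)"
  proof -
    have "(\<Sum>x\<in>Z. \<Sum>y\<in>Z. ew G x y * (f x)\<^sup>2) = (\<Sum>x\<in>V. (\<Sum>y\<in>Z. ew G x y) * (f x)\<^sup>2)"
      using Z f by (intro sum.mono_neutral_cong_right) (auto simp: sum_distrib_right)
    also have "\<dots> \<le> (\<Sum>x\<in>V. (\<Sum>y\<in>nbrs G x. ew G x y) * (f x)\<^sup>2)"
      using Z V by (intro sum_mono mult_right_mono sum_ew_le) auto
    finally show ?thesis .
  qed
  also have "(\<Sum>x\<in>Z. \<Sum>y\<in>Z. ew G x y * f x * f y) = (\<Sum>x\<in>V. \<Sum>y\<in>V. ew G x y * f x * f y)"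
  proof -
    have "(\<Sum>x\<in>Z. \<Sum>y\<in>Z. ew G x y * f x * f y) = (\<Sum>x\<in>Z. \<Sum>y\<in>V. ew G x y * f x * f y)"
      using Z f by (intro sum.cong refl sum.mono_neutral_right) auto
    also have "\<dots> = (\<Sum>x\<in>V. \<Sum>y\<in>V. ew G x y * f x * f y)"
      using Z f by (intro sum.mono_neutral_right) auto
    finally show ?thesis .
  qed
  finally have "(\<Sum>x\<in>Y. \<Sum>y\<in>Y. ew G x y * (f x - f y)\<^sup>2)
      \<le> 2 * (\<Sum>x\<in>V. (\<Sum>y\<in>nbrs G x. ew G x y) * (f x)\<^sup>2) - 2 * (\<Sum>x\<in>V. \<Sum>y\<in>V. ew G x y * f x * f y)"
    by simp
  moreover have "s.en f = (\<Sum>x\<in>V. (\<Sum>y\<in>nbrs G x. ew G x y) * (f x)\<^sup>2) - (\<Sum>x\<in>V. \<Sum>y\<in>V. ew G x y * f x * f y)"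
  proof -
    have row: "(\<Sum>y\<in>V. a x y * f x * f y) = (vw G x - (\<Sum>y\<in>nbrs G x. ew G x y)) * (f x)\<^sup>2
        + (\<Sum>y\<in>V. ew G x y * f x * f y)" if x: "x \<in> V" for x
    proof -
      have "ew G x x = 0" using ew_self x V by auto
      then have "(\<Sum>y\<in>V. ew G x y * f x * f y) = (\<Sum>y\<in>V-{x}. ew G x y * f x * f y)"
        using x V by (subst sum.remove[of _ x]) auto
      moreover have "(\<Sum>y\<in>V. a x y * f x * f y) = a x x * f x * f x + (\<Sum>y\<in>V-{x}. ew G x y * f x * f y)"
      proof -
        have "(\<Sum>y\<in>V-{x}. a x y * f x * f y) = (\<Sum>y\<in>V-{x}. ew G x y * f x * f y)"
          by (rule sum.cong) (auto simp: a_def)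
        then show ?thesis using sum.remove[OF V(1) x, of "\<lambda>y. a x y * f x * f y"] by simp
      qed
      ultimately show ?thesis by (simp add: a_def power2_eq_square mult.assoc)
    qed
    have "s.en f = (\<Sum>x\<in>V. vw G x * f x * f x) - (\<Sum>x\<in>V. \<Sum>y\<in>V. a x y * f x * f y)"
      unfolding s.en_def s.ip_op by (simp add: s.ip_def)
    also have "\<dots> = (\<Sum>x\<in>V. vw G x * f x * f x) - (\<Sum>x\<in>V. (vw G x - (\<Sum>y\<in>nbrs G x. ew G x y)) * (f x)\<^sup>2
        + (\<Sum>y\<in>V. ew G x y * f x * f y))"
      by (simp only: row cong: sum.cong)
    also have "\<dots> = (\<Sum>x\<in>V. (\<Sum>y\<in>nbrs G x. ew G x y) * (f x)\<^sup>2) - (\<Sum>x\<in>V. \<Sum>y\<in>V. ew G x y * f x * f y)"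
      by (simp add: sum.distrib sum_subtractf left_diff_distrib power2_eq_square mult.assoc)
    finally show ?thesis .
  qed
  ultimately show ?thesis by simp
qed

section \<open>From the pages to the vertices near them\<close>

definition pages :: "'a set" where "pages = (\<Union>i\<in>{1..l}. verts (P i))"

text \<open>Induction on the distance from the pages: a vertex of layer k + 1 has a neighbour y in
  layer k, f(x)^2 \<le> 2 f(y)^2 + 2 (f(x) - f(y))^2, and controlled weights replace
  \<open>vw G x\<close> by \<open>Cc * ew G x y\<close>. Every vertex is reached after floor
  \<delta> layers.\<close>

lemma spread_from_pages:
  assumes A: "finite A" "A \<subseteq> verts G" and f: "\<And>x. x \<notin> A \<Longrightarrow> f x = 0"
  shows "\<exists>Y. finite Y \<and> Y \<subseteq> verts G \<and> (\<Sum>x\<in>A. vw G x * (f x)\<^sup>2)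
    \<le> (1 + 2 * Cc) ^ nat \<lfloor>\<delta>\<rfloor> * ((\<Sum>x\<in>A \<inter> pages. vw G x * (f x)\<^sup>2)
       + (\<Sum>x\<in>Y. \<Sum>y\<in>Y. ew G x y * (f x - f y)\<^sup>2))"
proof -
  define Y where "Y = A \<union> (\<Union>x\<in>A. nbrs G x)"
  have Y: "finite Y" "Y \<subseteq> verts G"
    unfolding Y_def using A finite_nbrs nbrs_subset by auto
  define D where "D = (\<Sum>x\<in>Y. \<Sum>y\<in>Y. ew G x y * (f x - f y)\<^sup>2)"
  have D0: "0 \<le> D" unfolding D_def using Y by (intro sum_nonneg mult_nonneg_nonneg ew_nonneg) auto
  define N where "N k = {x \<in> verts G. \<exists>u\<in>pages. gdist G x u \<le> k}" for k :: nat
  define W where "W k = (\<Sum>x\<in>A \<inter> N k. vw G x * (f x)\<^sup>2)" for k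
  have pv: "pages \<subseteq> verts G" unfolding pages_def using page_verts by blast
  have f0: "0 \<le> vw G x * (f x)\<^sup>2" if "x \<in> verts G" for x using weighted_graphD(8)[OF that] by simp
  \<comment> \<open>Adding the energy \<open>D\<close> to both sides makes the recursion a plain
    multiplication by 1 + 2 Cc.\<close>
  have step: "W (Suc k) + D \<le> (1 + 2 * Cc) * (W k + D)" for k
  proof -
    \<comment> \<open>All neighbours in \<open>Y\<close> enter instead of one chosen neighbour:
      subordination then bounds the sum over x by \<open>vw G y\<close>, with no count of how often
      y is chosen.\<close>
    define s1 s2 where "s1 x = (\<Sum>y\<in>Y. if y \<in> N k then ew G x y * (f y)\<^sup>2 else 0)" and "s2 x = (\<Sum>y\<in>Y. ew G x y * (f x - f y)\<^sup>2)" for x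
    have s0: "0 \<le> s1 x" "0 \<le> s2 x" if "x \<in> verts G" for x
      unfolding s1_def s2_def using that Y
      by (auto intro!: sum_nonneg mult_nonneg_nonneg ew_nonneg)
    let ?t = "\<lambda>x. (if x \<in> N k then vw G x * (f x)\<^sup>2 else 0) + 2 * Cc * s1 x + 2 * Cc * s2 x"
    have t0: "0 \<le> ?t x" if "x \<in> verts G" for x using s0[OF that] f0[OF that] Cc by simp
    have pt: "vw G x * (f x)\<^sup>2 \<le> ?t x" if x: "x \<in> A \<inter> N (Suc k)" for x
    proof -
      have xv: "x \<in> verts G" using x A by auto
      show ?thesis
      proof (cases "x \<in> N k")
        case True
        then show ?thesis using s0[OF xv] Cc by simp
      next
        case False
        obtain u where u: "u \<in> pages" "gdist G x u \<le> Suc k" using x by (auto simp: N_def)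
        then have "gdist G x u = Suc k" using False xv by (auto simp: N_def)
        then have "(x, u) \<in> edges G ^^ Suc k" using gdist_relpow[OF xv] u pv by fastforce
        then obtain y where y: "(x, y) \<in> edges G" "(y, u) \<in> edges G ^^ k" by (meson relpow_Suc_D2)
        have yN: "y \<in> N k" using gdist_le[OF y(2)] edgeD[OF y(1)] u(1) by (auto simp: N_def)
        have yY: "y \<in> Y" using y x by (auto simp: Y_def nbrs_def)
        have e0: "0 \<le> ew G x z" if "z \<in> Y" for z using ew_nonneg xv that Y by auto
        have 1: "ew G x y * (f y)\<^sup>2 \<le> s1 x"
          using member_le_sum[OF yY, of "\<lambda>y. if y \<in> N k then ew G x y * (f y)\<^sup>2 else 0"] yN Y e0
          by (simp add: s1_def)
        have 2: "ew G x y * (f x - f y)\<^sup>2 \<le> s2 x"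
          using member_le_sum[OF yY, of "\<lambda>y. ew G x y * (f x - f y)\<^sup>2"] Y e0 by (simp add: s2_def)
        have "vw G x * (f x)\<^sup>2 \<le> Cc * ew G x y * (2 * (f y)\<^sup>2 + 2 * (f x - f y)\<^sup>2)"
        proof (rule mult_mono)
          show "(f x)\<^sup>2 \<le> 2 * (f y)\<^sup>2 + 2 * (f x - f y)\<^sup>2"
            using zero_le_power2[of "f x - 2 * f y"] by (simp add: power2_eq_square algebra_simps)
        qed (use Cc y e0 yY in auto)
        also have "\<dots> = 2 * Cc * (ew G x y * (f y)\<^sup>2) + 2 * Cc * (ew G x y * (f x - f y)\<^sup>2)"
          by (simp add: algebra_simps)
        also have "\<dots> \<le> 2 * Cc * s1 x + 2 * Cc * s2 x"
          using Cc(1) 1 2 by (intro add_mono mult_left_mono) auto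
        finally show ?thesis using False by simp
      qed
    qed
    have "W (Suc k) \<le> (\<Sum>x\<in>A \<inter> N (Suc k). ?t x)"
      unfolding W_def by (rule sum_mono) (rule pt)
    also have "\<dots> \<le> (\<Sum>x\<in>A. ?t x)"
    proof (rule sum_mono2)
      show "0 \<le> ?t x" if "x \<in> A - A \<inter> N (Suc k)" for x using t0[of x] that A by blast
    qed (use A in auto)
    also have "\<dots> = W k + 2 * Cc * (\<Sum>x\<in>A. s1 x) + 2 * Cc * (\<Sum>x\<in>A. s2 x)"
      using A by (simp add: W_def sum.distrib sum_distrib_left sum.inter_restrict)
    also have "(\<Sum>x\<in>A. s1 x) \<le> W k"
    proof -
      have "(\<Sum>x\<in>A. s1 x) = (\<Sum>y\<in>Y. \<Sum>x\<in>A. if y \<in> N k then ew G x y * (f y)\<^sup>2 else 0)"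
        unfolding s1_def by (rule sum.swap)
      also have "\<dots> \<le> (\<Sum>y\<in>Y. if y \<in> N k then vw G y * (f y)\<^sup>2 else 0)"
      proof (rule sum_mono)
        fix y assume y: "y \<in> Y"
        have "(\<Sum>x\<in>A. ew G x y) = (\<Sum>x\<in>A. ew G y x)"
          using A Y y by (intro sum.cong refl ew_sym) auto
        also have "\<dots> \<le> vw G y" using A Y y by (intro sum_ew_le_vw) auto
        finally show "(\<Sum>x\<in>A. if y \<in> N k then ew G x y * (f y)\<^sup>2 else 0)
            \<le> (if y \<in> N k then vw G y * (f y)\<^sup>2 else 0)"
          by (simp add: sum_distrib_right[symmetric] mult_right_mono)
      qed
      also have "\<dots> = W k"
        unfolding W_def using Y A f by (intro sum.mono_neutral_cong_right) (auto simp: Y_def)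
      finally show ?thesis .
    qed
    also have "(\<Sum>x\<in>A. s2 x) \<le> D"
      unfolding D_def s2_def using Y
      by (intro sum_mono2 sum_nonneg mult_nonneg_nonneg ew_nonneg) (auto simp: Y_def)
    finally show ?thesis using Cc by (simp add: algebra_simps)
  qed
  have pow: "W k + D \<le> (1 + 2 * Cc) ^ k * (W 0 + D)" for k
  proof (induction k)
    case (Suc k)
    have "W (Suc k) + D \<le> (1 + 2 * Cc) * (W k + D)" by (rule step)
    also have "\<dots> \<le> (1 + 2 * Cc) * ((1 + 2 * Cc) ^ k * (W 0 + D))"
      using Suc Cc by (intro mult_left_mono) auto
    finally show ?case by (simp add: mult.assoc)
  qed simp
  have "A \<inter> N (nat \<lfloor>\<delta>\<rfloor>) = A"
  proof -
    have "x \<in> N (nat \<lfloor>\<delta>\<rfloor>)" if x: "x \<in> verts G" for x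
    proof -
      obtain i u where "i \<in> {1..l}" "u \<in> verts (P i)" "real (gdist G x u) \<le> \<delta>"
        using cover[OF x] by blast
      then have "gdist G x u \<le> nat \<lfloor>\<delta>\<rfloor>" "u \<in> pages"
        unfolding pages_def by (auto simp only: le_nat_floor)
      then show ?thesis using x by (auto simp: N_def)
    qed
    then show ?thesis using A by auto
  qed
  then have "(\<Sum>x\<in>A. vw G x * (f x)\<^sup>2) = W (nat \<lfloor>\<delta>\<rfloor>)" by (simp add: W_def)
  also have "\<dots> \<le> (1 + 2 * Cc) ^ nat \<lfloor>\<delta>\<rfloor> * (W 0 + D)" using pow[of "nat \<lfloor>\<delta>\<rfloor>"] D0 by simp
  also have "W 0 = (\<Sum>x\<in>A \<inter> pages. vw G x * (f x)\<^sup>2)"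
  proof -
    have "x \<in> pages" if "x \<in> verts G" "u \<in> pages" "gdist G x u \<le> 0" for x u
      using gdist_eq_0[of x u] that pv by auto
    moreover have "gdist G x x \<le> 0" for x by simp
    ultimately have "N 0 = pages" unfolding N_def using pv by blast
    then show ?thesis by (simp add: W_def)
  qed
  finally show ?thesis using Y by (auto simp: D_def)
qed

end

context book
begin

section \<open>Volume comparison and the global Nash inequality\<close>

text \<open>Chosen so that r + U (d + \<delta>) \<le> r Kv exp (d / r) for r \<ge> 1.\<close>

definition Kv :: real where "Kv = 1 + U * (1 + \<delta>)"

lemma Kv: "1 \<le> Kv"
  using U delta by (simp add: Kv_def)

text \<open>One nearby vertex per page is reference enough: \<open>vol_compare\<close> carries the
  bound to every other vertex of that page.\<close>

definition near_vol :: "'a \<Rightarrow> real \<Rightarrow> real \<Rightarrow> bool" where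
  "near_vol v r F \<longleftrightarrow> 0 < F \<and>
     (\<forall>i\<in>{1..l}. \<exists>u\<in>verts (P i). real (gdist G v u) \<le> \<delta> \<and> F \<le> vol (P i) u r)"

text \<open>The ball about u lies in a ball about y whose radius grows by the page distance, at most
  U (d(v, y) + \<delta>) by uniformity. Doubling brings the radius down to s at a cost polynomial in
  d(v, y) / r, and exchanging the polynomial for an exponential produces a weight with bounded
  logarithmic slope, as Davies' method requires.\<close>

lemma vol_compare:
  assumes i: "i \<in> {1..l}" and v: "v \<in> verts G" and u: "u \<in> verts (P i)" and y: "y \<in> verts (P i)"
    and vu: "real (gdist G v u) \<le> \<delta>" and r: "1 \<le> r" and s: "0 < s" "s \<le> r"
  shows "vol (P i) u r \<le> (2 * Kv * (r / s)) ^ (2 * q) * exp (2 * q * gdist G v y / r) * vol (P i) y s"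
proof -
  interpret p: wgr "P i" by (rule page_wgr[OF i])
  define d where "d = real (gdist G v y)"
  have uv: "u \<in> verts G" "y \<in> verts G" using i u y page_vertsD by auto
  have "real (gdist G u y) \<le> d + \<delta>"
    using gdist_triangle[OF uv(1) v uv(2)] gdist_sym[OF uv(1) v] vu by (simp add: d_def)
  then have "real (gdist (P i) u y) \<le> U * (d + \<delta>)"
    using U(2)[OF i u y] U(1) mult_left_mono[of "real (gdist G u y)" "d + \<delta>" U] by linarith
  then have le: "r + real (gdist (P i) u y) \<le> r + U * (d + \<delta>)" by simp
  define t where "t = r + U * (d + \<delta>)"
  have d0: "0 \<le> d" by (simp add: d_def)
  have tr: "r \<le> t" using U delta d0 by (simp add: t_def)
  have texp: "t \<le> r * Kv * exp (d / r)"
  proof -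
    have dr: "r * (1 + U * \<delta> + U * (d / r)) = r + U * \<delta> * r + U * d"
      using r by (simp add: field_simps)
    have "U * \<delta> \<le> U * \<delta> * r" using U delta r by simp
    then have "t \<le> r * (1 + U * \<delta> + U * (d / r))"
      unfolding t_def dr by (simp add: algebra_simps)
    also have "\<dots> \<le> r * (Kv * (1 + d / r))"
    proof (rule mult_left_mono)
      have "0 \<le> U * \<delta> * (d / r) + d / r + U" using U delta d0 r by simp
      then show "1 + U * \<delta> + U * (d / r) \<le> Kv * (1 + d / r)"
        by (simp add: Kv_def algebra_simps)
    qed (use r in simp)
    also have "\<dots> \<le> r * (Kv * exp (d / r))"
      using r Kv exp_ge_add_one_self[of "d / r"] by (intro mult_left_mono) auto
    finally show ?thesis by (simp add: mult.assoc)
  qed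
  have "vol (P i) u r \<le> vol (P i) y (r + gdist (P i) u y)" by (rule p.vol_shift[OF u y])
  also have "\<dots> \<le> vol (P i) y t" unfolding t_def by (rule p.vol_mono[OF y le])
  also have "\<dots> \<le> (2 * t / s) ^ (2 * q) * vol (P i) y s"
    using s tr by (intro p.vol_growth q i y) auto
  also have "\<dots> \<le> ((2 * Kv * (r / s)) * exp (d / r)) ^ (2 * q) * vol (P i) y s"
  proof (intro mult_right_mono power_mono)
    show "2 * t / s \<le> 2 * Kv * (r / s) * exp (d / r)"
      using texp s by (simp add: divide_right_mono mult_ac)
    show "0 \<le> 2 * t / s" using tr r s by simp
    show "0 \<le> vol (P i) y s" using p.vol_pos[OF y] s by (simp add: less_imp_le)
  qed
  also have "\<dots> = (2 * Kv * (r / s)) ^ (2 * q) * exp (2 * q * gdist G v y / r) * vol (P i) y s"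
  proof -
    have "exp (d / r) ^ (2 * q) = exp (2 * q * gdist G v y / r)"
      unfolding exp_of_nat_mult[symmetric] by (simp add: d_def)
    then show ?thesis by (simp only: power_mult_distrib)
  qed
  finally show ?thesis .
qed

text \<open>The factor of \<open>local_nash\<close> on page i.\<close>

definition page_const :: "nat \<Rightarrow> real" where
  "page_const i = 2 * 4 ^ q * (4 * \<kappa> i) ^ (2 * q)"

definition nash_C :: real where
  "nash_C = (1 + 2 * Cc) ^ nat \<lfloor>\<delta>\<rfloor> * (2 + 2 * K\<^sup>2 * (\<Sum>i\<in>{1..l}. page_const i * Cp i))"

definition nash_G0 :: real where
  "nash_G0 = (1 + 2 * Cc) ^ nat \<lfloor>\<delta>\<rfloor> * (K ^ 3 * ((2 * Kv) ^ (2 * q) * exp (2 * q)) * (\<Sum>i\<in>{1..l}. page_const i))"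

definition crude_G :: real where
  "crude_G = (4 * Kv) ^ (2 * q) * exp (2 * q * \<delta>) * (K * Cc ^ nat \<lfloor>\<delta>\<rfloor>)"

lemma page_const_pos: "i \<in> {1..l} \<Longrightarrow> 0 < page_const i"
  using kap[of i] by (simp add: page_const_def)

text \<open>The weight is built from the ambient distance to v, so one and the same \<tau> serves
  all pages, and the weighted L^1 norm over \<open>V\<close> dominates those over the pages.\<close>

lemma book_nash:
  assumes V: "finite V" "V \<subseteq> verts G" and v: "v \<in> verts G" and r: "1 \<le> r" and F: "near_vol v r F"
    and f: "\<And>x. 0 \<le> f x" "\<And>x. x \<notin> V \<Longrightarrow> f x = 0" and S: "1 \<le> S" "S \<le> r\<^sup>2"
  shows "(\<Sum>x\<in>V. vw G x * (f x)\<^sup>2) \<le> nash_C * S * subkernel.en V (vw G) a f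
    + nash_G0 / F * (r\<^sup>2 / S) ^ q * (\<Sum>x\<in>V. vw G x * f x * exp (2 * q * gdist G v x / r))\<^sup>2"
proof -
  interpret sk: subkernel V "vw G" a Ce by (rule subkernel[OF V])
  define \<tau> where "\<tau> x = exp (2 * q * gdist G v x / r)" for x
  define N where "N = (\<Sum>x\<in>V. vw G x * f x * \<tau> x)"
  define s where "s = sqrt S"
  have s: "1 \<le> s" "s \<le> r" "s\<^sup>2 = S" using S r by (auto simp: s_def real_le_lsqrt)
  have F0: "0 < F" using F by (simp add: near_vol_def)
  \<comment> \<open>The reciprocal volume bound of \<open>vol_compare\<close>. There the weight sits
    at the centre x of a ball; the extra exp (2 q) moves it to y, at distance at most s \<le>
    r.\<close>
  define lam where "lam = (2 * Kv * (r / s)) ^ (2 * q) * exp (2 * q) / F"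
  have Lam: "0 \<le> lam" using F0 by (simp add: lam_def)
  have fw: "0 \<le> vw G x * f x * \<tau> x" if "x \<in> V" for x
    using that V f by (intro mult_nonneg_nonneg less_imp_le[OF weighted_graphD(8)]) (auto simp: \<tau>_def)
  have page: "(\<Sum>x\<in>V \<inter> verts (P i). vw G x * (f x)\<^sup>2)
      \<le> 2 * K\<^sup>2 * (page_const i * Cp i) * (S * sk.en f) + K ^ 3 * page_const i * (lam * N\<^sup>2)"
    if i: "i \<in> {1..l}" for i
  proof -
    interpret p: wgr "P i" by (rule page_wgr[OF i])
    define A where "A = V \<inter> verts (P i)"
    define g where "g x = (if x \<in> A then f x else 0)" for x
    have A: "finite A" "A \<subseteq> verts (P i)" "A \<subseteq> V" using V by (auto simp: A_def)
    obtain u where u: "u \<in> verts (P i)" "real (gdist G v u) \<le> \<delta>" "F \<le> vol (P i) u r"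
      using F i unfolding near_vol_def by blast
    have tau: "1 \<le> lam * \<tau> y * vol (P i) x s"
      if x: "x \<in> verts (P i)" and y: "y \<in> A" and xy: "real (gdist (P i) x y) \<le> s" for x y
    proof -
      have yP: "y \<in> verts (P i)" using y A by auto
      have xv: "x \<in> verts G" "y \<in> verts G" using page_vertsD[OF i] x yP by auto
      have "gdist G v x \<le> gdist G v y + gdist G y x" by (rule gdist_triangle[OF v xv(2,1)])
      moreover have "gdist G y x \<le> gdist (P i) x y" using gdist_page[OF i x yP] gdist_sym[OF xv] by simp
      ultimately have "real (gdist G v x) \<le> gdist G v y + r" using xy s by linarith
      then have "2 * q * real (gdist G v x) / r \<le> 2 * q * (real (gdist G v y) + r) / r"
        using r by (intro divide_right_mono mult_left_mono) auto
      also have "\<dots> = 2 * q * real (gdist G v y) / r + 2 * q" using r by (simp add: field_simps)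
      finally have e: "exp (2 * q * real (gdist G v x) / r) \<le> \<tau> y * exp (2 * q)"
        by (simp add: \<tau>_def exp_add[symmetric])
      have "F \<le> (2 * Kv * (r / s)) ^ (2 * q) * exp (2 * q * gdist G v x / r) * vol (P i) x s"
        using vol_compare[OF i v u(1) x u(2) r, of s] s u(3) by linarith
      also have "\<dots> \<le> (2 * Kv * (r / s)) ^ (2 * q) * (\<tau> y * exp (2 * q)) * vol (P i) x s"
        using e p.vol_pos[OF x, of s] s by (intro mult_right_mono mult_left_mono) auto
      also have "\<dots> = F * (lam * \<tau> y * vol (P i) x s)"
        using F0 by (simp add: lam_def)
      finally show ?thesis using F0 by simp
    qed
    have g0: "0 \<le> g y" "y \<notin> A \<Longrightarrow> g y = 0" for y using f by (auto simp: g_def)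
    have tau1: "1 \<le> \<tau> y" for y using r by (simp add: \<tau>_def)
    have s0: "0 < s" using s by simp
    let ?E = "\<lambda>Y. \<Sum>y\<in>Y. \<Sum>z\<in>Y. ew (P i) y z * (g y - g z)\<^sup>2"
    have "\<exists>Y. finite Y \<and> Y \<subseteq> verts (P i) \<and>
        (\<Sum>y\<in>A. vw (P i) y * (g y)\<^sup>2) \<le> 2 * 4 ^ q * (4 * \<kappa> i) ^ (2 * q) *
        (Cp i * s\<^sup>2 * ?E Y + lam * (\<Sum>y\<in>A. vw (P i) y * g y * \<tau> y)\<^sup>2)"
      by (rule p.local_nash)
        (fact q[OF i] kap[OF i] Cp[OF i] PI[OF i] A(1) A(2) s0 Lam tau1 g0(1)
          | (rule g0(2); assumption) | (rule tau; assumption))+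
    then obtain Y where Y: "finite Y" "Y \<subseteq> verts (P i)"
      and le: "(\<Sum>y\<in>A. vw (P i) y * (g y)\<^sup>2) \<le> 2 * 4 ^ q * (4 * \<kappa> i) ^ (2 * q) *
        (Cp i * s\<^sup>2 * ?E Y + lam * (\<Sum>y\<in>A. vw (P i) y * g y * \<tau> y)\<^sup>2)"
      by blast
    have g: "g y = f y" if "y \<in> verts (P i)" for y using that f(2) by (auto simp: g_def A_def)
    have "?E Y \<le> (\<Sum>y\<in>Y. \<Sum>z\<in>Y. K * (ew G y z * (f y - f z)\<^sup>2))"
    proof (intro sum_mono)
      fix y z assume "y \<in> Y" "z \<in> Y"
      then have yz: "y \<in> verts (P i)" "z \<in> verts (P i)" using Y by auto
      have "ew (P i) y z * (f y - f z)\<^sup>2 \<le> K * ew G y z * (f y - f z)\<^sup>2"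
        by (intro mult_right_mono ew_page[OF i yz]) auto
      then show "ew (P i) y z * (g y - g z)\<^sup>2 \<le> K * (ew G y z * (f y - f z)\<^sup>2)"
        using g yz by (simp add: mult.assoc)
    qed
    also have "\<dots> = K * (\<Sum>y\<in>Y. \<Sum>z\<in>Y. ew G y z * (f y - f z)\<^sup>2)" by (simp add: sum_distrib_left)
    also have "\<dots> \<le> K * (2 * sk.en f)"
      using K Y page_verts[OF i] by (intro mult_left_mono energy_le_en V f) auto
    finally have en: "?E Y \<le> K * (2 * sk.en f)" .
    have nn: "0 \<le> vw (P i) y * g y * \<tau> y" if "y \<in> A" for y
      using that A by (intro mult_nonneg_nonneg less_imp_le[OF p.weighted_graphD(8)] g0(1)) (auto simp: \<tau>_def)
    have "(\<Sum>y\<in>A. vw (P i) y * g y * \<tau> y) \<le> (\<Sum>y\<in>A. K * (vw G y * f y * \<tau> y))"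
    proof (rule sum_mono)
      fix y assume y: "y \<in> A"
      then have yP: "y \<in> verts (P i)" using A by auto
      have "vw (P i) y * (f y * \<tau> y) \<le> (K * vw G y) * (f y * \<tau> y)"
        using f by (intro mult_right_mono vw_page(1)[OF i yP]) (auto simp: \<tau>_def)
      then show "vw (P i) y * g y * \<tau> y \<le> K * (vw G y * f y * \<tau> y)"
        using g[OF yP] by (simp add: mult.assoc)
    qed
    also have "\<dots> = K * (\<Sum>y\<in>A. vw G y * f y * \<tau> y)" by (simp add: sum_distrib_left)
    also have "\<dots> \<le> K * N"
      unfolding N_def using K A V fw by (intro mult_left_mono sum_mono2) auto
    finally have "(\<Sum>y\<in>A. vw (P i) y * g y * \<tau> y)\<^sup>2 \<le> (K * N)\<^sup>2"
      by (intro power_mono sum_nonneg nn)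
    then have "page_const i * (Cp i * S * ?E Y
          + lam * (\<Sum>y\<in>A. vw (P i) y * g y * \<tau> y)\<^sup>2)
        \<le> page_const i * (Cp i * S * (K * (2 * sk.en f)) + lam * (K * N)\<^sup>2)"
      using Lam Cp[OF i] S page_const_pos[OF i] by (intro mult_left_mono add_mono en) auto
    then have "(\<Sum>y\<in>A. vw (P i) y * (g y)\<^sup>2) \<le> page_const i * (Cp i * S * (K * (2 * sk.en f)) + lam * (K * N)\<^sup>2)"
      using le unfolding s(3) page_const_def[symmetric] by linarith
    then have "K * (\<Sum>y\<in>A. vw (P i) y * (g y)\<^sup>2)
        \<le> K * (page_const i * (Cp i * S * (K * (2 * sk.en f)) + lam * (K * N)\<^sup>2))"
      using K by (intro mult_left_mono) auto
    moreover have "(\<Sum>y\<in>A. vw G y * (f y)\<^sup>2) \<le> (\<Sum>y\<in>A. K * (vw (P i) y * (g y)\<^sup>2))"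
    proof (rule sum_mono)
      fix y assume "y \<in> A"
      then have yP: "y \<in> verts (P i)" using A by auto
      have "vw G y * (f y)\<^sup>2 \<le> (K * vw (P i) y) * (f y)\<^sup>2"
        by (intro mult_right_mono vw_page(2)[OF i yP]) auto
      then show "vw G y * (f y)\<^sup>2 \<le> K * (vw (P i) y * (g y)\<^sup>2)" using g[OF yP] by simp
    qed
    ultimately have "(\<Sum>y\<in>A. vw G y * (f y)\<^sup>2)
        \<le> K * (page_const i * (Cp i * S * (K * (2 * sk.en f)) + lam * (K * N)\<^sup>2))"
      by (simp add: sum_distrib_left)
    \<comment> \<open>The powers of \<open>K\<close>: one for the vertex weights on the left, then
      one more for the edge weights in the energy, or two more for the square of the L^1
      norm.\<close>
    moreover have "K * (page_const i * (Cp i * S * (K * (2 * sk.en f)) + lam * (K * N)\<^sup>2))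
        = 2 * K\<^sup>2 * (page_const i * Cp i) * (S * sk.en f) + K ^ 3 * page_const i * (lam * N\<^sup>2)"
      by algebra
    ultimately show ?thesis by (simp only: A_def)
  qed
  obtain Y where Y: "finite Y" "Y \<subseteq> verts G"
    and sp: "(\<Sum>x\<in>V. vw G x * (f x)\<^sup>2)
    \<le> (1 + 2 * Cc) ^ nat \<lfloor>\<delta>\<rfloor> * ((\<Sum>x\<in>V \<inter> pages. vw G x * (f x)\<^sup>2)
       + (\<Sum>x\<in>Y. \<Sum>y\<in>Y. ew G x y * (f x - f y)\<^sup>2))"
    using spread_from_pages[OF V, of f] f(2) by blast
  have f0: "0 \<le> vw G x * (f x)\<^sup>2" if "x \<in> V" for x using weighted_graphD(8)[of x] that V by auto
  \<comment> \<open>A vertex may lie on several pages; the right side counts it with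
    multiplicity.\<close>
  have "(\<Sum>x\<in>V \<inter> pages. vw G x * (f x)\<^sup>2) \<le> (\<Sum>i\<in>{1..l}. \<Sum>x\<in>V \<inter> verts (P i). vw G x * (f x)\<^sup>2)"
  proof -
    have "(\<Sum>x\<in>V \<inter> pages. vw G x * (f x)\<^sup>2)
        \<le> (\<Sum>x\<in>V \<inter> pages. \<Sum>i\<in>{1..l}. if x \<in> verts (P i) then vw G x * (f x)\<^sup>2 else 0)"
    proof (rule sum_mono)
      fix x assume x: "x \<in> V \<inter> pages"
      then obtain i where i: "i \<in> {1..l}" "x \<in> verts (P i)" by (auto simp: pages_def)
      have "(if x \<in> verts (P i) then vw G x * (f x)\<^sup>2 else 0)
          \<le> (\<Sum>i\<in>{1..l}. if x \<in> verts (P i) then vw G x * (f x)\<^sup>2 else 0)"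
        using f0 x by (intro member_le_sum[OF i(1)]) auto
      then show "vw G x * (f x)\<^sup>2 \<le> (\<Sum>i\<in>{1..l}. if x \<in> verts (P i) then vw G x * (f x)\<^sup>2 else 0)"
        using i by simp
    qed
    also have "\<dots> \<le> (\<Sum>x\<in>V. \<Sum>i\<in>{1..l}. if x \<in> verts (P i) then vw G x * (f x)\<^sup>2 else 0)"
      using V f0 by (intro sum_mono2 sum_nonneg) auto
    also have "\<dots> = (\<Sum>i\<in>{1..l}. \<Sum>x\<in>V. if x \<in> verts (P i) then vw G x * (f x)\<^sup>2 else 0)"
      by (rule sum.swap)
    also have "\<dots> = (\<Sum>i\<in>{1..l}. \<Sum>x\<in>V \<inter> verts (P i). vw G x * (f x)\<^sup>2)"
      using V by (simp add: sum.inter_restrict)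
    finally show ?thesis .
  qed
  also have "\<dots> \<le> (\<Sum>i\<in>{1..l}. 2 * K\<^sup>2 * (page_const i * Cp i) * (S * sk.en f) + K ^ 3 * page_const i * (lam * N\<^sup>2))"
    by (rule sum_mono) (rule page)
  also have "\<dots> = 2 * K\<^sup>2 * (\<Sum>i\<in>{1..l}. page_const i * Cp i) * (S * sk.en f)
      + K ^ 3 * (\<Sum>i\<in>{1..l}. page_const i) * (lam * N\<^sup>2)"
    by (simp add: sum.distrib sum_distrib_left sum_distrib_right mult_ac)
  finally have pg: "(\<Sum>x\<in>V \<inter> pages. vw G x * (f x)\<^sup>2) \<le> \<dots>" .
  have "(\<Sum>x\<in>Y. \<Sum>y\<in>Y. ew G x y * (f x - f y)\<^sup>2) \<le> 2 * sk.en f"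
    by (rule energy_le_en[OF V Y f(2)])
  also have "\<dots> \<le> 2 * (S * sk.en f)" using S sk.en_nonneg[of f] by (simp add: mult_le_cancel_right1)
  finally have dg: "(\<Sum>x\<in>Y. \<Sum>y\<in>Y. ew G x y * (f x - f y)\<^sup>2) \<le> 2 * (S * sk.en f)" .
  have "(\<Sum>x\<in>V. vw G x * (f x)\<^sup>2) \<le> (1 + 2 * Cc) ^ nat \<lfloor>\<delta>\<rfloor> *
     ((2 * K\<^sup>2 * (\<Sum>i\<in>{1..l}. page_const i * Cp i) * (S * sk.en f)
      + K ^ 3 * (\<Sum>i\<in>{1..l}. page_const i) * (lam * N\<^sup>2)) + 2 * (S * sk.en f))"
    using Cc(1) by (intro order_trans[OF sp] mult_left_mono add_mono pg dg) auto
  also have "\<dots> = nash_C * S * sk.en f + nash_G0 / F * (r\<^sup>2 / S) ^ q * N\<^sup>2"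
  proof -
    have "(2 * Kv * (r / s)) ^ (2 * q) = (2 * Kv) ^ (2 * q) * (r\<^sup>2 / S) ^ q"
      unfolding power_mult_distrib power_mult using s by (simp add: power_divide power_mult_distrib)
    then have "lam = ((2 * Kv) ^ (2 * q) * exp (2 * q)) * (r\<^sup>2 / S) ^ q / F" by (simp add: lam_def)
    moreover have "X * ((2 * k2 * A1 * (S * e) + k3 * A2 * (M1 * R1 / F * n)) + 2 * (S * e))
        = X * (2 + 2 * k2 * A1) * S * e + X * (k3 * M1 * A2) / F * R1 * n" for X k2 A1 e k3 A2 M1 R1 n :: real
      by (simp add: algebra_simps)
    ultimately show ?thesis unfolding nash_C_def nash_G0_def by simp
  qed
  finally show ?thesis by (simp add: N_def \<tau>_def)
qed

lemma nash_consts: "1 \<le> nash_C" "0 < nash_G0" "0 < crude_G"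
proof -
  have ne: "{1..l} \<noteq> {}" using l by auto
  have "0 \<le> (\<Sum>i\<in>{1..l}. page_const i * Cp i)"
    by (intro sum_nonneg mult_nonneg_nonneg less_imp_le[OF page_const_pos] less_imp_le[OF Cp])
  then have "0 \<le> 2 * K\<^sup>2 * (\<Sum>i\<in>{1..l}. page_const i * Cp i)" by simp
  then have "1 * 1 \<le> nash_C" unfolding nash_C_def
    using Cc by (intro mult_mono one_le_power) auto
  then show "1 \<le> nash_C" by simp
  have "0 < (\<Sum>i\<in>{1..l}. page_const i)" using ne page_const_pos by (intro sum_pos) auto
  then show "0 < nash_G0" unfolding nash_G0_def using Cc K Kv by (intro mult_pos_pos) auto
  show "0 < crude_G" unfolding crude_G_def using Cc K Kv by (intro mult_pos_pos) auto
qed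

text \<open>\<open>vol_compare\<close> down to radius 1/2, where a ball is a single vertex. A vertex
  off the pages is first moved by at most \<delta> onto one, at a bounded cost in weight because
  edge weights are controlled.\<close>

lemma crude_bound:
  assumes v: "v \<in> verts G" and r: "1 \<le> r" and F: "near_vol v r F" and x: "x \<in> verts G"
  shows "F \<le> crude_G * (r\<^sup>2) ^ q * (vw G x * exp (2 * q * gdist G v x / r))"
proof -
  obtain i y where i: "i \<in> {1..l}" and y: "y \<in> verts (P i)" "real (gdist G x y) \<le> \<delta>"
    using cover[OF x] by blast
  interpret p: wgr "P i" by (rule page_wgr[OF i])
  have yv: "y \<in> verts G" using page_vertsD[OF i y(1)] .
  obtain u where u: "u \<in> verts (P i)" "real (gdist G v u) \<le> \<delta>" "F \<le> vol (P i) u r"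
    using F i unfolding near_vol_def by blast
  have vy: "vw G y \<le> Cc ^ nat \<lfloor>\<delta>\<rfloor> * vw G x"
  proof -
    have "vw G y \<le> Cc ^ gdist G x y * vw G x" by (rule vw_path[OF gdist_relpow[OF x yv]])
    also have "\<dots> \<le> Cc ^ nat \<lfloor>\<delta>\<rfloor> * vw G x"
      using Cc y(2) weighted_graphD(8)[OF x] by (intro mult_right_mono power_increasing) (auto simp: le_nat_floor)
    finally show ?thesis .
  qed
  have "F \<le> (2 * Kv * (r / (1/2))) ^ (2 * q) * exp (2 * q * gdist G v y / r) * vol (P i) y (1/2)"
    using vol_compare[OF i v u(1) y(1) u(2) r, of "1/2"] u(3) r by linarith
  also have "vol (P i) y (1/2) = vw (P i) y" by (rule p.vol_small[OF y(1)]) auto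
  also have "(2 * Kv * (r / (1/2))) ^ (2 * q) * exp (2 * q * gdist G v y / r) * vw (P i) y
      \<le> (2 * Kv * (r / (1/2))) ^ (2 * q) * (exp (2 * q * \<delta>) * exp (2 * q * gdist G v x / r)) * (K * (Cc ^ nat \<lfloor>\<delta>\<rfloor> * vw G x))"
  proof (intro mult_mono)
    have "real (gdist G v y) \<le> gdist G v x + \<delta>" using gdist_triangle[OF v x yv] y(2) by linarith
    then have "2 * q * real (gdist G v y) / r \<le> 2 * q * (real (gdist G v x) + \<delta>) / r"
      using r by (intro divide_right_mono mult_left_mono) auto
    also have "\<dots> = 2 * q * \<delta> / r + 2 * q * real (gdist G v x) / r"
      by (simp add: distrib_left add_divide_distrib)
    also have "2 * q * \<delta> / r \<le> 2 * q * \<delta> / 1" using r delta by (intro divide_left_mono) auto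
    finally show "exp (2 * q * gdist G v y / r) \<le> exp (2 * q * \<delta>) * exp (2 * q * gdist G v x / r)"
      by (simp add: exp_add[symmetric])
    have "vw (P i) y \<le> K * vw G y" by (rule vw_page(1)[OF i y(1)])
    also have "\<dots> \<le> K * (Cc ^ nat \<lfloor>\<delta>\<rfloor> * vw G x)" using vy K by (intro mult_left_mono) auto
    finally show "vw (P i) y \<le> K * (Cc ^ nat \<lfloor>\<delta>\<rfloor> * vw G x)" .
    show "0 \<le> vw (P i) y" using p.weighted_graphD(8)[OF y(1)] by simp
  qed (use Kv r in auto)
  also have "(2 * Kv * (r / (1/2))) ^ (2 * q) = (4 * Kv) ^ (2 * q) * (r\<^sup>2) ^ q"
    by (simp add: power_mult power_mult_distrib)
  finally show ?thesis by (simp add: crude_G_def mult_ac)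
qed

definition nash_G :: real where "nash_G = nash_G0 + crude_G"

lemma nash_kernel:
  assumes V: "finite V" "V \<subseteq> verts G" and v: "v \<in> V" and r: "1 \<le> r" and F: "near_vol v r F"
  shows "nash_kernel V (vw G) a Ce v (\<lambda>x. gdist G v x) r F nash_C nash_G q"
proof -
  interpret sk: subkernel V "vw G" a Ce by (rule subkernel[OF V])
  have vv: "v \<in> verts G" using v V by auto
  have F0: "0 < F" using F by (simp add: near_vol_def)
  show ?thesis
  proof
    fix x y assume xy: "x \<in> V" "y \<in> V" "a x y \<noteq> 0"
    then have xv: "x \<in> verts G" "y \<in> verts G" using V by auto
    have "gdist G x y \<le> 1"
      using xy(3) ew_eq_0[OF xv] gdist_edge[of x y] by (cases "x = y") (auto simp: a_def)
    then show "\<bar>real (gdist G v y) - real (gdist G v x)\<bar> \<le> 1"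
      using gdist_triangle[OF vv xv] gdist_triangle[OF vv xv(2,1)] gdist_sym[OF xv] by linarith
  next
    fix f :: "'a \<Rightarrow> real" and S :: real
    assume f: "\<And>x. x \<in> V \<Longrightarrow> 0 \<le> f x" and S: "1 \<le> S" "S \<le> r\<^sup>2"
    \<comment> \<open>Nonnegativity of f is known on \<open>V\<close> only; the extension by zero
      leaves all terms unchanged, as every sum runs over \<open>V\<close>.\<close>
    define g where "g x = (if x \<in> V then f x else 0)" for x
    let ?N = "\<Sum>x\<in>V. vw G x * g x * exp (2 * q * gdist G v x / r)"
    have "(\<Sum>x\<in>V. vw G x * (g x)\<^sup>2) \<le> nash_C * S * sk.en g + nash_G0 / F * (r\<^sup>2 / S) ^ q * ?N\<^sup>2"
      by (rule book_nash[OF V vv r F _ _ S]) (use f in \<open>auto simp: g_def\<close>)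
    also have "\<dots> \<le> nash_C * S * sk.en g + nash_G / F * (r\<^sup>2 / S) ^ q * ?N\<^sup>2"
      using nash_consts F0 S by (intro add_left_mono mult_right_mono divide_right_mono) (auto simp: nash_G_def)
    also have "sk.en g = sk.en f" unfolding sk.en_def sk.ip_op by (simp add: sk.ip_def g_def)
    also have "(\<Sum>x\<in>V. vw G x * (g x)\<^sup>2) = sk.ip f f"
      by (simp add: sk.ip_def g_def power2_eq_square mult.assoc)
    finally show "sk.ip f f \<le> nash_C * S * sk.en f
        + nash_G / F * (r\<^sup>2 / S) ^ q * (\<Sum>x\<in>V. vw G x * f x * exp (real (2 * q) * gdist G v x / r))\<^sup>2"
      by (simp add: g_def)
  next
    fix x assume "x \<in> V"
    then have xv: "x \<in> verts G" using V by auto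
    have "F \<le> crude_G * (r\<^sup>2) ^ q * (vw G x * exp (2 * q * gdist G v x / r))"
      by (rule crude_bound[OF vv r F xv])
    also have "\<dots> \<le> nash_G * (r\<^sup>2) ^ q * (vw G x * exp (2 * q * gdist G v x / r))"
      using nash_consts weighted_graphD(8)[OF xv] by (intro mult_right_mono) (auto simp: nash_G_def)
    finally show "F \<le> nash_G * (r\<^sup>2) ^ q * (vw G x * exp (real (2 * q) * gdist G v x / r))"
      by simp
  qed (use v r F0 nash_consts in \<open>auto simp: nash_G_def\<close>)
qed

end

section \<open>Heat kernel estimates on books\<close>

context book
begin

abbreviation delta_fun :: "'a \<Rightarrow> 'a \<Rightarrow> real" where
  "delta_fun v \<equiv> (\<lambda>x. if x = v then 1 else 0)"

text \<open>Each step moves by at most 1, so a walk of n steps from x stays within distance R of v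
  and never meets the killing. This reduces the infinite sums of \<open>markov_pow\<close> to finite
  ones.\<close>

lemma markov_pow_killed:
  assumes v: "v \<in> verts G" and x: "x \<in> verts G" "real (gdist G v x) + n \<le> R"
  shows "markov_pow G n x w = (subkernel.op (gball G v R) (vw G) a ^^ n) (delta_fun w) x"
  using x
proof (induction n arbitrary: x)
  case 0
  then show ?case by simp
next
  case (Suc n)
  have V: "finite (gball G v R)" "gball G v R \<subseteq> verts G" using v gball_subset by auto
  interpret sk: subkernel "gball G v R" "vw G" a Ce by (rule subkernel[OF V])
  have near: "real (gdist G v z) + n \<le> R" if "z \<in> verts G" "a x z \<noteq> 0" for z
  proof -
    have "gdist G x z \<le> 1"
      using that ew_eq_0[OF Suc.prems(1) that(1)] gdist_edge[of x z] by (cases "x = z") (auto simp: a_def)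
    then show ?thesis using gdist_triangle[OF v Suc.prems(1) that(1)] Suc.prems(2) by linarith
  qed
  have "markov_pow G (Suc n) x w = (\<Sum>\<^sub>\<infinity>z\<in>verts G. markov G x z * markov_pow G n z w)" by simp
  also have "\<dots> = (\<Sum>\<^sub>\<infinity>z\<in>gball G v R. a x z * (sk.op ^^ n) (delta_fun w) z / vw G x)"
  proof (rule infsum_cong_neutral)
    fix z assume z: "z \<in> verts G - gball G v R"
    have "a x z = 0" using near[of z] z by (fastforce simp: gball_def)
    then show "markov G x z * markov_pow G n z w = 0" by (simp add: a_markov Suc.prems)
  next
    fix z assume "z \<in> gball G v R - verts G"
    then show "a x z * (sk.op ^^ n) (delta_fun w) z / vw G x = 0" using gball_subset by blast
  next
    fix z assume z: "z \<in> verts G \<inter> gball G v R"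
    show "markov G x z * markov_pow G n z w = a x z * (sk.op ^^ n) (delta_fun w) z / vw G x"
    proof (cases "a x z = 0")
      case False
      then show ?thesis using Suc.IH[of z] near[of z] z by (simp add: a_markov Suc.prems)
    qed (simp add: a_markov Suc.prems)
  qed
  also have "\<dots> = (\<Sum>z\<in>gball G v R. a x z * (sk.op ^^ n) (delta_fun w) z / vw G x)"
    using V by simp
  also have "\<dots> = (sk.op ^^ Suc n) (delta_fun w) x"
    by (simp add: sk.op_def[of "(sk.op ^^ n) (delta_fun w)"] sum_divide_distrib)
  finally show ?case .
qed

section \<open>Off-diagonal bounds\<close>

definition twist :: real where "twist = 6 + 8 / Ce"

definition ultra :: real where "ultra = ultra_const Ce q nash_C nash_G"

text \<open>At half time the kernel is the product \<open>ip g1 g2\<close>. By the triangle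
  inequality the two weights, centred at v and at w, together supply exp (d(v, w) / r) at every
  intermediate vertex, and Cauchy-Schwarz separates the two weighted L^2 norms.\<close>

lemma heat_kernel_scale:
  assumes v: "v \<in> verts G" and w: "w \<in> verts G" and r: "1 \<le> r" "r\<^sup>2 \<le> real (m div 2)"
    and Fv: "near_vol v r Fv" and Fw: "near_vol w r Fw"
  shows "heat_kernel G m v w \<le> ultra / sqrt (Fv * Fw) * exp (twist * m / (2 * r\<^sup>2) - gdist G v w / r)"
proof -
  \<comment> \<open>Large enough for the ball about v to contain w and all walks of m steps from
    v.\<close>
  define R where "R = real m + gdist G v w"
  define V where "V = gball G v R"
  have V: "finite V" "V \<subseteq> verts G" using v gball_subset by (auto simp: V_def)
  have vwin: "v \<in> V" "w \<in> V" using v w by (auto simp: V_def gball_def R_def)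
  interpret sk: subkernel V "vw G" a Ce by (rule subkernel[OF V])
  interpret nv: nash_kernel V "vw G" a Ce v "\<lambda>x. gdist G v x" r Fv nash_C nash_G q
    by (rule nash_kernel[OF V vwin(1) r(1) Fv])
  interpret nw: nash_kernel V "vw G" a Ce w "\<lambda>x. gdist G w x" r Fw nash_C nash_G q
    by (rule nash_kernel[OF V vwin(2) r(1) Fw])
  \<comment> \<open>The halves may differ by one, but both are at least r^2, and their exponents add
    up to that of m exactly.\<close>
  define n1 n2 where "n1 = m div 2" and "n2 = m - m div 2"
  have n: "n1 + n2 = m" "r\<^sup>2 \<le> real n1" "r\<^sup>2 \<le> real n2" using r by (auto simp: n1_def n2_def)
  define g1 g2 where "g1 = (sk.op ^^ n1) (delta_fun v)" and "g2 = (sk.op ^^ n2) (delta_fun w)"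
  define d where "d = real (gdist G v w)"
  have g0: "0 \<le> g1 x" "0 \<le> g2 x" if "x \<in> V" for x
    unfolding g1_def g2_def by (rule sk.op_pow_nonneg[OF _ that]; simp)+
  have wv: "0 < vw G v" "0 < vw G w" using v w weighted_graphD(8) by auto
  have Fpos: "0 < Fv" "0 < Fw" using Fv Fw by (auto simp: near_vol_def)
  have al: "sk.\<alpha> = twist" by (simp add: sk.\<alpha>_def twist_def)
  have kernel: "vw G v * markov_pow G m v w = sk.ip g1 g2"
  proof -
    have "markov_pow G m v w = (sk.op ^^ m) (delta_fun w) v"
      unfolding V_def by (rule markov_pow_killed[OF v v]) (simp add: R_def)
    moreover have "vw G v * (sk.op ^^ m) (delta_fun w) v = sk.ip (delta_fun v) ((sk.op ^^ m) (delta_fun w))"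
    proof -
      have "sk.ip (delta_fun v) ((sk.op ^^ m) (delta_fun w))
          = (\<Sum>x\<in>V. if x = v then vw G x * (sk.op ^^ m) (delta_fun w) x else 0)"
        unfolding sk.ip_def by (rule sum.cong) auto
      then show ?thesis using vwin V by simp
    qed
    moreover have "(sk.op ^^ m) (delta_fun w) = (sk.op ^^ n1) g2"
      unfolding n(1)[symmetric] funpow_add g2_def by simp
    ultimately show ?thesis by (simp add: sk.op_pow_sym g1_def)
  qed
  define h1 h2 where "h1 x = g1 x * exp (gdist G v x / r)" and "h2 x = g2 x * exp (gdist G w x / r)" for x
  have Z1: "sk.ip h1 h1 \<le> ultra / Fv * exp (twist * n1 / r\<^sup>2) * (vw G v)\<^sup>2"
    using nv.weighted_L2_bound[OF n(2)]
    by (simp add: sk.ip_def h1_def g1_def ultra_def al power2_eq_square mult.assoc)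
  have Z2: "sk.ip h2 h2 \<le> ultra / Fw * exp (twist * n2 / r\<^sup>2) * (vw G w)\<^sup>2"
    using nw.weighted_L2_bound[OF n(3)]
    by (simp add: sk.ip_def h2_def g2_def ultra_def al power2_eq_square mult.assoc)
  have dist: "exp (d / r) * sk.ip g1 g2 \<le> sk.ip h1 h2"
    unfolding sk.ip_def sum_distrib_left
  proof (rule sum_mono)
    fix x assume x: "x \<in> V"
    then have xv: "x \<in> verts G" using V by auto
    have "d \<le> real (gdist G v x) + gdist G w x"
      using gdist_triangle[OF v xv w] gdist_sym[OF w xv] by (simp add: d_def)
    then have "d / r \<le> (real (gdist G v x) + gdist G w x) / r" using r by (intro divide_right_mono) auto
    then have "exp (d / r) \<le> exp (gdist G v x / r) * exp (gdist G w x / r)"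
      by (simp add: exp_add[symmetric] add_divide_distrib)
    then have "exp (d / r) * (vw G x * g1 x * g2 x)
        \<le> (exp (gdist G v x / r) * exp (gdist G w x / r)) * (vw G x * g1 x * g2 x)"
      using g0[OF x] weighted_graphD(8)[OF xv] by (intro mult_right_mono) auto
    then show "exp (d / r) * (vw G x * g1 x * g2 x) \<le> vw G x * h1 x * h2 x"
      by (simp add: h1_def h2_def mult_ac)
  qed
  have ul: "0 \<le> ultra"
    using nv.L(3) nv.A(3) nash_consts unfolding ultra_def ultra_const_def nash_G_def
    by (intro mult_nonneg_nonneg zero_le_power) auto
  define T where "T = ultra / sqrt (Fv * Fw) * exp (twist * m / (2 * r\<^sup>2)) * (vw G v * vw G w)"
  have T0: "0 \<le> T" using ul wv Fpos by (simp add: T_def)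
  have "(sk.ip h1 h2)\<^sup>2 \<le> sk.ip h1 h1 * sk.ip h2 h2" by (rule sk.ip_Cauchy_Schwarz)
  also have "\<dots> \<le> (ultra / Fv * exp (twist * n1 / r\<^sup>2) * (vw G v)\<^sup>2) * (ultra / Fw * exp (twist * n2 / r\<^sup>2) * (vw G w)\<^sup>2)"
    using ul Fpos sk.ip_nonneg by (intro mult_mono Z1 Z2) auto
  also have "\<dots> = T\<^sup>2"
  proof -
    have e: "exp (twist * n1 / r\<^sup>2) * exp (twist * n2 / r\<^sup>2) = (exp (twist * m / (2 * r\<^sup>2)))\<^sup>2"
    proof -
      have "twist * n1 / r\<^sup>2 + twist * n2 / r\<^sup>2 = 2 * (twist * m / (2 * r\<^sup>2))"
        unfolding n(1)[symmetric] by (simp add: add_divide_distrib distrib_left)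
      then show ?thesis by (simp add: exp_add[symmetric] exp_double[symmetric])
    qed
    have s: "(sqrt (Fv * Fw))\<^sup>2 = Fv * Fw" using Fpos by simp
    have "T\<^sup>2 = ultra\<^sup>2 / (Fv * Fw) * (exp (twist * m / (2 * r\<^sup>2)))\<^sup>2 * (vw G v * vw G w)\<^sup>2"
      unfolding T_def power_mult_distrib power_divide s ..
    then show ?thesis unfolding e[symmetric] by (simp add: power2_eq_square mult_ac)
  qed
  finally have "sk.ip h1 h2 \<le> T" using T0 by (rule power2_le_imp_le)
  then have "exp (d / r) * (vw G v * markov_pow G m v w) \<le> T" using dist kernel by simp
  then have "markov_pow G m v w \<le> T / (exp (d / r) * vw G v)"
    using wv by (simp add: pos_le_divide_eq mult_ac)
  then have "heat_kernel G m v w \<le> T / (exp (d / r) * vw G v) / vw G w"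
    unfolding heat_kernel_def using wv by (intro divide_right_mono) auto
  also have "\<dots> = ultra / sqrt (Fv * Fw) * exp (twist * m / (2 * r\<^sup>2) - d / r)"
    using wv by (simp add: T_def exp_diff)
  finally show ?thesis by (simp add: d_def)
qed

lemma ultra_pos: "0 < ultra"
proof -
  have "0 < smooth_rate Ce q nash_C"
  proof -
    have "0 < (6 + 8 / Ce) * (1 + 2 * real q)\<^sup>2" using Ce by (intro mult_pos_pos add_pos_pos) auto
    then have "0 < q + (6 + 8 / Ce) * (1 + 2 * real q)\<^sup>2" by (rule add_nonneg_pos[rotated]) simp
    then show ?thesis unfolding smooth_rate_def using Ce nash_consts by (intro divide_pos_pos mult_pos_pos) auto
  qed
  then have L: "0 < smooth_lag Ce q nash_C" by (simp add: smooth_lag_def add_pos_nonneg)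
  then have "0 < smooth_amp Ce q nash_C" by (simp add: smooth_amp_def less_max_iff_disj)
  then show ?thesis
    unfolding ultra_def ultra_const_def nash_G_def using nash_consts L by (intro mult_pos_pos zero_less_power) auto
qed

lemma near_vol_scale:
  assumes v: "v \<in> verts G" and F: "near_vol v t F" and r: "0 < r" "r \<le> t"
  shows "near_vol v r (F / (2 * t / r) ^ (2 * q))"
  unfolding near_vol_def
proof (intro conjI ballI)
  have pos: "0 < (2 * t / r) ^ (2 * q)" using r by simp
  show "0 < F / (2 * t / r) ^ (2 * q)" using F pos by (simp add: near_vol_def)
  fix i assume i: "i \<in> {1..l}"
  obtain u where u: "u \<in> verts (P i)" "real (gdist G v u) \<le> \<delta>" "F \<le> vol (P i) u t"
    using F i unfolding near_vol_def by blast
  have "vol (P i) u t \<le> (2 * t / r) ^ (2 * q) * vol (P i) u r"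
    by (rule wgr.vol_growth[OF page_wgr[OF i] q[OF i] u(1) r])
  then have "F / (2 * t / r) ^ (2 * q) \<le> vol (P i) u r"
    using u(3) pos by (simp add: divide_le_eq mult.commute)
  then show "\<exists>u\<in>verts (P i). real (gdist G v u) \<le> \<delta> \<and> F / (2 * t / r) ^ (2 * q) \<le> vol (P i) u r"
    using u by blast
qed

text \<open>At r = sqrt m / x the twist costs exp (twist x^2 / 2), and the volume loss (2 x)^(2 q) =
  (4 x^2)^q is at most exp (4 q x^2).\<close>

definition gauss_C :: real where "gauss_C = twist / 2 + 4 * q"

lemma gauss_C: "1 \<le> gauss_C"
  using Ce by (simp add: gauss_C_def twist_def add_increasing2)

text \<open>The radius \<open>r = \<surd>m / x\<close> with \<open>x \<sim> d / \<surd>m\<close> optimizes the exponent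
  \<open>gauss_C * x\<^sup>2 - (d / \<surd>m) * x\<close>; the volume loss \<open>(2 x)\<close> to the power \<open>2 q\<close>
  is absorbed in the first term.\<close>

lemma heat_kernel_gauss:
  assumes v: "v \<in> verts G" and w: "w \<in> verts G" and m: "4 \<le> m" "real (gdist G v w) \<le> m"
    and Fv: "near_vol v (sqrt m) Fv" and Fw: "near_vol w (sqrt m) Fw"
  shows "heat_kernel G m v w \<le> ultra * exp (8 * gauss_C) / sqrt (Fv * Fw)
    * exp (- (real (gdist G v w))\<^sup>2 / (4 * gauss_C * m))"
proof -
  define d t where "d = real (gdist G v w)" and "t = d / sqrt m"
  \<comment> \<open>The minimizer of the exponent is t / (2 gauss_C). The floor 2 keeps r^2 \<le> m
    / 4, so that each half of the time is at least r^2; the hypothesis d \<le> m gives x \<le> sqrt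
    m and hence r \<ge> 1.\<close>
  define x where "x = max 2 (t / (2 * gauss_C))"
  define r where "r = sqrt m / x"
  note C1 = gauss_C
  have sm: "2 \<le> sqrt m" using m by (intro real_le_rsqrt) auto
  have t0: "0 \<le> t" by (simp add: t_def d_def)
  have x2: "2 \<le> x" by (simp add: x_def)
  have tm: "t \<le> sqrt m"
    using m sm by (simp add: t_def d_def divide_le_eq)
  have "t / (2 * gauss_C) \<le> t / 1" using t0 C1 by (intro divide_left_mono) auto
  then have xm: "x \<le> sqrt m" using sm tm by (simp add: x_def)
  have r1: "1 \<le> r" using xm x2 by (simp add: r_def)
  have rx: "sqrt m / r = x" using x2 sm m by (simp add: r_def)
  have r2: "r\<^sup>2 = m / x\<^sup>2" by (simp add: r_def power_divide)
  have "4 \<le> x\<^sup>2" using power_mono[OF x2, of 2] by simp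
  then have "r\<^sup>2 \<le> m / 4" unfolding r2 by (intro divide_left_mono) auto
  also have "\<dots> \<le> real (m div 2)" using m by linarith
  finally have rm: "r\<^sup>2 \<le> real (m div 2)" .
  have "sqrt m / x \<le> sqrt m / 1" using x2 sm by (intro divide_left_mono) auto
  then have rt: "r \<le> sqrt m" by (simp add: r_def)
  have e2: "2 * sqrt m / r = 2 * x" using rx by simp
  define Y where "Y = (2 * x) ^ (2 * q)"
  have Y: "0 < Y" using x2 by (simp add: Y_def)
  have Fpos: "0 < Fv" "0 < Fw" using Fv Fw by (auto simp: near_vol_def)
  have nv: "near_vol v r (Fv / Y)" "near_vol w r (Fw / Y)"
    using near_vol_scale[OF v Fv _ rt] near_vol_scale[OF w Fw _ rt] r1 unfolding e2 Y_def by auto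
  have "heat_kernel G m v w \<le> ultra / sqrt (Fv / Y * (Fw / Y)) * exp (twist * m / (2 * r\<^sup>2) - d / r)"
    unfolding d_def by (rule heat_kernel_scale[OF v w r1 rm nv])
  also have "sqrt (Fv / Y * (Fw / Y)) = sqrt (Fv * Fw) / Y"
    using Y by (simp add: real_sqrt_divide real_sqrt_mult)
  also have "twist * m / (2 * r\<^sup>2) = twist / 2 * x\<^sup>2"
    unfolding r2 using x2 sm m by simp
  also have "d / r = t * x" using sm x2 by (simp add: r_def t_def)
  also have "ultra / (sqrt (Fv * Fw) / Y) * exp (twist / 2 * x\<^sup>2 - t * x)
      = ultra / sqrt (Fv * Fw) * (Y * exp (twist / 2 * x\<^sup>2 - t * x))" by simp
  also have "\<dots> \<le> ultra / sqrt (Fv * Fw) * (exp (8 * gauss_C) * exp (- t\<^sup>2 / (4 * gauss_C)))"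
  proof (rule mult_left_mono)
    have "4 * x\<^sup>2 \<le> exp (4 * x\<^sup>2)" using exp_ge_add_one_self[of "4 * x\<^sup>2"] by linarith
    then have "(4 * x\<^sup>2) ^ q \<le> exp (4 * x\<^sup>2) ^ q" by (intro power_mono) auto
    then have "Y \<le> exp (q * (4 * x\<^sup>2))"
      by (simp add: Y_def power_mult power_mult_distrib exp_of_nat_mult)
    then have "Y * exp (twist / 2 * x\<^sup>2 - t * x) \<le> exp (q * (4 * x\<^sup>2)) * exp (twist / 2 * x\<^sup>2 - t * x)"
      by (intro mult_right_mono) auto
    also have "\<dots> = exp (gauss_C * x\<^sup>2 - t * x)"
      by (simp add: exp_add[symmetric] gauss_C_def algebra_simps)
    also have "\<dots> \<le> exp (8 * gauss_C - t\<^sup>2 / (4 * gauss_C))"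
    proof -
      \<comment> \<open>Off the floor this is the exact minimum. On it x = 2 and t \<le> 4 gauss_C,
        so 4 gauss_C covers the exponent and another 4 gauss_C the Gaussian term; this is the source
        of exp (8 gauss_C).\<close>
      have "gauss_C * x\<^sup>2 - t * x \<le> 8 * gauss_C - t\<^sup>2 / (4 * gauss_C)"
      proof (cases "t / (2 * gauss_C) \<le> 2")
        case True
        then have x: "x = 2" by (simp add: x_def)
        have "t \<le> 4 * gauss_C" using True C1 by (simp add: divide_le_eq)
        then have "t * t \<le> (4 * gauss_C) * (4 * gauss_C)" using t0 C1 by (intro mult_mono) auto
        then have "t\<^sup>2 / (4 * gauss_C) \<le> 4 * gauss_C" using C1 by (simp add: divide_le_eq power2_eq_square)
        then show ?thesis using t0 by (simp add: x)
      next
        case False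
        then have x: "x = t / (2 * gauss_C)" by (simp add: x_def)
        have "gauss_C * x\<^sup>2 - t * x = - t\<^sup>2 / (4 * gauss_C)"
          unfolding x using C1 by (simp add: power2_eq_square field_simps)
        then show ?thesis using C1 by simp
      qed
      then show ?thesis by simp
    qed
    finally show "Y * exp (twist / 2 * x\<^sup>2 - t * x) \<le> exp (8 * gauss_C) * exp (- t\<^sup>2 / (4 * gauss_C))"
      by (simp add: exp_add[symmetric])
    show "0 \<le> ultra / sqrt (Fv * Fw)" using ultra_pos Fpos by simp
  qed
  also have "- t\<^sup>2 / (4 * gauss_C) = - d\<^sup>2 / (4 * gauss_C * m)"
    using m by (simp add: t_def power_divide mult_ac)
  finally show ?thesis by (simp add: d_def mult.assoc)
qed

section \<open>Minimal volumes and volumes at closest points\<close>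

definition Vset :: "'a \<Rightarrow> real \<Rightarrow> nat \<Rightarrow> 'a set" where
  "Vset z r i = nbhd G (gball G z r) \<delta> \<inter> verts (P i) \<inter> nbhd G (verts (P 0)) \<delta>"

lemma VsetD:
  assumes z: "z \<in> verts G" and y: "y \<in> Vset z r i"
  shows "y \<in> verts (P i)" "y \<in> verts G" "real (gdist G z y) \<le> r + \<delta>"
proof -
  obtain x where x: "x \<in> verts G" "real (gdist G z x) \<le> r" "real (gdist G y x) \<le> \<delta>"
    and yv: "y \<in> verts G" "y \<in> verts (P i)"
    using y by (auto simp: Vset_def nbhd_def gball_def)
  show "y \<in> verts (P i)" "y \<in> verts G" using yv by auto
  show "real (gdist G z y) \<le> r + \<delta>"
    using gdist_triangle[OF z x(1) yv(1)] gdist_sym[OF x(1) yv(1)] x by linarith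
qed

lemma finite_Vset:
  assumes "z \<in> verts G"
  shows "finite (Vset z r i)"
proof (rule finite_subset)
  show "Vset z r i \<subseteq> gball G z (r + \<delta>)" using VsetD[OF assms] by (auto simp: gball_def)
qed (use assms in simp)

lemma near_in_Vset:
  assumes z: "z \<in> verts (P 0)" and i: "i \<in> {1..l}" and u: "u \<in> verts (P i)" "real (gdist G z u) \<le> \<delta>"
    and r: "0 \<le> r"
  shows "u \<in> Vset z r i"
proof -
  have zv: "z \<in> verts G" "u \<in> verts G" using z spine page_vertsD[OF i u(1)] by auto
  have "real (gdist G u z) \<le> \<delta>" "z \<in> gball G z r"
    using u(2) gdist_sym[OF zv] r zv by (auto simp: gball_def)
  then show ?thesis using z zv u unfolding Vset_def nbhd_def by blast
qed

text \<open>Book-likeness puts a vertex of every page near z; together with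
  \<open>finite_Vset\<close> this gives the inner \<open>MIN\<close> its meaning.\<close>

lemma Vset_nonempty: "z \<in> verts (P 0) \<Longrightarrow> i \<in> {1..l} \<Longrightarrow> 0 \<le> r \<Longrightarrow> Vset z r i \<noteq> {}"
  using book near_in_Vset by blast

lemma Vmin_Vset: "Vmin G P l \<delta> z r = (MIN i\<in>{1..l}. MIN y\<in>Vset z r i. vol (P i) y r)"
  by (simp add: Vmin_def Vset_def)

lemma Vmin_le:
  assumes z: "z \<in> verts (P 0)" and i: "i \<in> {1..l}" and u: "u \<in> verts (P i)" "real (gdist G z u) \<le> \<delta>"
    and r: "0 \<le> r"
  shows "Vmin G P l \<delta> z r \<le> vol (P i) u r"
proof -
  have zv: "z \<in> verts G" using z spine by auto
  have "Vmin G P l \<delta> z r \<le> (MIN y\<in>Vset z r i. vol (P i) y r)"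
    unfolding Vmin_Vset using i by (intro Min_le) auto
  also have "\<dots> \<le> vol (P i) u r"
    using near_in_Vset[OF z i u r] finite_Vset[OF zv] by (intro Min_le) auto
  finally show ?thesis .
qed

lemma Vmin_attained:
  assumes z: "z \<in> verts (P 0)" and r: "0 \<le> r"
  obtains i y where "i \<in> {1..l}" "y \<in> Vset z r i" "Vmin G P l \<delta> z r = vol (P i) y r"
proof -
  have zv: "z \<in> verts G" using z spine by auto
  have "Vmin G P l \<delta> z r \<in> (\<lambda>i. MIN y\<in>Vset z r i. vol (P i) y r) ` {1..l}"
    unfolding Vmin_Vset using l by (intro Min_in) auto
  then obtain i where i: "i \<in> {1..l}" "Vmin G P l \<delta> z r = (MIN y\<in>Vset z r i. vol (P i) y r)" by auto
  have "(MIN y\<in>Vset z r i. vol (P i) y r) \<in> (\<lambda>y. vol (P i) y r) ` Vset z r i"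
    using finite_Vset[OF zv] Vset_nonempty[OF z i(1) r] by (intro Min_in) auto
  then show ?thesis using that i by auto
qed

text \<open>The nearby vertices that \<open>near_vol\<close> demands are among those over which
  \<open>Vmin\<close> minimizes.\<close>

lemma Vmin_near_vol:
  assumes z: "z \<in> verts (P 0)" and r: "0 \<le> r"
  shows "near_vol z r (Vmin G P l \<delta> z r)"
  unfolding near_vol_def
proof (intro conjI ballI)
  have zv: "z \<in> verts G" using z spine by auto
  obtain i y where iy: "i \<in> {1..l}" "y \<in> Vset z r i" "Vmin G P l \<delta> z r = vol (P i) y r"
    by (rule Vmin_attained[OF z r])
  show "0 < Vmin G P l \<delta> z r"
    unfolding iy(3) by (rule wgr.vol_pos[OF page_wgr[OF iy(1)] VsetD(1)[OF zv iy(2)] r])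
  fix i assume i: "i \<in> {1..l}"
  then obtain u where "u \<in> verts (P i)" "real (gdist G z u) \<le> \<delta>" using book[OF z] by blast
  then show "\<exists>u\<in>verts (P i). real (gdist G z u) \<le> \<delta> \<and> Vmin G P l \<delta> z r \<le> vol (P i) u r"
    using Vmin_le[OF z i _ _ r] by blast
qed

definition cmp_const :: real where
  "cmp_const = (2 * Kv) ^ (2 * q) * exp (2 * q * (1 + \<delta>))"

text \<open>A minimizer for \<open>Vmin\<close> at z lies within d(v, z) + r + \<delta> of v, so
  \<open>vol_compare\<close> with s = r relates it to \<open>u i\<close> on the same page. Measured
  in units of r \<ge> 1, the part r + \<delta> is at most 1 + \<delta>, which gives
  \<open>cmp_const\<close>.\<close>

lemma min_vol_le_Vmin:
  assumes v: "v \<in> verts (P 0)" and z: "z \<in> verts (P 0)" and r: "1 \<le> r"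
    and u: "\<And>i. i \<in> {1..l} \<Longrightarrow> u i \<in> verts (P i) \<and> real (gdist G v (u i)) \<le> \<delta>"
  shows "(MIN i\<in>{1..l}. vol (P i) (u i) r)
    \<le> cmp_const * exp (2 * q * (gdist G v z / r)) * Vmin G P l \<delta> z r"
proof -
  have vv: "v \<in> verts G" "z \<in> verts G" using v z spine by auto
  obtain i y where iy: "i \<in> {1..l}" "y \<in> Vset z r i" "Vmin G P l \<delta> z r = vol (P i) y r"
    using Vmin_attained[OF z, of r] r by (metis order_trans zero_le_one)
  note y = VsetD[OF vv(2) iy(2)]
  have "real (gdist G v y) \<le> gdist G v z + (r + \<delta>)"
    using gdist_triangle[OF vv y(2)] y(3) by linarith
  then have "real (gdist G v y) / r \<le> (gdist G v z + (r + \<delta>)) / r" using r by (intro divide_right_mono) auto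
  also have "\<dots> = gdist G v z / r + (1 + \<delta> / r)" using r by (simp add: add_divide_distrib)
  also have "\<delta> / r \<le> \<delta> / 1" using r delta by (intro divide_left_mono) auto
  finally have "gdist G v y / r \<le> gdist G v z / r + (1 + \<delta>)" by simp
  then have "2 * q * (gdist G v y / r) \<le> 2 * q * (gdist G v z / r + (1 + \<delta>))" by (intro mult_left_mono) auto
  then have e: "exp (2 * q * gdist G v y / r) \<le> exp (2 * q * (1 + \<delta>)) * exp (2 * q * (gdist G v z / r))"
    unfolding exp_add[symmetric] exp_le_cancel_iff by (simp add: distrib_left add.commute)
  have "(MIN i\<in>{1..l}. vol (P i) (u i) r) \<le> vol (P i) (u i) r"
    using iy(1) by (intro Min_le) auto
  also have "\<dots> \<le> (2 * Kv * (r / r)) ^ (2 * q) * exp (2 * q * gdist G v y / r) * vol (P i) y r"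
    using u[OF iy(1)] r by (intro vol_compare[OF iy(1) vv(1) _ y(1)]) auto
  also have "\<dots> \<le> (2 * Kv) ^ (2 * q) * (exp (2 * q * (1 + \<delta>)) * exp (2 * q * (gdist G v z / r))) * vol (P i) y r"
    using e r wgr.vol_pos[OF page_wgr[OF iy(1)] y(1), of r]
    by (intro mult_right_mono mult_mono) (auto intro!: zero_le_power simp: Kv order_trans[OF zero_le_one])
  finally show ?thesis unfolding iy(3) by (simp add: cmp_const_def mult.assoc)
qed

definition bound_c :: real where "bound_c = ultra * exp (8 * gauss_C)"

definition bound_c' :: real where
  "bound_c' = bound_c * cmp_const * exp ((real q)\<^sup>2 * (4 * gauss_C) / 2)"

lemma bound_consts_pos: "0 < bound_c" "0 < bound_c'" "0 < cmp_const"
  using ultra_pos Kv by (simp_all add: bound_c_def bound_c'_def cmp_const_def)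

text \<open>For the second inequality the volumes near w are compared with those near v. This loses
  a factor exponential in d / sqrt m, which half of the Gaussian pays for; hence the doubled
  constant in the last exponent.\<close>

theorem book_heat_kernel:
  assumes v: "v \<in> verts (P 0)" and w: "w \<in> verts (P 0)"
    and m: "real m \<ge> (1 + 4 / \<delta>) * (real (gdist G v w) + \<delta>)"
    and arg: "\<forall>i\<in>{1..l}. is_arg_min (gdist G v) (\<lambda>y. y \<in> verts (P i)) (u i)"
  shows "heat_kernel G m v w
          \<le> bound_c / sqrt (Vmin G P l \<delta> v (sqrt (real m)) * Vmin G P l \<delta> w (sqrt (real m)))
             * exp (- (real (gdist G v w))\<^sup>2 / (4 * gauss_C * real m)) \<and>
        bound_c / sqrt (Vmin G P l \<delta> v (sqrt (real m)) * Vmin G P l \<delta> w (sqrt (real m)))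
             * exp (- (real (gdist G v w))\<^sup>2 / (4 * gauss_C * real m))
          \<le> bound_c' / (MIN i\<in>{1..l}. vol (P i) (u i) (sqrt (real m)))
             * exp (- (real (gdist G v w))\<^sup>2 / (2 * (4 * gauss_C) * real m))"
proof -
  define c2 where "c2 = 4 * gauss_C"
  define C where "C = 1 + 4 / \<delta>"
  have c2: "0 < c2" using gauss_C by (simp add: c2_def)
  note c1 = bound_consts_pos(1) and cc = bound_consts_pos(3) and m = m[folded C_def]
  have vv: "v \<in> verts G" "w \<in> verts G" using v w spine by auto
  define d where "d = real (gdist G v w)"
  have d0: "0 \<le> d" by (simp add: d_def)
  \<comment> \<open>The constant 1 + 4 / \<delta> is chosen to give both m \<ge> d and m \<ge> 4,
    the latter even for v = w.\<close>
  have "C * (d + \<delta>) = d + \<delta> + 4 * d / \<delta> + 4" using delta by (simp add: C_def field_simps)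
  then have "d + 4 \<le> C * (d + \<delta>)" using delta d0 by simp
  then have m4: "4 \<le> m" "d \<le> real m" using m d0 by (auto simp: d_def)
  define r where "r = sqrt m"
  have r: "1 \<le> r" "0 \<le> r" using m4 by (auto simp: r_def)
  define Vv Vw where "Vv = Vmin G P l \<delta> v r" and "Vw = Vmin G P l \<delta> w r"
  have nv: "near_vol v r Vv" "near_vol w r Vw"
    unfolding Vv_def Vw_def using Vmin_near_vol v w r by auto
  have Vpos: "0 < Vv" "0 < Vw" using nv by (auto simp: near_vol_def)
  have up: "heat_kernel G m v w \<le> bound_c / sqrt (Vv * Vw) * exp (- d\<^sup>2 / (c2 * m))"
    unfolding bound_c_def c2_def d_def
    using m4 nv unfolding r_def by (intro heat_kernel_gauss vv) (auto simp: d_def)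
  have u: "u i \<in> verts (P i) \<and> real (gdist G v (u i)) \<le> \<delta>" if i: "i \<in> {1..l}" for i
  proof -
    obtain y where y: "y \<in> verts (P i)" "real (gdist G v y) \<le> \<delta>" using book[OF v i] by blast
    have am: "u i \<in> verts (P i)" "\<not> (\<exists>y. y \<in> verts (P i) \<and> gdist G v y < gdist G v (u i))"
      using arg i unfolding is_arg_min_def by blast+
    then have "gdist G v (u i) \<le> gdist G v y" using y by (meson not_less)
    then show ?thesis using am y by linarith
  qed
  define F where "F = (MIN i\<in>{1..l}. vol (P i) (u i) r)"
  have F0: "0 < F"
  proof -
    have "F \<in> (\<lambda>i. vol (P i) (u i) r) ` {1..l}" unfolding F_def using l by (intro Min_in) auto
    then show ?thesis using u wgr.vol_pos[OF page_wgr] r by auto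
  qed
  define t where "t = d / r"
  have Fv: "F \<le> cmp_const * Vv"
    using min_vol_le_Vmin[OF v v r(1) u] by (simp add: F_def Vv_def)
  have Fw: "F \<le> cmp_const * exp (2 * q * t) * Vw"
    using min_vol_le_Vmin[OF v w r(1) u] by (simp add: F_def Vw_def t_def d_def)
  \<comment> \<open>Only the comparison at w carries the exponential, so the geometric mean of the
    two bounds halves its exponent.\<close>
  have "F * F \<le> (cmp_const * Vv) * (cmp_const * exp (2 * q * t) * Vw)"
    using F0 cc Vpos Fv Fw by (intro mult_mono) auto
  also have "exp (2 * q * t) = (exp (q * t))\<^sup>2" by (simp add: exp_double[symmetric] mult.assoc)
  finally have "F\<^sup>2 \<le> (cmp_const * exp (q * t))\<^sup>2 * (Vv * Vw)"
    by (simp add: power2_eq_square mult_ac)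
  then have "sqrt (F\<^sup>2) \<le> sqrt ((cmp_const * exp (q * t))\<^sup>2 * (Vv * Vw))" by (rule real_sqrt_le_mono)
  then have FV: "F \<le> cmp_const * exp (q * t) * sqrt (Vv * Vw)"
    using F0 cc by (simp add: real_sqrt_mult)
  have sV: "0 < sqrt (Vv * Vw)" using Vpos by simp
  have "bound_c / sqrt (Vv * Vw) \<le> bound_c * cmp_const * exp (q * t) / F"
    using FV F0 sV c1 by (simp add: divide_simps mult_ac)
  then have "bound_c / sqrt (Vv * Vw) * exp (- d\<^sup>2 / (c2 * m))
      \<le> bound_c * cmp_const * exp (q * t) / F * exp (- d\<^sup>2 / (c2 * m))"
    by (intro mult_right_mono) auto
  also have "\<dots> = bound_c * cmp_const / F * exp (q * t - d\<^sup>2 / (c2 * m))"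
    by (simp add: exp_add[symmetric])
  also have "\<dots> \<le> bound_c * cmp_const / F * exp ((real q)\<^sup>2 * c2 / 2 - d\<^sup>2 / (2 * c2 * m))"
  proof (rule mult_left_mono)
    have tm: "d\<^sup>2 / m = t\<^sup>2" by (simp add: t_def r_def power_divide)
    \<comment> \<open>Completing the square: q t \<le> t^2 / (2 c2) + q^2 c2 / 2. The last term is
      the additional exponential in \<open>bound_c'\<close>.\<close>
    have "0 \<le> (t - q * c2)\<^sup>2 / (2 * c2)" using c2 by simp
    also have "\<dots> = t\<^sup>2 / (2 * c2) - q * t + (real q)\<^sup>2 * c2 / 2"
      using c2 by (simp add: field_simps power2_eq_square)
    finally have "q * t \<le> t\<^sup>2 / (2 * c2) + (real q)\<^sup>2 * c2 / 2" by simp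
    moreover have "d\<^sup>2 / (c2 * m) = t\<^sup>2 / c2" "d\<^sup>2 / (2 * c2 * m) = t\<^sup>2 / (2 * c2)"
      unfolding tm[symmetric] by (simp_all add: mult_ac)
    moreover have "t\<^sup>2 / c2 = t\<^sup>2 / (2 * c2) + t\<^sup>2 / (2 * c2)" by simp
    ultimately have "q * t - d\<^sup>2 / (c2 * m) \<le> (real q)\<^sup>2 * c2 / 2 - d\<^sup>2 / (2 * c2 * m)"
      by linarith
    then show "exp (q * t - d\<^sup>2 / (c2 * m)) \<le> exp ((real q)\<^sup>2 * c2 / 2 - d\<^sup>2 / (2 * c2 * m))"
      by (subst exp_le_cancel_iff)
  qed (use c1 cc F0 in simp)
  also have "\<dots> = bound_c' / F * exp (- d\<^sup>2 / ((2 * c2) * m))"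
  proof -
    have "exp ((real q)\<^sup>2 * c2 / 2 - d\<^sup>2 / (2 * c2 * m))
        = exp ((real q)\<^sup>2 * c2 / 2) * exp (- d\<^sup>2 / ((2 * c2) * m))"
      unfolding exp_add[symmetric] by simp
    then show ?thesis by (simp only: bound_c'_def c2_def[symmetric] times_divide_eq_left mult.assoc)
  qed
  finally show ?thesis using up by (simp add: Vv_def Vw_def F_def r_def d_def c2_def)
qed

end

section \<open>Glued and cut graphs\<close>

text \<open>The connecting path stays in H, so its length bounds the distance of H.\<close>

lemma uniform_in_gdist:
  assumes "uniform_in H G"
  shows "\<exists>c>0. \<forall>x\<in>verts H. \<forall>y\<in>verts H. real (gdist H x y) \<le> c * real (gdist G x y)"
proof -
  obtain cu CU where CU: "0 < CU" and path: "\<forall>x\<in>verts H. \<forall>y\<in>verts H. \<exists>(k::nat) p.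
        p 0 = x \<and> p k = y \<and>
        (\<forall>j\<le>k. p j \<in> verts H) \<and> (\<forall>j<k. (p j, p (Suc j)) \<in> edges H) \<and>
        real k \<le> CU * real (gdist G x y) \<and>
        (\<forall>j\<le>k. \<forall>z\<in>verts G - verts H. real (gdist G (p j) z) \<ge> cu * (1 + real (min j (k - j))))"
    using assms unfolding uniform_in_def by (elim exE conjE)
  have "real (gdist H x y) \<le> CU * gdist G x y" if xy: "x \<in> verts H" "y \<in> verts H" for x y
  proof -
    obtain k p where p: "p 0 = x" "p k = y" "\<forall>j<k. (p j, p (Suc j)) \<in> edges H" "real k \<le> CU * real (gdist G x y)"
      using path[rule_format, OF xy] by (elim exE conjE)
    then have "(x, y) \<in> edges H ^^ k" using relpow_fun_conv[of x y k "edges H"] by blast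
    then have "gdist H x y \<le> k" by (rule gdist_le)
    then show ?thesis using p(4) by linarith
  qed
  then show ?thesis using CU by blast
qed

text \<open>The interface through which glued and cut graphs both reach \<open>book\<close>.\<close>

definition comparable_pages :: "'a wgraph \<Rightarrow> (nat \<Rightarrow> 'a wgraph) \<Rightarrow> nat \<Rightarrow> real \<Rightarrow> bool" where
  "comparable_pages G P l K \<longleftrightarrow>
    weighted_graph G \<and> (\<forall>i\<in>{1..l}. weighted_graph (P i) \<and> verts (P i) \<subseteq> verts G \<and> edges (P i) \<subseteq> edges G)
    \<and> verts (P 0) \<subseteq> verts G \<and> verts G \<subseteq> verts (P 0) \<union> (\<Union>i\<in>{1..l}. verts (P i))
    \<and> 1 \<le> K \<and> (\<forall>i\<in>{1..l}. \<forall>x\<in>verts (P i). vw (P i) x \<le> K * vw G x \<and> vw G x \<le> K * vw (P i) x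
         \<and> (\<forall>y\<in>verts (P i). ew (P i) x y \<le> K * ew G x y))"

lemma book_exists:
  fixes \<Gamma> :: "'a wgraph" and P :: "nat \<Rightarrow> 'a wgraph" and l :: nat and \<delta> K :: real
  assumes cmp: "comparable_pages \<Gamma> P l K" and l: "1 \<le> l" and delta: "0 < \<delta>"
    and bl: "book_like \<delta> \<Gamma> P l"
    and H: "\<forall>i\<in>{1..l}. harnack (P i) \<and> uniform_in (P i) \<Gamma>"
  shows "\<exists>U Ce Cc q \<kappa> Cp. book \<Gamma> P l \<delta> K U Ce Cc q \<kappa> Cp"
proof -
  note c = cmp[unfolded comparable_pages_def]
  have G: "weighted_graph \<Gamma>" and spine: "verts (P 0) \<subseteq> verts \<Gamma>"
    and all: "verts \<Gamma> \<subseteq> verts (P 0) \<union> (\<Union>i\<in>{1..l}. verts (P i))" and K1: "1 \<le> K"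
    using c by simp_all
  have pages: "weighted_graph (P i)" "verts (P i) \<subseteq> verts \<Gamma>" "edges (P i) \<subseteq> edges \<Gamma>" if "i \<in> {1..l}" for i
    using c that by blast+
  have K: "vw (P i) x \<le> K * vw \<Gamma> x" "vw \<Gamma> x \<le> K * vw (P i) x" if "i \<in> {1..l}" "x \<in> verts (P i)" for i x
    using c that by blast+
  have K': "ew (P i) x y \<le> K * ew \<Gamma> x y" if "i \<in> {1..l}" "x \<in> verts (P i)" "y \<in> verts (P i)" for i x y
    using c that by blast
  interpret wgr \<Gamma> by unfold_locales (rule G)
  obtain Ce where Ce: "0 < Ce" "Ce < 1" "\<And>x. x \<in> verts \<Gamma> \<Longrightarrow> (\<Sum>y\<in>nbrs \<Gamma> x. ew \<Gamma> x y) \<le> (1 - Ce) * vw \<Gamma> x"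
    using weighted_graphD(7) by (auto simp: uniformly_lazy_def)
  obtain Cc where Cc: "1 < Cc" "\<And>x y. x \<in> verts \<Gamma> \<Longrightarrow> y \<in> nbrs \<Gamma> x \<Longrightarrow> 1 / Cc \<le> ew \<Gamma> x y / vw \<Gamma> x"
    using weighted_graphD(6) by (auto simp: controlled_def)
  have Cc': "vw \<Gamma> x \<le> Cc * ew \<Gamma> x y" if "(x, y) \<in> edges \<Gamma>" for x y
  proof -
    have x: "x \<in> verts \<Gamma>" using edgeD that by auto
    have "1 / Cc \<le> ew \<Gamma> x y / vw \<Gamma> x" using Cc(2)[OF x] that by (simp add: nbrs_def)
    then show ?thesis using weighted_graphD(8)[OF x] Cc(1) by (simp add: field_simps)
  qed
  have "\<exists>q. dbl_exp (P i) q" if "i \<in> {1..l}" for i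
  proof -
    interpret p: wgr "P i" by unfold_locales (rule pages(1)[OF that])
    have "doubling (P i)" using H that by (simp add: harnack_def)
    then show ?thesis using p.doubling_dbl_exp by blast
  qed
  then obtain q0 where q0: "\<And>i. i \<in> {1..l} \<Longrightarrow> dbl_exp (P i) (q0 i)" by metis
  \<comment> \<open>There are finitely many pages, so a sum dominates all their constants;
    \<open>U\<close> below is formed in the same way.\<close>
  define q where "q = (\<Sum>i\<in>{1..l}. q0 i)"
  have q: "dbl_exp (P i) q" if i: "i \<in> {1..l}" for i
  proof -
    interpret p: wgr "P i" by unfold_locales (rule pages(1)[OF i])
    have "q0 i \<le> q" unfolding q_def by (rule member_le_sum[OF i]) auto
    then show ?thesis using p.dbl_exp_mono[OF q0[OF i]] by simp
  qed
  have "\<forall>i\<in>{1..l}. \<exists>c>0. \<forall>x\<in>verts (P i). \<forall>y\<in>verts (P i). real (gdist (P i) x y) \<le> c * real (gdist \<Gamma> x y)"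
    using H uniform_in_gdist by blast
  from bchoice[OF this] obtain U0 :: "nat \<Rightarrow> real" where U0: "\<forall>i\<in>{1..l}. 0 < U0 i \<and>
    (\<forall>x\<in>verts (P i). \<forall>y\<in>verts (P i). real (gdist (P i) x y) \<le> U0 i * real (gdist \<Gamma> x y))"
    by (elim exE)
  define U where "U = 1 + (\<Sum>i\<in>{1..l}. U0 i)"
  have U0p: "0 \<le> U0 i" if "i \<in> {1..l}" for i using U0 that by (blast intro: less_imp_le)
  then have "0 \<le> (\<Sum>i\<in>{1..l}. U0 i)" by (rule sum_nonneg)
  then have U: "1 \<le> U" unfolding U_def by simp
  have U': "real (gdist (P i) x y) \<le> U * gdist \<Gamma> x y"
    if i: "i \<in> {1..l}" and xy: "x \<in> verts (P i)" "y \<in> verts (P i)" for i x y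
  proof -
    have "U0 i \<le> (\<Sum>i\<in>{1..l}. U0 i)" using U0p by (intro member_le_sum[OF i]) auto
    then have "U0 i * gdist \<Gamma> x y \<le> U * gdist \<Gamma> x y" unfolding U_def by (intro mult_right_mono) auto
    moreover have "real (gdist (P i) x y) \<le> U0 i * real (gdist \<Gamma> x y)" using U0 i xy by blast
    ultimately show ?thesis by linarith
  qed
  have "\<exists>p. 0 < fst p \<and> 1 \<le> snd p \<and> poincare_with (P i) (fst p) (snd p)" if "i \<in> {1..l}" for i
  proof -
    have "poincare (P i)" using H that by (simp add: harnack_def)
    then obtain c k where "0 < c" "1 \<le> k" "poincare_with (P i) c k"
      unfolding poincare_def poincare_with_def by (elim exE conjE)
    then show ?thesis by (intro exI[of _ "(c, k)"]) simp
  qed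
  then have "\<forall>i\<in>{1..l}. \<exists>p. 0 < fst p \<and> 1 \<le> snd p \<and> poincare_with (P i) (fst p) (snd p)" by blast
  from bchoice[OF this] obtain p where
    p: "\<forall>i\<in>{1..l}. 0 < fst (p i) \<and> 1 \<le> snd (p i) \<and> poincare_with (P i) (fst (p i)) (snd (p i))"
    by (elim exE)
  have cover: "\<exists>i\<in>{1..l}. \<exists>u\<in>verts (P i). real (gdist \<Gamma> x u) \<le> \<delta>" if x: "x \<in> verts \<Gamma>" for x
  proof (cases "x \<in> verts (P 0)")
    case True
    moreover have "1 \<in> {1..l}" using l by simp
    ultimately show ?thesis using bl unfolding book_like_def by blast
  next
    case False
    then obtain i where "i \<in> {1..l}" "x \<in> verts (P i)" using all x by blast
    moreover have "real (gdist \<Gamma> x x) \<le> \<delta>" using delta by simp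
    ultimately show ?thesis by blast
  qed
  have "book \<Gamma> P l \<delta> K U Ce Cc q (\<lambda>i. snd (p i)) (\<lambda>i. fst (p i))"
  proof unfold_locales
    show "\<exists>u\<in>verts (P i). real (gdist \<Gamma> v u) \<le> \<delta>" if "v \<in> verts (P 0)" "i \<in> {1..l}" for v i
      using bl that unfolding book_like_def by blast
    show "0 < fst (p i)" "1 \<le> snd (p i)" "poincare_with (P i) (fst (p i)) (snd (p i))" if "i \<in> {1..l}" for i
      using p that by blast+
    show "\<exists>i\<in>{1..l}. \<exists>u\<in>verts (P i). real (gdist \<Gamma> x u) \<le> \<delta>" if "x \<in> verts \<Gamma>" for x
      using that by (rule cover)
    show "real (gdist (P i) x y) \<le> U * real (gdist \<Gamma> x y)"
      if "i \<in> {1..l}" "x \<in> verts (P i)" "y \<in> verts (P i)" for i x y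
      using that by (rule U')
    show "dbl_exp (P i) q" if "i \<in> {1..l}" for i using that by (rule q)
    show "(\<Sum>y\<in>nbrs \<Gamma> x. ew \<Gamma> x y) \<le> (1 - Ce) * vw \<Gamma> x" if "x \<in> verts \<Gamma>" for x
      using that by (rule Ce(3))
    show "vw \<Gamma> x \<le> Cc * ew \<Gamma> x y" if "(x, y) \<in> edges \<Gamma>" for x y using that by (rule Cc')
    show "weighted_graph (P i)" "verts (P i) \<subseteq> verts \<Gamma>" "edges (P i) \<subseteq> edges \<Gamma>" if "i \<in> {1..l}" for i
      using that by (rule pages)+
    show "vw (P i) x \<le> K * vw \<Gamma> x" "vw \<Gamma> x \<le> K * vw (P i) x"
      if "i \<in> {1..l}" "x \<in> verts (P i)" for i x
      using that by (rule K)+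
    show "ew (P i) x y \<le> K * ew \<Gamma> x y"
      if "i \<in> {1..l}" "x \<in> verts (P i)" "y \<in> verts (P i)" for i x y
      using that by (rule K')
  qed (fact l delta U Ce(1) Ce(2) Cc(1) K1 spine)+
  then show ?thesis by (intro exI)
qed

section \<open>Comparability for both constructions\<close>

text \<open>A vertex off the spine belongs to its own component and thereby to a page. The weight
  bounds are part of the definition; the exception for weightless vertices concerns index 0
  only.\<close>

lemma cut_comparable_pages:
  assumes cut: "cut G P l" and l: "1 \<le> l"
  shows "\<exists>K. comparable_pages G P l K"
proof -
  note c = cut[unfolded cut_def]
  note c_weighted = c[THEN conjunct1] and c_spine = c[THEN conjunct2, THEN conjunct1] and c_comp = c[THEN conjunct2, THEN conjunct2, THEN conjunct1]
    and c_pages = c[THEN conjunct2, THEN conjunct2, THEN conjunct2, THEN conjunct2, THEN conjunct1] and c_edges = c[THEN conjunct2, THEN conjunct2, THEN conjunct2, THEN conjunct2, THEN conjunct2, THEN conjunct1]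
    and c_weights = c[THEN conjunct2, THEN conjunct2, THEN conjunct2, THEN conjunct2, THEN conjunct2, THEN conjunct2, THEN conjunct1]
  have G: "weighted_graph G" and sp: "verts (P 0) \<subseteq> verts G"
    and pw: "\<And>i. i \<in> {1..l} \<Longrightarrow> weighted_graph (P i)"
    and ed: "\<And>i. i \<le> l \<Longrightarrow> edges (P i) = edges G \<inter> verts (P i) \<times> verts (P i)"
    using c_weighted c_spine c_pages c_edges by blast+
  interpret wgr G by unfold_locales (rule G)
  obtain Ki where bij: "bij_betw Ki {1..l} (graph_components G (verts G - verts (P 0)))"
    and Ki: "\<And>i. i \<in> {1..l} \<Longrightarrow> verts (P i) = Ki i \<union> {x \<in> verts (P 0). \<exists>y\<in>Ki i. (x, y) \<in> edges G}"
    using c_comp by blast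
  obtain cB CB where cB: "0 < cB" "0 < CB" and wts: "\<forall>i\<le>l.
        (\<forall>x\<in>verts (P i).
           (cB * vw G x \<le> vw (P i) x \<and> vw (P i) x \<le> CB * vw G x) \<or>
           (i = 0 \<and> vw (P 0) x = 0 \<and> nbrs (P 0) x = {})) \<and>
        (\<forall>(x, y)\<in>edges (P i). cB * ew G x y \<le> ew (P i) x y \<and> ew (P i) x y \<le> CB * ew G x y)"
    using c_weights by (elim exE conjE)
  have img: "Ki ` {1..l} = graph_components G (verts G - verts (P 0))"
    using bij by (simp add: bij_betw_def)
  have comp: "C \<subseteq> verts G" if "C \<in> graph_components G (verts G - verts (P 0))" for C
  proof -
    obtain x where x: "x \<in> verts G - verts (P 0)"
      "C = {y. (x, y) \<in> (edges G \<inter> (verts G - verts (P 0)) \<times> (verts G - verts (P 0)))\<^sup>*}"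
      using \<open>C \<in> _\<close> unfolding graph_components_def by blast
    have "y \<in> verts G" if "(x, y) \<in> (edges G \<inter> (verts G - verts (P 0)) \<times> (verts G - verts (P 0)))\<^sup>*" for y
      using that by (induction rule: rtrancl_induct) (use x in auto)
    then show ?thesis using x by auto
  qed
  have pv: "verts (P i) \<subseteq> verts G" if i: "i \<in> {1..l}" for i
    using Ki[OF i] comp[of "Ki i"] img i sp by blast
  have cover: "verts G \<subseteq> verts (P 0) \<union> (\<Union>i\<in>{1..l}. verts (P i))"
  proof
    fix x assume x: "x \<in> verts G"
    show "x \<in> verts (P 0) \<union> (\<Union>i\<in>{1..l}. verts (P i))"
    proof (cases "x \<in> verts (P 0)")
      case False
      let ?C = "{y. (x, y) \<in> (edges G \<inter> (verts G - verts (P 0)) \<times> (verts G - verts (P 0)))\<^sup>*}"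
      have "?C \<in> graph_components G (verts G - verts (P 0))"
        using x False unfolding graph_components_def by blast
      then obtain i where "i \<in> {1..l}" "Ki i = ?C" using img by (metis (no_types, lifting) imageE)
      moreover have "x \<in> ?C" by simp
      ultimately show ?thesis using Ki by blast
    qed simp
  qed
  define K where "K = 1 + CB + 1 / cB"
  have K1: "1 \<le> K" "CB \<le> K" "1 / cB \<le> K" using cB by (auto simp: K_def)
  have "vw (P i) x \<le> K * vw G x \<and> vw G x \<le> K * vw (P i) x \<and> (\<forall>y\<in>verts (P i). ew (P i) x y \<le> K * ew G x y)"
    if i: "i \<in> {1..l}" and x: "x \<in> verts (P i)" for i x
  proof -
    interpret p: wgr "P i" by unfold_locales (rule pw[OF i])
    have il: "i \<le> l" "i \<noteq> 0" using i by auto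
    have xG: "0 < vw G x" using weighted_graphD(8) pv[OF i] x by auto
    have b: "cB * vw G x \<le> vw (P i) x" "vw (P i) x \<le> CB * vw G x" using wts il x by auto
    have "CB * vw G x \<le> K * vw G x" using K1 xG by (intro mult_right_mono) auto
    moreover have "vw G x \<le> 1 / cB * vw (P i) x" using b(1) cB by (simp add: field_simps)
    moreover have "1 / cB * vw (P i) x \<le> K * vw (P i) x" using K1 p.weighted_graphD(8)[OF x] by (intro mult_right_mono) auto
    moreover have "ew (P i) x y \<le> K * ew G x y" if y: "y \<in> verts (P i)" for y
    proof -
      have e0: "0 \<le> ew G x y" using ew_nonneg pv[OF i] x y by auto
      show ?thesis
      proof (cases "(x, y) \<in> edges (P i)")
        case True
        then have "ew (P i) x y \<le> CB * ew G x y" using wts il by auto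
        also have "\<dots> \<le> K * ew G x y" using K1 e0 by (intro mult_right_mono) auto
        finally show ?thesis .
      next
        case False
        then show ?thesis using p.ew_eq_0[OF x y] e0 K1 by simp
      qed
    qed
    ultimately show ?thesis using b by force
  qed
  then show ?thesis
    unfolding comparable_pages_def using G sp cover K1(1) pw pv ed by (intro exI[of _ K]) auto
qed

text \<open>The standing assumptions hold for the parts and must be rebuilt for their sum. Laziness
  and subordination add up; controlled weights do not, since an edge may come from one part while
  the vertex weight collects all of them. The identification constants make these contributions
  comparable, and there are at most l + 1.\<close>

lemma glued_comparable_pages:
  assumes gl: "glued G P l" and l: "1 \<le> l"
  shows "\<exists>K. comparable_pages G P l K"
proof -
  note g = gl[unfolded glued_def]
  note g_spine = g[THEN conjunct1] and g_pages = g[THEN conjunct2, THEN conjunct1] and g_disj = g[THEN conjunct2, THEN conjunct2, THEN conjunct1]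
    and g_ident = g[THEN conjunct2, THEN conjunct2, THEN conjunct2, THEN conjunct1] and g_verts = g[THEN conjunct2, THEN conjunct2, THEN conjunct2, THEN conjunct2, THEN conjunct1]
    and g_edges = g[THEN conjunct2, THEN conjunct2, THEN conjunct2, THEN conjunct2, THEN conjunct2, THEN conjunct1]
    and g_vw = g[THEN conjunct2, THEN conjunct2, THEN conjunct2, THEN conjunct2, THEN conjunct2, THEN conjunct2, THEN conjunct1]
    and g_ew = g[THEN conjunct2, THEN conjunct2, THEN conjunct2, THEN conjunct2, THEN conjunct2, THEN conjunct2, THEN conjunct2, THEN conjunct1]
    and g_conn = g[THEN conjunct2, THEN conjunct2, THEN conjunct2, THEN conjunct2, THEN conjunct2, THEN conjunct2, THEN conjunct2, THEN conjunct2, THEN conjunct1]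
  note sg = g_spine and vG = g_verts and eG = g_edges and conn = g_conn
    and vwG = g_vw[rule_format] and ewG = g_ew[rule_format] and disj = g_disj[rule_format]
  have pw: "weighted_graph (P i)" and inf: "infinite (verts (P i))" if "i \<in> {1..l}" for i
    using g_pages that by blast+
  obtain cI CI where cI: "0 < cI" "0 < CI"
    and id1: "\<And>i x. i \<in> {1..l} \<Longrightarrow> x \<in> verts (P i) \<Longrightarrow> x \<in> verts (P 0) \<Longrightarrow> vw (P 0) x \<noteq> 0 \<Longrightarrow>
           cI * vw (P 0) x \<le> vw (P i) x \<and> vw (P i) x \<le> CI * vw (P 0) x"
    and id2: "\<And>i j x. i \<in> {1..l} \<Longrightarrow> j \<in> {1..l} \<Longrightarrow> x \<in> verts (P i) \<Longrightarrow> x \<in> verts (P j) \<Longrightarrow> x \<in> verts (P 0) \<Longrightarrow>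
           vw (P 0) x = 0 \<Longrightarrow> vw (P i) x \<le> CI * vw (P j) x"
  proof -
    obtain cI CI where "0 < cI" "0 < CI" "\<forall>i\<in>{1..l}. \<forall>x\<in>verts (P i) \<inter> verts (P 0). vw (P 0) x \<noteq> 0 \<longrightarrow>
           cI * vw (P 0) x \<le> vw (P i) x \<and> vw (P i) x \<le> CI * vw (P 0) x"
      "\<forall>i\<in>{1..l}. \<forall>j\<in>{1..l}. \<forall>x\<in>verts (P i) \<inter> verts (P j) \<inter> verts (P 0).
           vw (P 0) x = 0 \<longrightarrow> cI * vw (P j) x \<le> vw (P i) x \<and> vw (P i) x \<le> CI * vw (P j) x"
      using g_ident by (elim exE conjE)
    then show ?thesis using that by simp
  qed
  have st: "standing_weights (P i)" if "i \<le> l" for i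
    using sg pw[of i] that unfolding spine_graph_def weighted_graph_def by (cases "i = 0") auto
  have simp: "edges (P i) \<subseteq> verts (P i) \<times> verts (P i)" "sym (edges (P i))" "irrefl (edges (P i))"
    if "i \<le> l" for i using st[OF that] by (auto simp: standing_weights_def simple_graph_def)
  have ad: "ew (P i) x y = ew (P i) y x" "0 \<le> ew (P i) x y" "ew (P i) x y \<noteq> 0 \<longleftrightarrow> (x, y) \<in> edges (P i)"
    if "i \<le> l" "x \<in> verts (P i)" "y \<in> verts (P i)" for i x y
    using st[OF that(1)] that(2,3) by (auto simp: standing_weights_def adapted_def)
  have fin: "finite (nbrs (P i) x)" if "i \<le> l" "x \<in> verts (P i)" for i x
    using st[OF that(1)] that(2) by (auto simp: standing_weights_def subordinate_def)
  have vpos: "0 < vw (P i) x" if "i \<in> {1..l}" "x \<in> verts (P i)" for i x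
    using pw[OF that(1)] that(2) by (simp add: weighted_graph_def)
  have vnn: "0 \<le> vw (P i) x" if "i \<le> l" "x \<in> verts (P i)" for i x
    using vpos[of i x] sg that unfolding spine_graph_def by (cases "i = 0") (auto simp: less_imp_le)
  define I where "I x = {i. i \<le> l \<and> x \<in> verts (P i)}" for x
  have Ifin: "finite (I x)" for x by (simp add: I_def)
  have nbG: "nbrs G x = (\<Union>i\<in>I x. nbrs (P i) x)" for x
    using simp(1) by (fastforce simp: nbrs_def eG I_def)
  have vwI: "vw G x = (\<Sum>i\<in>I x. vw (P i) x)" if "x \<in> verts G" for x using vwG[OF that] by (simp add: I_def)
  have ewI: "ew G x y = (\<Sum>i\<in>I x. if y \<in> verts (P i) then ew (P i) x y else 0)"
    if "x \<in> verts G" "y \<in> verts G" for x y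
    unfolding ewG[OF that] by (rule sum.mono_neutral_cong_left) (auto simp: I_def)
  have VI: "x \<in> verts G" if "i \<in> I x" for x i using that by (auto simp: I_def vG)
  \<comment> \<open>The summands cover the cases of \<open>cmp\<close>: equal indices, spine to page
    or two pages over a weightless spine vertex (CI), two pages over a spine vertex of positive
    weight (CI / cI), and page to spine (1 / cI).\<close>
  define M where "M = 1 + CI + CI / cI + 1 / cI"
  have M: "1 \<le> M" "CI \<le> M" "CI / cI \<le> M" "1 / cI \<le> M" using cI by (auto simp: M_def)
  have cmp: "vw (P j) x \<le> M * vw (P i) x" if i: "i \<in> I x" and j: "j \<in> I x" and p: "0 < vw (P i) x" for i j x
  proof -
    have xi: "i \<le> l" "x \<in> verts (P i)" and xj: "j \<le> l" "x \<in> verts (P j)" using i j by (auto simp: I_def)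
    have up: "vw (P j) x \<le> M * vw (P i) x" if "vw (P j) x \<le> c * vw (P i) x" "c \<le> M" for c
      using that p by (smt (verit) mult_right_mono)
    show ?thesis
    proof (cases "i = j")
      case True
      then show ?thesis using up[of 1] M by simp
    next
      case ij: False
      show ?thesis
      proof (cases "vw (P 0) x = 0 \<or> x \<notin> verts (P 0)")
        case True
        then have i0: "i \<in> {1..l}" using p xi by (cases "i = 0") auto
        show ?thesis
        proof (cases "j = 0")
          case True
          then have "vw (P j) x = 0" using \<open>vw (P 0) x = 0 \<or> x \<notin> verts (P 0)\<close> xj by auto
          then show ?thesis using M p by simp
        next
          case False
          then have j0: "j \<in> {1..l}" using xj by auto
          have x0: "x \<in> verts (P 0)" using disj[OF i0 j0 ij] xi xj by auto
          then have "vw (P 0) x = 0" using True by auto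
          then show ?thesis using up[of CI] id2[OF j0 i0 xj(2) xi(2) x0] M by simp
        qed
      next
        case False
        then have x0: "x \<in> verts (P 0)" "vw (P 0) x \<noteq> 0" by auto
        have v0: "0 < vw (P 0) x" using x0 vnn[of 0 x] by auto
        show ?thesis
        proof (cases "j = 0")
          case True
          then have i0: "i \<in> {1..l}" using ij xi by auto
          have "vw (P j) x \<le> 1 / cI * vw (P i) x"
            using id1[OF i0 xi(2) x0] cI True by (simp add: field_simps)
          then show ?thesis using up M by blast
        next
          case False
          then have j0: "j \<in> {1..l}" using xj by auto
          have 1: "vw (P j) x \<le> CI * vw (P 0) x" using id1[OF j0 xj(2) x0] by simp
          show ?thesis
          proof (cases "i = 0")
            case True
            then show ?thesis using 1 up M by blast
          next
            case False
            then have i0: "i \<in> {1..l}" using xi by auto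
            have "vw (P 0) x \<le> vw (P i) x / cI" using id1[OF i0 xi(2) x0] cI by (simp add: field_simps)
            then have "CI * vw (P 0) x \<le> CI * (vw (P i) x / cI)" using cI by (intro mult_left_mono) auto
            then have "vw (P j) x \<le> CI / cI * vw (P i) x" using 1 by simp
            then show ?thesis using up M by blast
          qed
        qed
      qed
    qed
  qed
  have vw_le: "vw (P i) x \<le> vw G x" if i: "i \<in> I x" for i x
    unfolding vwI[OF VI[OF i]] using vnn by (intro member_le_sum[OF i]) (auto simp: I_def)
  have vw_ge: "vw G x \<le> (real l + 1) * M * vw (P i) x" if i: "i \<in> I x" and p: "0 < vw (P i) x" for i x
  proof -
    have "vw G x \<le> (\<Sum>j\<in>I x. M * vw (P i) x)"
      unfolding vwI[OF VI[OF i]] using cmp[OF i _ p] by (rule sum_mono)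
    also have "\<dots> = real (card (I x)) * (M * vw (P i) x)" by simp
    also have "\<dots> \<le> (real l + 1) * (M * vw (P i) x)"
    proof (rule mult_right_mono)
      have "card (I x) \<le> card {..l}" by (rule card_mono) (auto simp: I_def)
      then show "real (card (I x)) \<le> real l + 1" by simp
    qed (use M p in auto)
    finally show ?thesis by (simp add: mult.assoc)
  qed
  have ew_le: "ew (P i) x y \<le> ew G x y" if i: "i \<in> I x" and y: "y \<in> verts (P i)" for i x y
  proof -
    have yG: "y \<in> verts G" using i y by (auto simp: I_def vG)
    have "(if y \<in> verts (P i) then ew (P i) x y else 0) \<le> ew G x y"
      unfolding ewI[OF VI[OF i] yG] using ad(2) by (intro member_le_sum[OF i]) (auto simp: I_def)
    then show ?thesis using y by simp
  qed
  have Gsimple: "simple_graph G"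
    unfolding simple_graph_def
  proof (intro conjI)
    show "edges G \<subseteq> verts G \<times> verts G" using simp(1) unfolding eG vG by blast
    show "sym (edges G)" using simp(2) unfolding eG sym_def by blast
    show "irrefl (edges G)" using simp(3) unfolding eG irrefl_def by blast
  qed
  have Gadapted: "adapted G"
    unfolding adapted_def
  proof (intro ballI conjI)
    fix x y assume xy: "x \<in> verts G" "y \<in> verts G"
    let ?J = "{i. i \<le> l \<and> x \<in> verts (P i) \<and> y \<in> verts (P i)}"
    have e: "ew G x y = (\<Sum>i\<in>?J. ew (P i) x y)" by (rule ewG[OF xy])
    have "ew G y x = (\<Sum>i\<in>?J. ew (P i) y x)" unfolding ewG[OF xy(2,1)] by (rule sum.cong) auto
    then show "ew G x y = ew G y x" unfolding e using ad(1) by (auto intro!: sum.cong)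
    show "0 \<le> ew G x y" unfolding e by (rule sum_nonneg) (use ad(2) in auto)
    have "ew G x y = 0 \<longleftrightarrow> (\<forall>i\<in>?J. ew (P i) x y = 0)"
      unfolding e by (rule sum_nonneg_eq_0_iff) (use ad(2) in auto)
    also have "\<dots> \<longleftrightarrow> (x, y) \<notin> edges G" using ad(3) simp(1) unfolding eG by blast
    finally show "(ew G x y \<noteq> 0) = ((x, y) \<in> edges G)" by simp
  qed
  have finG: "finite (nbrs G x)" for x unfolding nbG using Ifin fin by (auto simp: I_def)
  have sumG: "(\<Sum>y\<in>nbrs G x. ew G x y) = (\<Sum>i\<in>I x. \<Sum>y\<in>nbrs (P i) x. ew (P i) x y)" if x: "x \<in> verts G" for x
  proof -
    have nv: "nbrs G x \<subseteq> verts G" using Gsimple by (auto simp: simple_graph_def nbrs_def)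
    have "(\<Sum>y\<in>nbrs G x. ew G x y) = (\<Sum>y\<in>nbrs G x. \<Sum>i\<in>I x. if y \<in> verts (P i) then ew (P i) x y else 0)"
      using ewI[OF x] nv by (intro sum.cong) auto
    also have "\<dots> = (\<Sum>i\<in>I x. \<Sum>y\<in>nbrs G x. if y \<in> verts (P i) then ew (P i) x y else 0)" by (rule sum.swap)
    also have "\<dots> = (\<Sum>i\<in>I x. \<Sum>y\<in>nbrs (P i) x. ew (P i) x y)"
    proof (rule sum.cong[OF refl])
      fix i assume i: "i \<in> I x"
      then have il: "i \<le> l" "x \<in> verts (P i)" by (auto simp: I_def)
      show "(\<Sum>y\<in>nbrs G x. if y \<in> verts (P i) then ew (P i) x y else 0) = (\<Sum>y\<in>nbrs (P i) x. ew (P i) x y)"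
      proof (rule sum.mono_neutral_cong_right[OF finG])
        show "nbrs (P i) x \<subseteq> nbrs G x" using i nbG by blast
        show "\<forall>y\<in>nbrs G x - nbrs (P i) x. (if y \<in> verts (P i) then ew (P i) x y else 0) = 0"
          using ad(3)[OF il] by (auto simp: nbrs_def)
        show "(if y \<in> verts (P i) then ew (P i) x y else 0) = ew (P i) x y" if "y \<in> nbrs (P i) x" for y
          using that simp(1)[OF il(1)] by (auto simp: nbrs_def)
      qed
    qed
    finally show ?thesis .
  qed
  have "\<exists>c>0. c < 1 \<and> (\<forall>x\<in>verts (P i). (\<Sum>y\<in>nbrs (P i) x. ew (P i) x y) \<le> (1 - c) * vw (P i) x)"
    if "i \<le> l" for i using st[OF that] unfolding standing_weights_def uniformly_lazy_def by blast
  then obtain ce where ce: "\<And>i. i \<le> l \<Longrightarrow> 0 < ce i" "\<And>i. i \<le> l \<Longrightarrow> ce i < 1"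
    "\<And>i x. i \<le> l \<Longrightarrow> x \<in> verts (P i) \<Longrightarrow> (\<Sum>y\<in>nbrs (P i) x. ew (P i) x y) \<le> (1 - ce i) * vw (P i) x"
    by metis
  define Ce where "Ce = (MIN i\<in>{..l}. ce i)"
  have Ce: "Ce \<in> ce ` {..l}" unfolding Ce_def by (rule Min_in) auto
  then have Ce01: "0 < Ce" "Ce < 1" using ce by auto
  have lazyG: "(\<Sum>y\<in>nbrs G x. ew G x y) \<le> (1 - Ce) * vw G x" if x: "x \<in> verts G" for x
  proof -
    have "(\<Sum>i\<in>I x. \<Sum>y\<in>nbrs (P i) x. ew (P i) x y) \<le> (\<Sum>i\<in>I x. (1 - Ce) * vw (P i) x)"
    proof (rule sum_mono)
      fix i assume "i \<in> I x"
      then have il: "i \<le> l" "x \<in> verts (P i)" by (auto simp: I_def)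
      have "Ce \<le> ce i" unfolding Ce_def using il by (intro Min_le) auto
      then have "(1 - ce i) * vw (P i) x \<le> (1 - Ce) * vw (P i) x"
        using vnn[OF il] by (intro mult_right_mono) auto
      then show "(\<Sum>y\<in>nbrs (P i) x. ew (P i) x y) \<le> (1 - Ce) * vw (P i) x" using ce(3)[OF il] by linarith
    qed
    then show ?thesis unfolding sumG[OF x] vwI[OF x] by (simp add: sum_distrib_left)
  qed
  have vG0: "0 \<le> vw G x" if "x \<in> verts G" for x
    unfolding vwI[OF that] by (rule sum_nonneg) (use vnn in \<open>auto simp: I_def\<close>)
  have Gsub: "subordinate G"
    unfolding subordinate_def
  proof (intro ballI conjI)
    fix x assume x: "x \<in> verts G"
    have "(1 - Ce) * vw G x \<le> 1 * vw G x" using Ce01 vG0[OF x] by (intro mult_right_mono) auto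
    then show "(\<Sum>y\<in>nbrs G x. ew G x y) \<le> vw G x" using lazyG[OF x] by simp
  qed (rule finG)
  have "\<exists>c>1. \<forall>x\<in>verts (P i). \<forall>y\<in>nbrs (P i) x. ew (P i) x y / vw (P i) x \<ge> 1 / c" if "i \<le> l" for i
    using st[OF that] unfolding standing_weights_def controlled_def by blast
  then obtain cc where cc: "\<And>i. i \<le> l \<Longrightarrow> 1 < cc i"
    "\<And>i x y. i \<le> l \<Longrightarrow> x \<in> verts (P i) \<Longrightarrow> y \<in> nbrs (P i) x \<Longrightarrow> 1 / cc i \<le> ew (P i) x y / vw (P i) x"
    by metis
  define S where "S = (\<Sum>i\<in>{..l}. cc i)"
  have S: "cc i \<le> S" if "i \<le> l" for i
    unfolding S_def using that cc(1) by (intro member_le_sum) (auto intro: less_imp_le order_trans[OF zero_le_one])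
  have edge: "\<exists>i\<in>I x. y \<in> nbrs (P i) x \<and> 0 < vw (P i) x \<and> vw (P i) x \<le> S * ew G x y"
    if x: "x \<in> verts G" and y: "y \<in> nbrs G x" for x y
  proof -
    obtain i where i: "i \<in> I x" "y \<in> nbrs (P i) x" using y nbG by blast
    then have il: "i \<le> l" "x \<in> verts (P i)" by (auto simp: I_def)
    have yv: "y \<in> verts (P i)" using simp(1)[OF il(1)] i by (auto simp: nbrs_def)
    have c1: "1 < cc i" by (rule cc(1)[OF il(1)])
    have ge: "1 / cc i \<le> ew (P i) x y / vw (P i) x" by (rule cc(2)[OF il i(2)])
    \<comment> \<open>Division by zero yields 0, so a vanishing weight would contradict the positive
      lower bound 1 / cc i.\<close>
    have "vw (P i) x \<noteq> 0"
    proof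
      assume "vw (P i) x = 0"
      then have "1 / cc i \<le> 0" using ge by simp
      then show False using c1 by (simp add: divide_le_0_iff)
    qed
    then have p: "0 < vw (P i) x" using vnn[OF il] by simp
    have e: "0 \<le> ew (P i) x y" by (rule ad(2)[OF il yv])
    have "vw (P i) x \<le> cc i * ew (P i) x y" using ge p c1 by (simp add: field_simps)
    also have "\<dots> \<le> S * ew (P i) x y" using S[OF il(1)] e by (rule mult_right_mono)
    also have "\<dots> \<le> S * ew G x y" using ew_le[OF i(1) yv] S[OF il(1)] c1 by (intro mult_left_mono) auto
    finally show ?thesis using i p by blast
  qed
  have page1: "1 \<in> {1..l}" using l by simp
  have Gpos: "0 < vw G x" if x: "x \<in> verts G" for x
  proof (cases "\<exists>i\<in>{1..l}. x \<in> verts (P i)")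
    case True
    then obtain i where i: "i \<in> {1..l}" "x \<in> verts (P i)" by blast
    then have "i \<in> I x" by (simp add: I_def)
    then show ?thesis using vw_le vpos[OF i] by fastforce
  next
    case False
    \<comment> \<open>A vertex on no page could have weight 0 only if isolated in the spine. But G
      is connected and page 1 provides another vertex, so an edge starts at x, and its part has
      positive weight there.\<close>
    obtain y where y: "y \<in> verts (P 1)" using inf[OF page1] by (metis finite.emptyI ex_in_conv)
    then have yG: "y \<in> verts G" using page1 vG by auto
    have "x \<noteq> y" using False y page1 by blast
    moreover have "(x, y) \<in> (edges G \<inter> verts G \<times> verts G)\<^sup>*"
      using conn x yG by (auto simp: connected_in_def)
    ultimately obtain z where "(x, z) \<in> edges G" by (metis converse_rtranclE IntD1)
    then obtain i where "i \<in> I x" "0 < vw (P i) x" using edge[OF x, of z] by (auto simp: nbrs_def)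
    then show ?thesis using vw_le by fastforce
  qed
  define L where "L = (real l + 1) * M"
  have L1: "1 \<le> L"
  proof -
    have "1 * 1 \<le> L" unfolding L_def using M by (intro mult_mono) auto
    then show ?thesis by simp
  qed
  have S1: "1 < S" using S[of 0] cc(1)[of 0] by simp
  have Gcon: "controlled G"
    unfolding controlled_def
  proof (intro exI[of _ "L * S"] conjI ballI)
    have "1 * S \<le> L * S" using L1 S1 by (intro mult_right_mono) auto
    then show "1 < L * S" using S1 by linarith
    fix x y assume x: "x \<in> verts G" and y: "y \<in> nbrs G x"
    obtain i where i: "i \<in> I x" "0 < vw (P i) x" "vw (P i) x \<le> S * ew G x y" using edge[OF x y] by blast
    have "vw G x \<le> L * vw (P i) x" unfolding L_def by (rule vw_ge[OF i(1,2)])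
    also have "\<dots> \<le> L * (S * ew G x y)" using i(3) L1 by (intro mult_left_mono) auto
    finally show "1 / (L * S) \<le> ew G x y / vw G x"
      using Gpos[OF x] L1 S1 by (simp add: field_simps)
  qed
  have Glazy: "uniformly_lazy G" unfolding uniformly_lazy_def using Ce01 lazyG by blast
  have G: "weighted_graph G"
    unfolding weighted_graph_def standing_weights_def
    using Gsimple Gadapted Gsub Gcon Glazy Gpos conn by blast
  have "vw (P i) x \<le> L * vw G x \<and> vw G x \<le> L * vw (P i) x \<and> (\<forall>y\<in>verts (P i). ew (P i) x y \<le> L * ew G x y)"
    if i: "i \<in> {1..l}" and x: "x \<in> verts (P i)" for i x
  proof (intro conjI ballI)
    have iI: "i \<in> I x" using i x by (simp add: I_def)
    have "1 * vw G x \<le> L * vw G x" using L1 vG0[OF VI[OF iI]] by (intro mult_right_mono) auto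
    then show "vw (P i) x \<le> L * vw G x" using vw_le[OF iI] by simp
    show "vw G x \<le> L * vw (P i) x" unfolding L_def by (rule vw_ge[OF iI vpos[OF i x]])
    fix y assume y: "y \<in> verts (P i)"
    have "0 \<le> ew (P i) x y" using ad(2) i x y by simp
    then have "0 \<le> ew G x y" using ew_le[OF iI y] by simp
    then have "1 * ew G x y \<le> L * ew G x y" using L1 by (intro mult_right_mono) auto
    then show "ew (P i) x y \<le> L * ew G x y" using ew_le[OF iI y] by simp
  qed
  moreover have "verts G \<subseteq> verts (P 0) \<union> (\<Union>i\<in>{1..l}. verts (P i))"
  proof
    fix x assume "x \<in> verts G"
    then obtain i where "i \<le> l" "x \<in> verts (P i)" using vG by auto
    then show "x \<in> verts (P 0) \<union> (\<Union>i\<in>{1..l}. verts (P i))" by (cases "i = 0") auto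
  qed
  ultimately show ?thesis
    unfolding comparable_pages_def using G L1 pw by (intro exI[of _ L]) (auto simp: vG eG)
qed

theorem theorem4:
  fixes \<Gamma> :: "'a wgraph" and P :: "nat \<Rightarrow> 'a wgraph" and l :: nat and \<delta> :: real
  assumes "pages_and_spine \<Gamma> P l"
    and "\<delta> > 0"
    and "book_like \<delta> \<Gamma> P l"
    and "\<forall>i\<in>{1..l}. harnack (P i) \<and> uniform_in (P i) \<Gamma>"
  shows "\<exists>C>0. \<exists>c1>0. \<exists>c2>0. \<exists>c1'>0. \<exists>c2'>0.
    \<forall>v\<in>verts (P 0). \<forall>w\<in>verts (P 0). \<forall>m::nat. \<forall>u :: nat \<Rightarrow> 'a.
      real m \<ge> C * (real (gdist \<Gamma> v w) + \<delta>) \<longrightarrow>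
      (\<forall>i\<in>{1..l}. is_arg_min (gdist \<Gamma> v) (\<lambda>y. y \<in> verts (P i)) (u i)) \<longrightarrow>
        heat_kernel \<Gamma> m v w
          \<le> c1 / sqrt (Vmin \<Gamma> P l \<delta> v (sqrt (real m)) * Vmin \<Gamma> P l \<delta> w (sqrt (real m)))
             * exp (- (real (gdist \<Gamma> v w))\<^sup>2 / (c2 * real m)) \<and>
        c1 / sqrt (Vmin \<Gamma> P l \<delta> v (sqrt (real m)) * Vmin \<Gamma> P l \<delta> w (sqrt (real m)))
             * exp (- (real (gdist \<Gamma> v w))\<^sup>2 / (c2 * real m))
          \<le> c1' / (MIN i\<in>{1..l}. vol (P i) (u i) (sqrt (real m)))
             * exp (- (real (gdist \<Gamma> v w))\<^sup>2 / (c2' * real m))"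
proof -
  have l: "1 \<le> l" and gc: "glued \<Gamma> P l \<or> cut \<Gamma> P l" using assms(1) by (auto simp: pages_and_spine_def)
  then obtain K where "comparable_pages \<Gamma> P l K"
    using glued_comparable_pages[OF _ l] cut_comparable_pages[OF _ l] by (elim disjE) blast+
  from book_exists[OF this l assms(2-4)]
  obtain U Ce Cc q \<kappa> Cp where "book \<Gamma> P l \<delta> K U Ce Cc q \<kappa> Cp" by (elim exE)
  then interpret book \<Gamma> P l \<delta> K U Ce Cc q \<kappa> Cp .
  have pos: "0 < 1 + 4 / \<delta>" "0 < 4 * gauss_C" "0 < 2 * (4 * gauss_C)"
    using gauss_C assms(2) by (simp_all add: add_pos_pos)
  show ?thesis
    by (rule exI[of _ "1 + 4 / \<delta>"], rule conjI[OF pos(1)], rule exI[of _ bound_c],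
        rule conjI[OF bound_consts_pos(1)], rule exI[of _ "4 * gauss_C"], rule conjI[OF pos(2)],
        rule exI[of _ bound_c'], rule conjI[OF bound_consts_pos(2)],
        rule exI[of _ "2 * (4 * gauss_C)"], rule conjI[OF pos(3)],
        intro ballI allI impI, rule book_heat_kernel; assumption)
qed

end
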